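(* Let $\delta>0$, $\eta>0$, $\lambda>0$, and $\nu$ with $\nu\lceil\delta\rceil\in(0,1)$, and let $\omega>0$, $\gamma\ge0$, $0<\alpha\le1$, $0<\beta\le1$, with $0<\beta\lceil\gamma\rceil/\gamma-r\alpha<1$ for all $r=0,1,\dots,\lceil\gamma\rceil$ if $\gamma\ne0$. Let $\mathfrak{U}_t$, $t\ge0$, be the hitting-time process defined in the context. Furthermore let $N({}_\eta\mathfrak{V}_t^{\nu,\delta})$ be a homogeneous Poisson process $N$ of parameter $\lambda$, subordinated by the process ${}_\eta\mathfrak{V}_t^{\nu,\delta}$ defined in the context, and independent of $\mathfrak{U}_t$. Then the time-changed process $$\mathfrak{N}(t)=N\left({}_\eta\mathfrak{V}^{\nu,\delta}_{\mathfrak{U}_t}\right),\qquad t\ge0,$$ has state probabilities $p_k(t)=\mathbb{P}(\mathfrak{N}(t)=k)$, $k\ge0$, given by $$p_k(t)=\frac{(-1)^k}{k!}\sum_{j=0}^\infty(-t^\beta)^jE_{\alpha,\beta j+1}^{\gamma j}(-\omega t^\alpha)\sum_{r=0}^j(-\eta^\delta)^{j-r}\sum_{m=0}^\infty\binom{r\delta}{m}\eta^{\delta r-m}\lambda^{\nu m}\frac{\Gamma(\nu m+1)}{\Gamma(\nu m-k+1)} .$$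
   Context: A subordinator is a process $S_t$, $t\ge0$, starting from zero, with increasing paths and with independent and stationary increments; its Laplace exponent $\Phi_S$ is defined by $\mathbb{E}e^{-\mu S_t}=e^{-t\Phi_S(\mu)}$. For $a\in(0,1)$, an $a$-stable subordinator $V_t^a$ has Laplace exponent $\mu^a$; for $a=1$ it is the trivial case $V^1_t=t$. Let $n=\lceil\delta\rceil$. Let $V^{\nu r}_t$, $r=1,\dots,n$, be independent $\nu r$-stable subordinators and ${}_\eta\mathcal{V}_t^{\nu,n}=\sum_{r=1}^n\binom{n}{r}^{1/(\nu r)}\eta^{(n-r)/(\nu r)}V_t^{\nu r}$. Let $\mathscr{V}_t^{\delta/n}$ be a tempered $\delta/n$-stable subordinator, independent of the $V^{\nu r}$, with Laplace exponent $(\eta^n+\mu)^{\delta/n}-\eta^\delta$. Define ${}_\eta\mathfrak{V}_t^{\nu,\delta}={}_\eta\mathcal{V}^{\nu,n}_{\mathscr{V}_t^{\delta/n}}$; the Poisson process $N$ is independent of it. Let $W_t$ denote the process, given as a sum of subordinated independent stable subordinators, $$W_t=\sum_{r=0}^{\lceil\gamma\rceil}V^{\beta\frac{\lceil\gamma\rceil}{\gamma}-r\alpha}_{\Phi(t)},\qquad t\ge0,$$ where the random time change (depending on the summation index $r$) is $\Phi(t)=\binom{\lceil\gamma\rceil}{r}V_t^{\gamma/\lceil\gamma\rceil}$, $V_t^{\gamma/\lceil\gamma\rceil}$ is a stable subordinator independent of all the others, and $0<\beta\lceil\gamma\rceil/\gamma-r\alpha<1$ holds for each $r=0,1,\dots,\lceil\gamma\rceil$.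 The hitting-time process is $\mathfrak{U}_t=\inf\{s\ge0: W_s>t\}$, $t\ge0$. The generalized Mittag-Leffler function is $E_{\kappa,\varpi}^{c}(x)=\sum_{i=0}^\infty\frac{x^i(c)_i}{i!\,\Gamma(\kappa i+\varpi)}$, with $(c)_i$ the Pochhammer symbol. Here $\binom{x}{m}=x(x-1)\cdots(x-m+1)/m!$, and $1/\Gamma(x)=0$ for $x\in\{0,-1,-2,\dots\}$.
   Formalization: A factor binom(j,r) is added in the sum over r and a factor ω^r in the time change Φ(t), since the printed formula fails without them; each innermost series over m is assumed to converge; paths are taken right-continuous, and ⌈γ⌉/γ is read as 1 for γ=0. *)

theory Defs
  imports "HOL-Probability.Probability"
begin

section \<open>Processes indexed by nonnegative real time\<close>

text \<open>
  A process is a function from time and sample point to its state.  Only the times \<open>t \<ge> 0\<close> are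
  meaningful.  The path of a process is a random element of the product space over \<open>{0..}\<close>, and
  independence of processes means independence of their paths.
\<close>

definition path_space :: "(real \<Rightarrow> real) measure" where
  "path_space = (\<Pi>\<^sub>M t\<in>{0..}. borel)"

definition process_path :: "(real \<Rightarrow> 'a \<Rightarrow> real) \<Rightarrow> 'a \<Rightarrow> real \<Rightarrow> real" where
  "process_path X x = (\<lambda>t\<in>{0..}. X t x)"

definition independent_processes ::
  "'a measure \<Rightarrow> 'i set \<Rightarrow> ('i \<Rightarrow> real \<Rightarrow> 'a \<Rightarrow> real) \<Rightarrow> bool" where
  "independent_processes M I X \<longleftrightarrow>
     prob_space.indep_vars M (\<lambda>_. path_space) (\<lambda>i. process_path (X i)) I"

definition independent_process_pair ::
  "'a measure \<Rightarrow> (real \<Rightarrow> 'a \<Rightarrow> real) \<Rightarrow> (real \<Rightarrow> 'a \<Rightarrow> real) \<Rightarrow> bool" where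
  "independent_process_pair M X Y \<longleftrightarrow>
     prob_space.indep_var M path_space (process_path X) path_space (process_path Y)"

definition independent_increments :: "'a measure \<Rightarrow> (real \<Rightarrow> 'a \<Rightarrow> real) \<Rightarrow> bool" where
  "independent_increments M X \<longleftrightarrow>
     (\<forall>\<tau> :: nat \<Rightarrow> real. mono \<tau> \<longrightarrow> 0 \<le> \<tau> 0 \<longrightarrow>
        prob_space.indep_vars M (\<lambda>_. borel) (\<lambda>i x. X (\<tau> (Suc i)) x - X (\<tau> i) x) UNIV)"

text \<open>
  As usual for Levy processes, paths are taken right-continuous; without a regularity
  requirement a process evaluated at a random time need not be a random variable.
\<close>

definition increasing_paths_from_zero :: "'a measure \<Rightarrow> (real \<Rightarrow> 'a \<Rightarrow> real) \<Rightarrow> bool" where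
  "increasing_paths_from_zero M X \<longleftrightarrow>
     (\<forall>t\<ge>0. X t \<in> borel_measurable M) \<and>
     (\<forall>x\<in>space M. X 0 x = 0 \<and> mono_on {0..} (\<lambda>t. X t x) \<and>
        (\<forall>t\<ge>0. continuous (at_right t) (\<lambda>s. X s x)))"

definition subordinator :: "'a measure \<Rightarrow> (real \<Rightarrow> 'a \<Rightarrow> real) \<Rightarrow> bool" where
  "subordinator M S \<longleftrightarrow>
     increasing_paths_from_zero M S \<and> independent_increments M S \<and>
     (\<forall>s\<ge>0. \<forall>t\<ge>0. distr M borel (\<lambda>x. S (s + t) x - S s x) = distr M borel (S t))"

definition has_laplace_exponent ::
  "'a measure \<Rightarrow> (real \<Rightarrow> 'a \<Rightarrow> real) \<Rightarrow> (real \<Rightarrow> real) \<Rightarrow> bool" where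
  "has_laplace_exponent M S \<Phi> \<longleftrightarrow>
     (\<forall>t\<ge>0. \<forall>\<mu>\<ge>0. (LINT x|M. exp (- \<mu> * S t x)) = exp (- t * \<Phi> \<mu>))"

text \<open>For \<open>a = 1\<close> the Laplace exponent forces the trivial subordinator \<open>S t = t\<close>.\<close>

definition stable_subordinator :: "'a measure \<Rightarrow> real \<Rightarrow> (real \<Rightarrow> 'a \<Rightarrow> real) \<Rightarrow> bool" where
  "stable_subordinator M a S \<longleftrightarrow>
     0 < a \<and> a \<le> 1 \<and> subordinator M S \<and> has_laplace_exponent M S (\<lambda>\<mu>. \<mu> powr a)"

definition poisson_process :: "'a measure \<Rightarrow> real \<Rightarrow> (real \<Rightarrow> 'a \<Rightarrow> nat) \<Rightarrow> bool" where
  "poisson_process M rate N \<longleftrightarrow>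
     increasing_paths_from_zero M (\<lambda>t x. real (N t x)) \<and>
     independent_increments M (\<lambda>t x. real (N t x)) \<and>
     (\<forall>s\<ge>0. \<forall>t>s. distr M (count_space UNIV) (\<lambda>x. N t x - N s x)
        = measure_pmf (poisson_pmf (rate * (t - s))))"

text \<open>
  The infimum is taken in the extended reals, so that the infimum of the empty set is infinity.
  The coercion back to the reals sends infinity to \<open>0\<close>; for the processes considered below
  this happens on a null set only.
\<close>

definition hitting_time :: "(real \<Rightarrow> 'a \<Rightarrow> real) \<Rightarrow> real \<Rightarrow> 'a \<Rightarrow> real" where
  "hitting_time W t x = real_of_ereal (INF s\<in>{s. 0 \<le> s \<and> t < W s x}. ereal s)"


section \<open>The two subordinated sums\<close>

text \<open>Here \<open>V r\<close> is the \<open>\<nu> r\<close>-stable subordinator.\<close>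

definition stable_sum ::
  "real \<Rightarrow> real \<Rightarrow> nat \<Rightarrow> (nat \<Rightarrow> real \<Rightarrow> 'a \<Rightarrow> real) \<Rightarrow> real \<Rightarrow> 'a \<Rightarrow> real" where
  "stable_sum \<eta> \<nu> n V t x =
     (\<Sum>r=1..n. real (n choose r) powr (1 / (\<nu> * real r))
        * \<eta> powr (real (n - r) / (\<nu> * real r)) * V r t x)"

definition subordinated_stable_sum ::
  "real \<Rightarrow> real \<Rightarrow> nat \<Rightarrow> (nat \<Rightarrow> real \<Rightarrow> 'a \<Rightarrow> real) \<Rightarrow> (real \<Rightarrow> 'a \<Rightarrow> real)
     \<Rightarrow> real \<Rightarrow> 'a \<Rightarrow> real" where
  "subordinated_stable_sum \<eta> \<nu> n V T t x = stable_sum \<eta> \<nu> n V (T t x) x"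

text \<open>
  The ratio \<open>\<lceil>\<gamma>\<rceil> / \<gamma>\<close>, read as \<open>1\<close> for \<open>\<gamma> = 0\<close>: in that case the process
  \<open>W\<close> below is just a \<open>\<beta>\<close>-stable subordinator.
\<close>

definition ceiling_ratio :: "real \<Rightarrow> real" where
  "ceiling_ratio \<gamma> = (if \<gamma> = 0 then 1 else real_of_int \<lceil>\<gamma>\<rceil> / \<gamma>)"

text \<open>
  Here \<open>V r\<close> is stable of order \<open>\<beta> \<lceil>\<gamma>\<rceil> / \<gamma> - r \<alpha>\<close>, and \<open>G\<close> is stable of order
  \<open>\<gamma> / \<lceil>\<gamma>\<rceil>\<close>.  The weight \<open>\<omega> ^ r\<close> in the random time change is what gives this process the Laplace
  exponent \<open>\<mu> powr \<beta> * (1 + \<omega> * \<mu> powr (- \<alpha>)) powr \<gamma>\<close>; for \<open>\<omega> = 1\<close> it disappears.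
\<close>

definition prabhakar_sum ::
  "real \<Rightarrow> real \<Rightarrow> (nat \<Rightarrow> real \<Rightarrow> 'a \<Rightarrow> real) \<Rightarrow> (real \<Rightarrow> 'a \<Rightarrow> real) \<Rightarrow> real \<Rightarrow> 'a \<Rightarrow> real" where
  "prabhakar_sum \<omega> \<gamma> V G t x =
     (\<Sum>r=0..nat \<lceil>\<gamma>\<rceil>. V r (real (nat \<lceil>\<gamma>\<rceil> choose r) * \<omega> ^ r * G t x) x)"


section \<open>The series\<close>

definition gen_mittag_leffler :: "real \<Rightarrow> real \<Rightarrow> real \<Rightarrow> real \<Rightarrow> real" where
  "gen_mittag_leffler \<kappa> \<theta> c z =
     (\<Sum>i. z ^ i * pochhammer c i / fact i * rGamma (\<kappa> * real i + \<theta>))"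

text \<open>
  The term of the innermost series.  The total function \<open>rGamma\<close> is the reciprocal Gamma function,
  zero at \<open>0, -1, -2, \<dots>\<close>.
\<close>

definition inner_term :: "real \<Rightarrow> real \<Rightarrow> real \<Rightarrow> real \<Rightarrow> nat \<Rightarrow> nat \<Rightarrow> nat \<Rightarrow> real" where
  "inner_term \<delta> \<eta> \<nu> rate k r m =
     ((real r * \<delta>) gchoose m) * \<eta> powr (\<delta> * real r - real m) * rate powr (\<nu> * real m)
       * (Gamma (\<nu> * real m + 1) * rGamma (\<nu> * real m - real k + 1))"

end

theory Submission
  imports Defs "HOL-Complex_Analysis.Complex_Analysis"
begin

text \<open>
  Each process in the statement is a subordination of Laplace exponents.  Hence the generating
  function of the state at time \<open>t\<close> is
  \<open>E z^N = E exp (- U t * \<phi> (rate * (1 - z)))\<close> with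
  \<open>\<phi> \<mu> = (\<eta> + \<mu> powr \<nu>) powr \<delta> - \<eta> powr \<delta>\<close>.  For each \<open>j\<close> the moment
  \<open>E (U t)^j / j!\<close>, as a function of \<open>t\<close>, has Laplace transform \<open>1 / (\<mu> * \<Psi> \<mu> ^ j)\<close>, where
  \<open>\<Psi>\<close> is the exponent of \<open>W\<close>; expanding \<open>(1 + \<omega> * \<mu> powr (- \<alpha>)) powr (- \<gamma> * j)\<close> and inverting
  termwise identifies it with the Mittag-Leffler coefficient.  These moments decay
  superexponentially in \<open>j\<close>, so \<open>E exp (- U t * q)\<close> is entire in \<open>q\<close> and the \<open>k\<close>-th
  derivative at \<open>rate\<close> may be taken termwise.  Finally \<open>\<phi> ^ j\<close> is expanded binomially, and the
  derivatives of \<open>(\<eta> + \<mu> powr \<nu>) powr (r * \<delta>)\<close> are read off from the binomial series in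
  \<open>\<mu> powr \<nu>\<close>.  Since only convergence of the innermost series is known, its sum at a boundary
  point of the disc of convergence is obtained from Abel's theorem.
\<close>

section \<open>Power series and derivatives\<close>

text \<open>The law of \<open>U t\<close> is never computed: only its moments enter. They are found
  through a Laplace transform in \<open>t\<close>, because \<open>W\<close> is known only through
  its Laplace exponent. Such a transform determines a function almost everywhere; equality at each
  \<open>t\<close> comes from monotonicity of the moments and continuity of the Mittag-Leffler side.

  Processes are evaluated at random times, while independence is used only between values at fixed
  times. To bridge the gap, a random time is approximated from the right by dyadic times. These take
  countably many values, and right-continuity of the paths recovers the limit.

  The boundary problem arises as follows. As a function of \<open>w\<close>,
  \<open>(\<eta> + w) powr a\<close> is singular at \<open>w = - \<eta>\<close>, so its binomial
  series has radius \<open>\<eta>\<close> unless it terminates, while the point of interest is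
  \<open>w = rate powr \<nu>\<close>, on the positive axis, where the function is holomorphic. Abel
  summation matters when \<open>rate powr \<nu> = \<eta>\<close>; no case distinction is made, since
  the argument starts from convergence at the point itself.\<close>

lemma abel_limit:
  fixes a :: "nat \<Rightarrow> complex"
  assumes "summable a"
  shows "((\<lambda>x. \<Sum>n. a n * of_real x ^ n) \<longlongrightarrow> suminf a) (at_left (1::real))"
proof -
  define S where "S = suminf a"
  define s where "s n = (\<Sum>i\<le>n. a i) - S" for n
  have s0: "s \<longlonglongrightarrow> 0"
    using summable_LIMSEQ'[OF assms] unfolding s_def S_def by (simp add: LIM_zero)
  then obtain B where B: "\<And>n. norm (s n) \<le> B"
    by (metis BseqE convergent_imp_Bseq convergentI)
  have summ: "summable (\<lambda>n. s n * of_real x ^ n)" if "0 < x" "x < 1" for x :: real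
    by (rule summable_comparison_test'[where g="\<lambda>n. B * x ^ n" and N=0])
      (use that B in \<open>auto simp: norm_mult norm_power summable_geometric intro!: mult_right_mono\<close>)
  \<comment> \<open>Summation by parts: with the partial sums recentred at their limit
    \<open>S\<close>, the series is \<open>S\<close> plus a remainder carrying the factor
    \<open>1 - x\<close>, which vanishes as \<open>x\<close> tends to \<open>1\<close> because
    \<open>s\<close> tends to \<open>0\<close>.\<close>
  have eq: "(\<Sum>n. a n * of_real x ^ n) = S + (1 - of_real x) * (\<Sum>n. s n * of_real x ^ n)"
    if x: "0 < x" "x < 1" for x :: real
  proof -
    let ?x = "of_real x :: complex"
    have nx: "norm ?x < 1" using x by simp
    have gs: "(\<lambda>n. S * ?x ^ n) sums (S * (1 / (1 - ?x)))"
      by (intro sums_mult geometric_sums nx)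
    define p where "p n = s n * ?x ^ n + S * ?x ^ n" for n
    have p: "p sums ((\<Sum>n. s n * ?x ^ n) + S * (1 / (1 - ?x)))" (is "_ sums ?P")
      unfolding p_def by (intro sums_add gs summable_sums summ x)
    \<comment> \<open>\<open>p n\<close> is the \<open>n\<close>-th partial sum of \<open>a\<close>
      times \<open>x ^ n\<close>. Subtracting the series shifted by one and multiplied by
      \<open>x\<close> leaves differences of partial sums, that is,
      \<open>a n * x ^ n\<close>.\<close>
    have p': "(\<lambda>n. p n - (if n = 0 then 0 else ?x * p (n - 1))) sums (?P - ?x * ?P)"
    proof (intro sums_diff p)
      have "(\<lambda>n. ?x * p n) sums (?x * ?P)" by (intro sums_mult p)
      then show "(\<lambda>n. if n = 0 then 0 else ?x * p (n - 1)) sums (?x * ?P)"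
        using sums_Suc[of "\<lambda>n. if n = 0 then 0 else ?x * p (n - 1)"] by simp
    qed
    have "p n - (if n = 0 then 0 else ?x * p (n - 1)) = a n * ?x ^ n" for n
    proof (cases n)
      case (Suc m)
      have "p n - ?x * p m = (s n - s m) * ?x ^ n" unfolding p_def Suc by (simp add: algebra_simps)
      also have "s n - s m = a n" unfolding s_def Suc by simp
      finally show ?thesis using Suc by simp
    qed (simp add: p_def s_def algebra_simps)
    with p' have "(\<lambda>n. a n * ?x ^ n) sums (?P - ?x * ?P)" by simp
    moreover have "?P - ?x * ?P = S + (1 - ?x) * (\<Sum>n. s n * ?x ^ n)"
    proof -
      have "1 - ?x \<noteq> 0" using x by (metis eq_iff_diff_eq_0 less_irrefl of_real_eq_1_iff)
      have "?P - ?x * ?P = (1 - ?x) * (\<Sum>n. s n * ?x ^ n) + S * ((1 - ?x) * (1 / (1 - ?x)))"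
        by (simp only: algebra_simps mult_1_left)
      then show ?thesis using \<open>1 - ?x \<noteq> 0\<close> by simp
    qed
    ultimately show ?thesis by (simp add: sums_iff)
  qed
  have "((\<lambda>x. (1 - of_real x) * (\<Sum>n. s n * of_real x ^ n)) \<longlongrightarrow> 0) (at_left (1::real))"
  proof (rule tendstoI)
    fix e :: real assume e: "e > 0"
    obtain N where N: "\<And>n. n \<ge> N \<Longrightarrow> norm (s n) < e / 2"
      using LIMSEQ_D[OF s0, of "e/2"] e by auto
    \<comment> \<open>The first \<open>N\<close> terms contribute at most \<open>K\<close>, which
      the factor \<open>1 - x\<close> makes small; the tail is at most
      \<open>e / 2 / (1 - x)\<close>, where the factor cancels. The \<open>K + 1\<close> in the
      threshold below avoids division by zero.\<close>
    define K where "K = (\<Sum>n<N. norm (s n))"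
    have K: "K \<ge> 0" unfolding K_def by (simp add: sum_nonneg)
    have "eventually (\<lambda>x::real. x > max 0 (1 - e / (2 * (K + 1)))) (at_left 1)"
      using e K by (intro eventually_at_leftI[of "max 0 (1 - e / (2 * (K + 1)))"]) auto
    moreover have "eventually (\<lambda>x::real. x < 1) (at_left 1)"
      by (auto simp: eventually_at_filter)
    ultimately show "eventually (\<lambda>x. dist ((1 - of_real x) * (\<Sum>n. s n * of_real x ^ n)) 0 < e) (at_left (1::real))"
    proof eventually_elim
      case (elim x)
      then have x: "0 < x" "x < 1" by auto
      have sn: "summable (\<lambda>n. norm (s n * of_real x ^ n))"
        by (rule summable_comparison_test'[where g="\<lambda>n. B * x ^ n" and N=0])
          (use x B in \<open>auto simp: norm_mult norm_power summable_geometric intro!: mult_right_mono\<close>)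
      have "norm (\<Sum>n. s n * of_real x ^ n) \<le> (\<Sum>n. norm (s n * of_real x ^ n))"
        by (rule summable_norm[OF sn])
      also have "\<dots> \<le> (\<Sum>n. (if n < N then norm (s n) else 0) + e / 2 * x ^ n)"
      proof (rule suminf_le)
        fix n
        show "norm (s n * of_real x ^ n) \<le> (if n < N then norm (s n) else 0) + e / 2 * x ^ n"
        proof (cases "n < N")
          case True
          have "norm (s n) * x ^ n \<le> norm (s n) * 1"
            using x by (intro mult_left_mono power_le_one) auto
          moreover have "e / 2 * x ^ n \<ge> 0" using e x by simp
          ultimately show ?thesis using True x by (simp add: norm_mult norm_power)
        next
          case False
          then have "norm (s n) * x ^ n \<le> e / 2 * x ^ n"
            using x N[of n] by (intro mult_right_mono) auto
          then show ?thesis using False x by (simp add: norm_mult norm_power)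
        qed
      next
        show "summable (\<lambda>n. (if n < N then norm (s n) else 0) + e / 2 * x ^ n)"
          using x by (intro summable_add summable_mult summable_geometric)
            (auto intro!: summable_finite[of "{..<N}"])
      qed (use sn in auto)
      also have "\<dots> = K + e / 2 * (1 / (1 - x))"
      proof -
        have "(\<lambda>n. if n \<in> {..<N} then norm (s n) else 0) sums K"
          unfolding K_def by (rule sums_If_finite_set) simp
        moreover have "(\<lambda>n. e / 2 * x ^ n) sums (e / 2 * (1 / (1 - x)))"
          using x by (intro sums_mult geometric_sums) auto
        ultimately show ?thesis using sums_unique[OF sums_add] by fastforce
      qed
      finally have "(1 - x) * norm (\<Sum>n. s n * of_real x ^ n) \<le> (1 - x) * (K + e / 2 * (1 / (1 - x)))"
        using x by (intro mult_left_mono) auto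
      also have "\<dots> = (1 - x) * K + e / 2" using x by (simp add: field_simps)
      also have "\<dots> < e"
      proof -
        have "(1 - x) * K \<le> (1 - x) * (K + 1)" using x by simp
        also have "\<dots> < e / (2 * (K + 1)) * (K + 1)"
          using elim K by (intro mult_strict_right_mono) auto
        also have "\<dots> = e / 2" using K by (simp add: field_simps)
        finally show ?thesis by simp
      qed
      finally have *: "(1 - x) * norm (\<Sum>n. s n * of_real x ^ n) < e" .
      show ?case
      proof -
        have "norm (1 - complex_of_real x) = 1 - x"
          using x norm_of_real[of "1 - x", where 'a=complex] by simp
        then show ?thesis using * by (simp add: norm_mult)
      qed
    qed
  qed
  then have "((\<lambda>x. S + (1 - of_real x) * (\<Sum>n. s n * of_real x ^ n)) \<longlongrightarrow> S + 0) (at_left (1::real))"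
    by (intro tendsto_add tendsto_const)
  moreover have "eventually (\<lambda>x::real. S + (1 - of_real x) * (\<Sum>n. s n * of_real x ^ n) = (\<Sum>n. a n * of_real x ^ n)) (at_left 1)"
    using eq by (intro eventually_at_leftI[of 0]) auto
  ultimately show ?thesis unfolding S_def
    by (auto elim: Lim_transform_eventually)
qed

text \<open>Convexity of \<open>S\<close> puts the segment from \<open>0\<close> to \<open>w\<close>
  into it. The identity theorem on \<open>S \<inter> ball 0 w\<close> equates the series and
  \<open>g\<close> along this segment short of \<open>w\<close>; at \<open>w\<close> one side has
  its limit by Abel's theorem, the other by continuity. It makes no difference whether
  \<open>w\<close> lies inside or on the boundary of the disc of convergence.\<close>

lemma holomorphic_eq_power_series_at_boundary:
  fixes g :: "complex \<Rightarrow> complex" and w :: real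
  assumes hol: "g holomorphic_on S" and S: "open S" "convex S" "0 \<in> S" "of_real w \<in> S"
    and w: "0 < w" and exp: "g has_fps_expansion F"
    and summ: "summable (\<lambda>m. fps_nth F m * of_real w ^ m)"
  shows "(\<Sum>m. fps_nth F m * of_real w ^ m) = g (of_real w)"
proof -
  have rad: "fps_conv_radius F \<ge> ereal w"
    using conv_radius_geI[OF summ] w by (simp add: fps_conv_radius_def)
  define D where "D = S \<inter> ball 0 w"
  have D: "open D" "connected D" "0 \<in> D"
    unfolding D_def using S w by (auto intro: convex_connected convex_Int)
  have inD: "norm z < fps_conv_radius F" if "z \<in> D" for z
    using that rad by (auto simp: D_def intro: less_le_trans[OF _ rad])
  have holF: "eval_fps F holomorphic_on D"
    by (rule holomorphic_on_eval_fps) (use inD in \<open>auto simp: eball_def dist_norm\<close>)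
  have "eventually (\<lambda>z. eval_fps F z = g z) (nhds 0)"
    using exp by (simp add: has_fps_expansion_def)
  then obtain A where A: "open A" "0 \<in> A" "\<And>z. z \<in> A \<Longrightarrow> eval_fps F z = g z"
    by (auto simp: eventually_nhds)
  have eq: "eval_fps F z = g z" if "z \<in> D" for z
    by (rule analytic_continuation_open[of "A \<inter> D" D])
      (use A D hol holF that in \<open>auto intro: holomorphic_on_subset simp: D_def\<close>)
  have inD: "of_real (x * w) \<in> D" if "0 < x" "x < 1" for x :: real
  proof -
    have "x *\<^sub>R complex_of_real w + (1 - x) *\<^sub>R 0 \<in> S"
      using that S by (intro convexD) auto
    then show ?thesis using that w by (auto simp: D_def scaleR_conv_of_real norm_mult)
  qed
  have "((\<lambda>x. \<Sum>m. (fps_nth F m * of_real w ^ m) * of_real x ^ m) \<longlongrightarrow>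
     (\<Sum>m. fps_nth F m * of_real w ^ m)) (at_left (1::real))"
    by (rule abel_limit[OF summ])
  moreover have "((\<lambda>x. \<Sum>m. (fps_nth F m * of_real w ^ m) * of_real x ^ m) \<longlongrightarrow> g (of_real w)) (at_left (1::real))"
  proof (rule Lim_transform_eventually)
    have "isCont g (of_real w)"
      using hol S by (meson continuous_on_eq_continuous_at holomorphic_on_imp_continuous_on)
    moreover have "((\<lambda>x. complex_of_real (x * w)) \<longlongrightarrow> of_real (1 * w)) (at_left 1)"
      by (intro tendsto_intros)
    ultimately show "((\<lambda>x. g (complex_of_real (x * w))) \<longlongrightarrow> g (of_real w)) (at_left 1)"
      using isCont_tendsto_compose by force
    have "g (complex_of_real (x * w)) = (\<Sum>m. (fps_nth F m * of_real w ^ m) * of_real x ^ m)"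
      if "0 < x" "x < 1" for x
      using eq[OF inD[OF that]] by (simp add: eval_fps_def power_mult_distrib mult_ac)
    then show "eventually (\<lambda>x. g (complex_of_real (x * w)) = (\<Sum>m. (fps_nth F m * of_real w ^ m) * of_real x ^ m)) (at_left 1)"
      by (intro eventually_at_leftI[of 0]) auto
  qed
  ultimately show ?thesis
    by (rule tendsto_unique[rotated]) simp
qed

text \<open>
  In the variable \<open>w = z powr \<nu>\<close> the operator \<open>z d/dz\<close> is \<open>\<nu> w d/dw\<close>, so \<open>z ^ k\<close> times the
  \<open>k\<close>-th derivative is the product of the operators \<open>\<nu> w d/dw - i\<close> over \<open>i < k\<close>.  In this
  form it acts diagonally on power series in \<open>w\<close>.
\<close>

primrec euler_op :: "real \<Rightarrow> nat \<Rightarrow> (complex \<Rightarrow> complex) \<Rightarrow> complex \<Rightarrow> complex" where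
  "euler_op \<nu> 0 f = f"
| "euler_op \<nu> (Suc k) f =
     (\<lambda>w. of_real \<nu> * w * deriv (euler_op \<nu> k f) w - of_nat k * euler_op \<nu> k f w)"

lemma holomorphic_euler_op:
  assumes "f holomorphic_on S" "open S"
  shows "euler_op \<nu> k f holomorphic_on S"
  by (induction k) (use assms in \<open>auto intro!: holomorphic_intros\<close>)

lemma has_fps_expansion_euler_op:
  assumes "f has_fps_expansion F"
  shows "euler_op \<nu> k f has_fps_expansion
    Abs_fps (\<lambda>m. (\<Prod>i<k. of_real (\<nu> * real m - real i)) * fps_nth F m)"
proof (induction k)
  case 0
  then show ?case using assms by (simp add: fps_nth_inverse)
next
  case (Suc k)
  let ?G = "Abs_fps (\<lambda>m. (\<Prod>i<k. of_real (\<nu> * real m - real i)) * fps_nth F m)"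
  have "(\<lambda>w. of_real \<nu> * w * deriv (euler_op \<nu> k f) w - of_nat k * euler_op \<nu> k f w) has_fps_expansion
     fps_const (of_real \<nu>) * fps_X * fps_deriv ?G - fps_const (of_nat k) * ?G"
    by (intro fps_expansion_intros Suc)
  also have "fps_const (of_real \<nu>) * fps_X * fps_deriv ?G - fps_const (of_nat k) * ?G =
     Abs_fps (\<lambda>m. (\<Prod>i<Suc k. of_real (\<nu> * real m - real i)) * fps_nth F m)" (is "?l = ?r")
  proof (rule fps_ext)
    fix m
    show "fps_nth ?l m = fps_nth ?r m"
      by (cases m) (auto simp: mult.assoc fps_X_mult_nth algebra_simps)
  qed
  finally show ?case by simp
qed

text \<open>Induction: applying \<open>z d/dz\<close> to the identity for \<open>k\<close> gives, on
  the left, \<open>k\<close> times its left side plus the left side for \<open>Suc k\<close>, and on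
  the right \<open>\<nu> w d/dw\<close> of the Euler operator. Differentiating needs the identity on
  an open set; the right half-plane keeps \<open>z\<close> off the branch cut.\<close>

lemma higher_deriv_compose_powr:
  assumes f: "f holomorphic_on S" "open S"
    and T: "open T" "\<And>z. z \<in> T \<Longrightarrow> 0 < Re z" "\<And>z. z \<in> T \<Longrightarrow> z powr of_real \<nu> \<in> S"
    and z: "z \<in> T"
  shows "z ^ k * (deriv ^^ k) (\<lambda>z. f (z powr of_real \<nu>)) z = euler_op \<nu> k f (z powr of_real \<nu>)"
  using z
proof (induction k arbitrary: z)
  case (Suc k)
  let ?h = "(deriv ^^ k) (\<lambda>z. f (z powr of_real \<nu>))"
  have nonpos: "x \<notin> \<real>\<^sub>\<le>\<^sub>0" if "x \<in> T" for x
    using T(2)[OF that] by (auto simp: complex_nonpos_Reals_iff)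
  have "(\<lambda>z. f (z powr of_real \<nu>)) holomorphic_on T"
    by (rule holomorphic_on_compose_gen[OF _ f(1), unfolded o_def])
      (use nonpos T in \<open>auto intro!: holomorphic_intros\<close>)
  then have hd: "?h field_differentiable (at x)" if "x \<in> T" for x
    by (meson T(1) holomorphic_higher_deriv holomorphic_on_imp_differentiable_at that)
  have z0: "z \<noteq> 0" using T(2)[OF Suc.prems] by auto
  let ?E = "euler_op \<nu> k f"
  have E: "?E field_differentiable (at (z powr of_real \<nu>))"
    using holomorphic_euler_op[OF f] f(2) T(3)[OF Suc.prems]
    by (meson holomorphic_on_imp_differentiable_at)
  have "((\<lambda>x. x ^ k * ?h x) has_field_derivative
       (of_nat k * z ^ (k - 1) * ?h z + z ^ k * deriv ?h z)) (at z)"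
    using hd[OF Suc.prems]
    by (auto intro!: derivative_eq_intros simp: field_differentiable_derivI)
  moreover have "((\<lambda>x. ?E (x powr of_real \<nu>)) has_field_derivative
       (deriv ?E (z powr of_real \<nu>) * (of_real \<nu> * z powr (of_real \<nu> - 1)))) (at z)"
    by (rule DERIV_chain2[where f = ?E and g = "\<lambda>x. x powr of_real \<nu>", OF field_differentiable_derivI[OF E]])
      (rule has_field_derivative_powr[OF nonpos[OF Suc.prems]])
  then have "((\<lambda>x. x ^ k * ?h x) has_field_derivative
       (deriv ?E (z powr of_real \<nu>) * (of_real \<nu> * z powr (of_real \<nu> - 1)))) (at z)"
    by (rule has_field_derivative_transform_within_open[OF _ T(1) Suc.prems]) (simp add: Suc.IH)
  ultimately have "of_nat k * z ^ (k - 1) * ?h z + z ^ k * deriv ?h z =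
      deriv ?E (z powr of_real \<nu>) * (of_real \<nu> * z powr (of_real \<nu> - 1))"
    by (rule DERIV_unique)
  then have "z * (of_nat k * z ^ (k - 1) * ?h z + z ^ k * deriv ?h z) =
      z * (deriv ?E (z powr of_real \<nu>) * (of_real \<nu> * z powr (of_real \<nu> - 1)))"
    by simp
  moreover have "z * z powr (of_real \<nu> - 1) = z powr of_real \<nu>"
    using z0 by (simp add: powr_diff)
  then have "z * (deriv ?E (z powr of_real \<nu>) * (of_real \<nu> * z powr (of_real \<nu> - 1))) =
      of_real \<nu> * z powr of_real \<nu> * deriv ?E (z powr of_real \<nu>)"
    by (metis mult.assoc mult.commute)
  moreover have "z * (of_nat k * z ^ (k - 1) * ?h z + z ^ k * deriv ?h z) =
      of_nat k * (z ^ k * ?h z) + z ^ Suc k * deriv ?h z"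
    by (cases k) (simp_all add: algebra_simps)
  ultimately have "of_nat k * (z ^ k * ?h z) + z ^ Suc k * deriv ?h z =
     of_real \<nu> * z powr of_real \<nu> * deriv ?E (z powr of_real \<nu>)"
    by simp
  then show ?case by (simp add: Suc.IH[OF Suc.prems] algebra_simps)
qed simp

text \<open>\<open>rGamma z = z * rGamma (z + 1)\<close> holds at the poles of Gamma too, so the
  value zero there needs no separate case. The product is what \<open>k\<close> derivatives of
  \<open>\<mu> powr a\<close> produce.\<close>

lemma Gamma_rGamma_falling:
  fixes a :: real
  assumes "0 \<le> a"
  shows "Gamma (a + 1) * rGamma (a - real k + 1) = (\<Prod>i<k. a - real i)"
proof (induction k)
  case 0
  have "Gamma (a + 1) \<noteq> 0" using assms Gamma_real_pos[of "a+1"] by linarith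
  then show ?case by (simp add: rGamma_inverse_Gamma)
next
  case (Suc k)
  have "rGamma (a - real k) = (a - real k) * rGamma (a - real k + 1)"
    by (simp add: rGamma_plus1)
  then have "Gamma (a + 1) * rGamma (a - real (Suc k) + 1) =
      (a - real k) * (Gamma (a + 1) * rGamma (a - real k + 1))"
    by (simp add: add.commute)
  then show ?case using Suc by simp
qed

text \<open>Factoring out \<open>\<eta>\<close> reduces this to the binomial series of
  \<open>1 + w / \<eta>\<close>; the logarithm of the product splits without correction because
  \<open>\<eta>\<close> is a positive real.\<close>

lemma has_fps_expansion_shifted_powr:
  assumes "0 < \<eta>"
  shows "(\<lambda>w::complex. (of_real \<eta> + w) powr of_real a) has_fps_expansion
    Abs_fps (\<lambda>m. of_real ((a gchoose m) * \<eta> powr (a - real m)))"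
    (is "?f has_fps_expansion ?F")
proof -
  have S: "(\<lambda>m. fps_nth ?F m * w ^ m) sums ?f w" if "norm w < \<eta>" for w :: complex
  proof -
    have nz: "norm (w / of_real \<eta>) < 1" using that assms by (simp add: norm_divide)
    have "(\<lambda>m. of_real (\<eta> powr a) * ((of_real a gchoose m) * (w / of_real \<eta>) ^ m)) sums
        (of_real (\<eta> powr a) * (1 + w / of_real \<eta>) powr of_real a)"
      by (intro sums_mult gen_binomial_complex nz)
    moreover have "of_real (\<eta> powr a) * ((of_real a gchoose m) * (w / of_real \<eta>) ^ m) = fps_nth ?F m * w ^ m" for m
    proof -
      have "complex_of_real (a gchoose m) = of_real a gchoose m"
        by (simp add: gbinomial_prod_rev)
      then show ?thesis using assms by (simp add: powr_diff powr_realpow power_divide)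
    qed
    moreover have "of_real (\<eta> powr a) * (1 + w / of_real \<eta>) powr of_real a = ?f w"
    proof -
      have ne: "1 + w / of_real \<eta> \<noteq> 0"
        using nz by (auto simp: add_eq_0_iff)
      have "of_real \<eta> + w = of_real \<eta> * (1 + w / of_real \<eta>)" using assms by (simp add: field_simps)
      then have "?f w = (of_real \<eta> * (1 + w / of_real \<eta>)) powr of_real a" by simp
      also have "\<dots> = exp (of_real a * (of_real (ln \<eta>) + Ln (1 + w / of_real \<eta>)))"
        using assms ne by (simp add: powr_def Ln_times_of_real Ln_of_real)
      also have "\<dots> = of_real (\<eta> powr a) * (1 + w / of_real \<eta>) powr of_real a"
        using assms ne by (simp add: powr_def exp_add distrib_left exp_of_real[symmetric])
      finally show ?thesis by simp
    qed
    ultimately show ?thesis by simp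
  qed
  have "fps_conv_radius ?F \<ge> norm (complex_of_real (\<eta>/2))"
    unfolding fps_conv_radius_def
    by (rule conv_radius_geI) (use S[of "of_real (\<eta>/2)"] assms in \<open>auto simp: sums_iff\<close>)
  then have "fps_conv_radius ?F > 0" using assms
    by (metis abs_of_pos half_gt_zero_iff less_le_trans norm_of_real ereal_less(2))
  moreover have "eventually (\<lambda>z. eval_fps ?F z = ?f z) (nhds 0)"
  proof -
    have "eventually (\<lambda>z. z \<in> ball (0::complex) \<eta>) (nhds 0)"
      using assms by (intro eventually_nhds_in_open) auto
    then show ?thesis by eventually_elim (use S in \<open>auto simp: eval_fps_def sums_iff\<close>)
  qed
  ultimately show ?thesis by (simp add: has_fps_expansion_def)
qed

text \<open>The exponent shrinks the argument of \<open>z\<close>, which stays within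
  \<open>pi / 2\<close> of zero. Hence \<open>\<eta> + z powr \<nu>\<close> avoids the branch cut of
  the outer power.\<close>

lemma Re_powr_pos:
  assumes "0 < Re z" "0 \<le> \<nu>" "\<nu> \<le> 1"
  shows "0 < Re (z powr of_real \<nu>)"
proof -
  have z0: "z \<noteq> 0" using assms by auto
  have "\<bar>Im (Ln z)\<bar> < pi / 2" using assms Re_Ln_pos_lt[OF z0] by simp
  then have "\<bar>\<nu> * Im (Ln z)\<bar> < pi / 2"
    using assms mult_left_le_one_le[of "\<bar>Im (Ln z)\<bar>" \<nu>] by (simp add: abs_mult)
  then have "cos (\<nu> * Im (Ln z)) > 0" by (intro cos_gt_zero_pi) auto
  then show ?thesis using z0 by (simp add: powr_def Re_exp)
qed

text \<open>The Gamma quotient in \<open>inner_term\<close> is the eigenvalue of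
  \<open>z ^ k\<close> times the \<open>k\<close>-th derivative on
  \<open>z powr (\<nu> * m)\<close>. So the series is the Euler operator applied to the binomial
  series, at \<open>w = rate powr \<nu>\<close>. This point lies in the half-plane
  \<open>Re w > - \<eta>\<close>, where the function is holomorphic even beyond the disc.\<close>

lemma suminf_inner_term:
  fixes \<delta> \<eta> \<nu> rate :: real and k r :: nat
  assumes "0 < \<eta>" "0 < rate" "0 < \<nu>" "\<nu> \<le> 1"
    and summ: "summable (inner_term \<delta> \<eta> \<nu> rate k r)"
  shows "complex_of_real (\<Sum>m. inner_term \<delta> \<eta> \<nu> rate k r m) = of_real rate ^ k *
    (deriv ^^ k) (\<lambda>z. (of_real \<eta> + z powr of_real \<nu>) powr of_real (real r * \<delta>)) (of_real rate)"
proof -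
  define f where "f w = (of_real \<eta> + w) powr (of_real (real r * \<delta>) :: complex)" for w :: complex
  define S where "S = {w. Re w > - \<eta>}"
  have S: "open S" "convex S" unfolding S_def by (auto simp: open_halfspace_Re_gt convex_halfspace_Re_gt)
  have hf: "f holomorphic_on S" unfolding f_def S_def
    by (intro holomorphic_intros) (auto simp: complex_nonpos_Reals_iff)
  define F where "F = Abs_fps (\<lambda>m. complex_of_real ((real r * \<delta> gchoose m) * \<eta> powr (real r * \<delta> - real m)))"
  define G where "G = Abs_fps (\<lambda>m. (\<Prod>i<k. complex_of_real (\<nu> * real m - real i)) * fps_nth F m)"
  have G: "euler_op \<nu> k f has_fps_expansion G"
    unfolding G_def f_def F_def
    by (intro has_fps_expansion_euler_op has_fps_expansion_shifted_powr assms)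
  define w where "w = rate powr \<nu>"
  have w: "0 < w" unfolding w_def using assms by simp
  have summand: "fps_nth G m * of_real w ^ m = of_real (inner_term \<delta> \<eta> \<nu> rate k r m)" for m
  proof -
    have "rate powr (\<nu> * real m) = w ^ m"
      unfolding w_def using assms by (simp add: powr_powr[symmetric] powr_realpow)
    then show ?thesis
      using assms Gamma_rGamma_falling[of "\<nu> * real m" k] unfolding G_def F_def inner_term_def
      by (simp add: mult_ac)
  qed
  have "of_real (\<Sum>m. inner_term \<delta> \<eta> \<nu> rate k r m) = (\<Sum>m. fps_nth G m * of_real w ^ m)"
    unfolding summand by (rule suminf_of_real[OF summ])
  also have "\<dots> = euler_op \<nu> k f (of_real w)"
    by (rule holomorphic_eq_power_series_at_boundary[OF holomorphic_euler_op[OF hf S(1)] S _ _ w G])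
      (use assms w summ in \<open>auto simp: S_def summand summable_of_real_iff\<close>)
  also have "of_real w = complex_of_real rate powr of_real \<nu>"
    unfolding w_def using assms by (simp add: powr_of_real)
  finally have 1: "of_real (\<Sum>m. inner_term \<delta> \<eta> \<nu> rate k r m) =
    euler_op \<nu> k f (complex_of_real rate powr of_real \<nu>)" .
  have "- \<eta> < Re (z powr of_real \<nu>)" if "0 < Re z" for z
    using Re_powr_pos[OF that, of \<nu>] assms by linarith
  then have P: "z powr of_real \<nu> \<in> S" if "0 < Re z" for z
    using that by (simp add: S_def)
  have "euler_op \<nu> k f (complex_of_real rate powr of_real \<nu>) =
     of_real rate ^ k * (deriv ^^ k) (\<lambda>z. f (z powr of_real \<nu>)) (of_real rate)"
    by (rule higher_deriv_compose_powr[OF hf S(1), of "{z. 0 < Re z}", symmetric])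
      (use assms P in \<open>auto simp: open_halfspace_Re_gt\<close>)
  with 1 show ?thesis unfolding f_def by simp
qed

section \<open>Termwise differentiation and coefficients of the generating function\<close>

lemma higher_deriv_sum:
  fixes f :: "'i \<Rightarrow> complex \<Rightarrow> complex"
  assumes "\<And>i. i \<in> I \<Longrightarrow> f i holomorphic_on S" "open S" "z \<in> S"
  shows "(deriv ^^ n) (\<lambda>w. \<Sum>i\<in>I. f i w) z = (\<Sum>i\<in>I. (deriv ^^ n) (f i) z)"
  using assms(1)
proof (induction I rule: infinite_finite_induct)
  case (insert i I)
  have "(deriv ^^ n) (\<lambda>w. f i w + (\<Sum>i\<in>I. f i w)) z = (deriv ^^ n) (f i) z + (deriv ^^ n) (\<lambda>w. \<Sum>i\<in>I. f i w) z"
    by (rule higher_deriv_add[OF _ _ assms(2,3)]) (use insert.prems in \<open>auto intro!: holomorphic_intros\<close>)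
  then show ?case using insert by simp
qed auto

text \<open>Summability of \<open>c\<close> against every geometric sequence makes the outer series
  entire. On a closed disc about \<open>z\<close> the function \<open>f\<close> is bounded, so the
  partial sums converge uniformly and Weierstrass' theorem passes derivatives to the limit.\<close>

lemma entire_series_compose:
  fixes c :: "nat \<Rightarrow> real" and f :: "complex \<Rightarrow> complex"
  assumes c: "\<And>B. summable (\<lambda>j. \<bar>c j\<bar> * B ^ j)"
    and f: "f holomorphic_on T" "open T" and z: "z \<in> T"
  shows "(\<lambda>z. \<Sum>j. of_real (c j) * f z ^ j) holomorphic_on T"
    and "(\<lambda>j. of_real (c j) * (deriv ^^ k) (\<lambda>z. f z ^ j) z) sums
      (deriv ^^ k) (\<lambda>z. \<Sum>j. of_real (c j) * f z ^ j) z"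
proof -
  define C where "C = Abs_fps (\<lambda>j. complex_of_real (c j))"
  have rad: "fps_conv_radius C = \<infinity>"
    unfolding fps_conv_radius_def C_def
  proof (rule conv_radius_inftyI')
    fix B :: real assume "B > 0"
    have "summable (\<lambda>j. norm (complex_of_real (c j) * of_real B ^ j))"
      using c[of B] \<open>B > 0\<close> by (simp add: norm_mult norm_power)
    then show "\<exists>w. norm w = B \<and> summable (\<lambda>n. fps_nth (Abs_fps (\<lambda>j. complex_of_real (c j))) n * w ^ n)"
      using \<open>B > 0\<close> by (intro exI[of _ "of_real B"]) (auto dest: summable_norm_cancel)
  qed
  have F: "(\<lambda>z. \<Sum>j. of_real (c j) * f z ^ j) = (\<lambda>z. eval_fps C (f z))"
    by (simp add: eval_fps_def C_def)
  show "(\<lambda>z. \<Sum>j. of_real (c j) * f z ^ j) holomorphic_on T"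
    unfolding F
    by (rule holomorphic_on_compose_gen[OF f(1), unfolded o_def, where t=UNIV])
      (auto intro!: holomorphic_on_eval_fps simp: rad eball_def)
  obtain r where r: "r > 0" "cball z r \<subseteq> T"
    using f(2) z by (meson open_contains_cball)
  have "compact (f ` cball z r)"
    by (intro compact_continuous_image continuous_on_subset[OF holomorphic_on_imp_continuous_on[OF f(1)]] r)
      auto
  then obtain B where B: "\<And>w. w \<in> cball z r \<Longrightarrow> norm (f w) \<le> B"
    by (meson compact_imp_bounded bounded_iff imageI)
  have ul: "uniform_limit (ball z r) (\<lambda>n w. \<Sum>j<n. of_real (c j) * f w ^ j)
      (\<lambda>w. \<Sum>j. of_real (c j) * f w ^ j) sequentially"
  proof (rule Weierstrass_m_test)
    show "norm (of_real (c j) * f w ^ j) \<le> \<bar>c j\<bar> * B ^ j" if "w \<in> ball z r" for j w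
      using B[of w] that by (auto simp: norm_mult norm_power intro!: mult_left_mono power_mono)
  qed (rule c)
  have fr: "f holomorphic_on ball z r" by (rule holomorphic_on_subset[OF f(1)]) (use r in auto)
  have hol: "(\<lambda>w. f w ^ j) holomorphic_on ball z r" for j
    by (intro holomorphic_intros fr)
  have "(\<lambda>n. (deriv ^^ k) (\<lambda>w. \<Sum>j<n. of_real (c j) * f w ^ j) z) \<longlonglongrightarrow>
      (deriv ^^ k) (\<lambda>w. \<Sum>j. of_real (c j) * f w ^ j) z"
    by (rule higher_deriv_complex_uniform_limit[OF ul])
      (use r fr in \<open>auto intro!: always_eventually holomorphic_intros\<close>)
  also have "(\<lambda>n. (deriv ^^ k) (\<lambda>w. \<Sum>j<n. of_real (c j) * f w ^ j) z) =
      (\<lambda>n. \<Sum>j<n. of_real (c j) * (deriv ^^ k) (\<lambda>z. f z ^ j) z)"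
  proof
    fix n
    have "(deriv ^^ k) (\<lambda>w. \<Sum>j<n. of_real (c j) * f w ^ j) z =
        (\<Sum>j<n. (deriv ^^ k) (\<lambda>w. of_real (c j) * f w ^ j) z)"
      by (rule higher_deriv_sum[where S = "ball z r"]) (use r fr in \<open>auto intro!: holomorphic_intros\<close>)
    also have "\<dots> = (\<Sum>j<n. of_real (c j) * (deriv ^^ k) (\<lambda>w. f w ^ j) z)"
      by (intro sum.cong refl higher_deriv_cmult[OF hol]) (use r in auto)
    finally show "(deriv ^^ k) (\<lambda>w. \<Sum>j<n. of_real (c j) * f w ^ j) z = \<dots>" .
  qed
  finally show "(\<lambda>j. of_real (c j) * (deriv ^^ k) (\<lambda>z. f z ^ j) z) sums
      (deriv ^^ k) (\<lambda>z. \<Sum>j. of_real (c j) * f z ^ j) z"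
    by (simp add: sums_def)
qed

text \<open>The identity is available only for real \<open>z\<close> strictly between
  \<open>0\<close> and \<open>1\<close>, but these points accumulate at \<open>0\<close>, inside the
  disc where both sides are holomorphic. So it holds near \<open>0\<close>, where Taylor
  coefficients are compared; the chain rule for \<open>rate * (1 - z)\<close> supplies the power of
  \<open>- rate\<close>.\<close>

lemma generating_function_coefficient:
  fixes p :: "nat \<Rightarrow> real" and L :: "complex \<Rightarrow> complex" and rate :: real
  assumes p: "summable p" and rate: "0 < rate"
    and L: "L holomorphic_on {z. 0 < Re z}"
    and eq: "\<And>z::real. 0 < z \<Longrightarrow> z < 1 \<Longrightarrow> of_real (\<Sum>k. p k * z ^ k) = L (of_real (rate * (1 - z)))"
  shows "of_real (p k) = (- of_real rate) ^ k / fact k * (deriv ^^ k) L (of_real rate)"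
proof -
  define P where "P = Abs_fps (\<lambda>j. complex_of_real (p j))"
  have "fps_conv_radius P \<ge> norm (1::complex)"
    unfolding fps_conv_radius_def P_def
    by (rule conv_radius_geI) (use p in \<open>auto simp: summable_of_real_iff\<close>)
  then have rad: "fps_conv_radius P \<ge> 1" by (simp add: one_ereal_def)
  define D where "D = ball (0::complex) 1"
  have Re: "0 < Re (- of_real rate * z + of_real rate)" if "z \<in> D" for z
  proof -
    have "Re z < 1" using that complex_Re_le_cmod[of z] by (simp add: D_def)
    then show ?thesis using rate by simp
  qed
  define g where "g z = L (- of_real rate * z + of_real rate)" for z
  have g: "g holomorphic_on D"
    unfolding g_def
    by (rule holomorphic_on_compose_gen[OF _ L, unfolded o_def]) (use Re in \<open>auto intro!: holomorphic_intros\<close>)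
  have hP: "eval_fps P holomorphic_on D"
  proof (rule holomorphic_on_eval_fps)
    show "D \<subseteq> eball 0 (fps_conv_radius P)"
    proof
      fix x assume "x \<in> D"
      then have "ereal (norm x) < 1" by (simp add: D_def)
      then show "x \<in> eball 0 (fps_conv_radius P)"
        using less_le_trans[OF _ rad] by (auto simp: eball_def)
    qed
  qed
  have eqD: "eval_fps P z - g z = 0" if "z \<in> D" for z
  proof (rule analytic_continuation[where S = D and U = "complex_of_real ` {0<..<1}" and \<xi> = 0 and f = "\<lambda>z. eval_fps P z - g z"])
    show "(\<lambda>z. eval_fps P z - g z) holomorphic_on D" by (intro holomorphic_intros g hP)
    show "0 islimpt complex_of_real ` {0<..<1}"
    proof (rule islimptI)
      fix T :: "complex set" assume "0 \<in> T" "open T"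
      then obtain e where e: "e > 0" "ball 0 e \<subseteq> T" by (meson openE)
      then show "\<exists>y\<in>complex_of_real ` {0<..<1}. y \<in> T \<and> y \<noteq> 0"
        by (intro bexI[of _ "of_real (min (e/2) (1/2))"]) (auto intro!: subsetD[OF e(2)])
    qed
    fix z assume "z \<in> complex_of_real ` {0<..<1}"
    then obtain x :: real where x: "z = of_real x" "0 < x" "x < 1" by auto
    have "summable (\<lambda>k. p k * x ^ k)"
      by (rule powser_inside[of _ 1]) (use p x in auto)
    then have "eval_fps P z = of_real (\<Sum>k. p k * x ^ k)"
      unfolding eval_fps_def P_def x by (simp add: suminf_of_real)
    then show "eval_fps P z - g z = 0"
      using eq[OF x(2,3)] by (simp add: g_def x algebra_simps)
  qed (use that in \<open>auto simp: D_def\<close>)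
  have "of_real (p k) = fps_nth P k" by (simp add: P_def)
  also have "\<dots> = (deriv ^^ k) (eval_fps P) 0 / fact k"
    by (rule fps_nth_conv_deriv) (use rad in \<open>auto intro: less_le_trans[of _ 1]\<close>)
  also have "(deriv ^^ k) (eval_fps P) 0 = (deriv ^^ k) g 0"
    by (rule higher_deriv_transform_within_open[OF hP g]) (use eqD in \<open>auto simp: D_def\<close>)
  also have "(deriv ^^ k) g 0 = (- of_real rate) ^ k * (deriv ^^ k) L (- of_real rate * 0 + of_real rate)"
    unfolding g_def
    by (rule higher_deriv_compose_linear'[OF L, of D]) (use Re in \<open>auto simp: D_def open_halfspace_Re_gt\<close>)
  finally show ?thesis by simp
qed

text \<open>In the proof \<open>f\<close> extends \<open>- \<phi>\<close> to the right half-plane.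
  The \<open>rate ^ k\<close> from the chain rule is exactly the factor that turns a
  \<open>k\<close>-th derivative at \<open>rate\<close> into the innermost series, so no power of
  \<open>rate\<close> survives outside it.\<close>

lemma generating_function_expansion:
  fixes p c :: "nat \<Rightarrow> real" and \<delta> \<eta> \<nu> rate :: real and k :: nat
  assumes pos: "0 < \<eta>" "0 < rate" "0 < \<nu>" "\<nu> \<le> 1"
    and p: "summable p" and c: "\<And>B. summable (\<lambda>j. \<bar>c j\<bar> * B ^ j)"
    and eq: "\<And>z. 0 < z \<Longrightarrow> z < 1 \<Longrightarrow> (\<Sum>k. p k * z ^ k) =
      (\<Sum>j. c j * (- ((\<eta> + (rate * (1 - z)) powr \<nu>) powr \<delta> - \<eta> powr \<delta>)) ^ j)"
    and summ: "\<And>r. summable (inner_term \<delta> \<eta> \<nu> rate k r)"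
  shows "(\<lambda>j. (- 1) ^ k / fact k * ((- 1) ^ j * c j *
      (\<Sum>r=0..j. real (j choose r) * (- (\<eta> powr \<delta>)) ^ (j - r) * (\<Sum>m. inner_term \<delta> \<eta> \<nu> rate k r m))))
    sums p k"
proof -
  define T where "T = {z. 0 < Re z}"
  have T: "open T" "of_real rate \<in> T" unfolding T_def using pos by (auto simp: open_halfspace_Re_gt)
  define H where "H r z = (of_real \<eta> + z powr of_real \<nu>) powr (of_real (real r * \<delta>) :: complex)" for r z
  have base: "0 < Re (of_real \<eta> + z powr of_real \<nu>)" if "z \<in> T" for z
    using Re_powr_pos[of z \<nu>] that pos by (simp add: T_def)
  have H: "H r holomorphic_on T" for r
    unfolding H_def
  proof (intro holomorphic_intros)
    show "of_real \<eta> + z powr of_real \<nu> \<notin> \<real>\<^sub>\<le>\<^sub>0" if "z \<in> T" for z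
      using base[OF that] by (simp add: complex_nonpos_Reals_iff)
  qed (auto simp: complex_nonpos_Reals_iff T_def)
  define f where "f z = - (H 1 z - of_real (\<eta> powr \<delta>))" for z
  have f: "f holomorphic_on T" unfolding f_def by (intro holomorphic_intros H)
  define L where "L z = (\<Sum>j. of_real (c j) * f z ^ j)" for z
  have L: "L holomorphic_on T"
    unfolding L_def by (rule entire_series_compose(1)[OF c f T])
  have fr: "f (of_real \<mu>) = of_real (- ((\<eta> + \<mu> powr \<nu>) powr \<delta> - \<eta> powr \<delta>))" if "0 < \<mu>" for \<mu>
  proof -
    have "complex_of_real \<mu> powr of_real \<nu> = of_real (\<mu> powr \<nu>)"
      using that by (simp add: powr_of_real)
    then have "H 1 (of_real \<mu>) = of_real (\<eta> + \<mu> powr \<nu>) powr of_real \<delta>"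
      by (simp add: H_def)
    also have "\<dots> = of_real ((\<eta> + \<mu> powr \<nu>) powr \<delta>)"
      using pos by (intro powr_of_real) (auto simp: add_nonneg_nonneg)
    finally show ?thesis by (simp add: f_def)
  qed
  have pk: "of_real (p k) = (- of_real rate) ^ k / fact k * (deriv ^^ k) L (of_real rate)"
  proof (rule generating_function_coefficient[OF p pos(2) L[unfolded T_def]])
    fix z :: real assume z: "0 < z" "z < 1"
    define q where "q = - ((\<eta> + (rate * (1 - z)) powr \<nu>) powr \<delta> - \<eta> powr \<delta>)"
    have "summable (\<lambda>j. c j * q ^ j)"
      by (rule summable_norm_cancel) (use c[of "\<bar>q\<bar>"] in \<open>simp add: abs_mult power_abs\<close>)
    then have "of_real (\<Sum>j. c j * q ^ j) = (\<Sum>j. complex_of_real (c j * q ^ j))"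
      by (rule suminf_of_real)
    then show "of_real (\<Sum>k. p k * z ^ k) = L (of_real (rate * (1 - z)))"
      using fr[of "rate * (1 - z)"] z pos by (simp add: eq[OF z] L_def q_def)
  qed
  have fk: "of_real rate ^ k * (deriv ^^ k) (\<lambda>z. f z ^ j) (of_real rate) =
      of_real ((- 1) ^ j * (\<Sum>r=0..j. real (j choose r) * (- (\<eta> powr \<delta>)) ^ (j - r) *
        (\<Sum>m. inner_term \<delta> \<eta> \<nu> rate k r m)))" for j
  proof -
    define d where "d r = (- 1) ^ j * (of_nat (j choose r) * of_real (- (\<eta> powr \<delta>)) ^ (j - r) :: complex)" for r
    have "f z ^ j = (\<Sum>r=0..j. d r * H r z)" if "z \<in> T" for z
    proof -
      \<comment> \<open>Natural powers multiply the exponent without branch trouble; this makes the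
        binomial expansion of \<open>f z ^ j\<close> linear in the \<open>H r\<close>.\<close>
      have "H 1 z ^ r = H r z" for r
      proof -
        have "of_real \<eta> + z powr of_real \<nu> \<noteq> 0" using base[OF that] by (metis less_irrefl zero_complex.sel(1))
        then show ?thesis unfolding H_def powr_def by (simp add: exp_of_nat_mult[symmetric] mult_ac)
      qed
      moreover have "f z ^ j = (- 1) ^ j * (H 1 z + of_real (- (\<eta> powr \<delta>))) ^ j"
        unfolding f_def by (subst power_minus) simp
      ultimately have "f z ^ j = (- 1) ^ j * (\<Sum>r\<le>j. of_nat (j choose r) * H r z * of_real (- (\<eta> powr \<delta>)) ^ (j - r))"
        by (simp only: binomial_ring)
      then show ?thesis
        by (simp add: d_def sum_distrib_left atLeast0AtMost mult_ac)
    qed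
    then have "(deriv ^^ k) (\<lambda>z. f z ^ j) (of_real rate) = (deriv ^^ k) (\<lambda>z. \<Sum>r=0..j. d r * H r z) (of_real rate)"
      by (intro higher_deriv_transform_within_open[of _ T]) (use T f H in \<open>auto intro!: holomorphic_intros\<close>)
    also have "\<dots> = (\<Sum>r=0..j. (deriv ^^ k) (\<lambda>z. d r * H r z) (of_real rate))"
      by (rule higher_deriv_sum[where S = T]) (use T H in \<open>auto intro!: holomorphic_intros\<close>)
    also have "\<dots> = (\<Sum>r=0..j. d r * (deriv ^^ k) (H r) (of_real rate))"
      by (intro sum.cong refl higher_deriv_cmult[OF H]) (use T in auto)
    finally have "of_real rate ^ k * (deriv ^^ k) (\<lambda>z. f z ^ j) (of_real rate) =
        (\<Sum>r=0..j. d r * (of_real rate ^ k * (deriv ^^ k) (H r) (of_real rate)))"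
      by (simp add: sum_distrib_left mult_ac)
    also have "\<dots> = (\<Sum>r=0..j. d r * of_real (\<Sum>m. inner_term \<delta> \<eta> \<nu> rate k r m))"
      unfolding suminf_inner_term[OF pos summ] H_def[abs_def] ..
    finally show ?thesis by (simp add: d_def sum_distrib_left mult_ac)
  qed
  have "(\<lambda>j. (- of_real rate) ^ k / fact k * (of_real (c j) * (deriv ^^ k) (\<lambda>z. f z ^ j) (of_real rate)))
      sums of_real (p k)"
    unfolding pk L_def by (intro sums_mult entire_series_compose(2)[OF c f T])
  also have "(\<lambda>j. (- of_real rate) ^ k / fact k * (of_real (c j) * (deriv ^^ k) (\<lambda>z. f z ^ j) (of_real rate))) =
     (\<lambda>j. of_real ((- 1) ^ k / fact k * ((- 1) ^ j * c j * (\<Sum>r=0..j. real (j choose r) *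
        (- (\<eta> powr \<delta>)) ^ (j - r) * (\<Sum>m. inner_term \<delta> \<eta> \<nu> rate k r m)))))"
  proof
    fix j
    have "(- of_real rate) ^ k / fact k * (of_real (c j) * (deriv ^^ k) (\<lambda>z. f z ^ j) (of_real rate)) =
      (- 1) ^ k / fact k * (of_real (c j) * (of_real rate ^ k * (deriv ^^ k) (\<lambda>z. f z ^ j) (of_real rate)))"
      by (subst power_minus) (simp add: mult_ac)
    then show "(- of_real rate) ^ k / fact k * (of_real (c j) * (deriv ^^ k) (\<lambda>z. f z ^ j) (of_real rate)) =
      of_real ((- 1) ^ k / fact k * ((- 1) ^ j * c j * (\<Sum>r=0..j. real (j choose r) *
        (- (\<eta> powr \<delta>)) ^ (j - r) * (\<Sum>m. inner_term \<delta> \<eta> \<nu> rate k r m))))"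
      unfolding fk by (simp add: mult_ac)
  qed
  finally show ?thesis by (simp only: sums_of_real_iff)
qed

section \<open>Processes at independent random times\<close>

text \<open>The successor makes the approximation strictly larger than \<open>s\<close>, so that it
  converges in \<open>at_right s\<close>; the floor keeps it to countably many values.\<close>

definition dyadic_above :: "nat \<Rightarrow> real \<Rightarrow> real" where
  "dyadic_above m s = real (Suc (nat \<lfloor>2 ^ m * s\<rfloor>)) / 2 ^ m"

lemma dyadic_above_at_right:
  assumes "0 \<le> s"
  shows "filterlim (\<lambda>m. dyadic_above m s) (at_right s) sequentially"
proof -
  have b: "s < dyadic_above m s" "dyadic_above m s \<le> s + (1/2) ^ m" for m
  proof -
    have f: "real (Suc (nat \<lfloor>2 ^ m * s\<rfloor>)) = of_int \<lfloor>2 ^ m * s\<rfloor> + 1" using assms by simp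
    have "2 ^ m * s < of_int \<lfloor>2 ^ m * s\<rfloor> + 1" "of_int \<lfloor>2 ^ m * s\<rfloor> \<le> 2 ^ m * s" by linarith+
    then show "s < dyadic_above m s" "dyadic_above m s \<le> s + (1/2) ^ m"
      unfolding dyadic_above_def f
      by (simp_all add: pos_less_divide_eq pos_divide_le_eq distrib_left power_one_over mult.commute)
  qed
  have "(\<lambda>m. s + (1/2::real) ^ m) \<longlonglongrightarrow> s + 0"
    by (intro tendsto_intros LIMSEQ_power_zero) auto
  then have "(\<lambda>m. dyadic_above m s) \<longlonglongrightarrow> s"
    by (intro tendsto_sandwich[of "\<lambda>_. s" "\<lambda>m. dyadic_above m s" sequentially "\<lambda>m. s + (1/2) ^ m"])
      (simp_all add: b less_imp_le)
  then show ?thesis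
    unfolding filterlim_at using b(1) by (auto intro!: always_eventually simp: less_imp_neq[symmetric])
qed

lemma dyadic_above_tendsto:
  fixes f :: "real \<Rightarrow> 'b::topological_space"
  assumes "0 \<le> s" "continuous (at_right s) f"
  shows "(\<lambda>m. f (dyadic_above m s)) \<longlonglongrightarrow> f s"
  using filterlim_compose[OF _ dyadic_above_at_right[OF assms(1)]] assms(2)
  by (simp add: continuous_within)

text \<open>At each dyadic level the approximation is constant in time on countably many pieces,
  hence jointly measurable; right-continuity gives the process as its pointwise limit. Nothing is
  known of \<open>X\<close> at negative times, hence \<open>max 0\<close>.\<close>

lemma right_continuous_process_measurable:
  fixes X :: "real \<Rightarrow> 'a \<Rightarrow> real"
  assumes meas: "\<And>s. 0 \<le> s \<Longrightarrow> X s \<in> borel_measurable M"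
    and rc: "\<And>s x. 0 \<le> s \<Longrightarrow> x \<in> space M \<Longrightarrow> continuous (at_right s) (\<lambda>s. X s x)"
  shows "(\<lambda>(s, x). X (max 0 s) x) \<in> borel_measurable (borel \<Otimes>\<^sub>M M)"
proof -
  let ?u = "\<lambda>m z. X (dyadic_above m (max 0 (fst z))) (snd z)"
  have lim: "(\<lambda>m. ?u m z) \<longlonglongrightarrow> X (max 0 (fst z)) (snd z)"
    if "z \<in> space (borel \<Otimes>\<^sub>M M)" for z :: "real \<times> 'a"
    using that by (intro dyadic_above_tendsto rc) (auto simp: space_pair_measure)
  have "?u m \<in> borel_measurable (borel \<Otimes>\<^sub>M M)" for m
  proof -
    have "(\<lambda>z::real \<times> 'a. (\<lambda>i z. X (real (Suc i) / 2 ^ m) (snd z)) (nat \<lfloor>2 ^ m * max 0 (fst z)\<rfloor>) z)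
       \<in> borel_measurable (borel \<Otimes>\<^sub>M M)"
    proof (rule measurable_compose_countable[where f = "\<lambda>i z. X (real (Suc i) / 2 ^ m) (snd z)"])
      show "(\<lambda>z. X (real (Suc i) / 2 ^ m) (snd z)) \<in> borel_measurable (borel \<Otimes>\<^sub>M M)" for i
        by (rule measurable_compose[OF measurable_snd meas]) simp
    qed measurable
    then show ?thesis by (simp add: dyadic_above_def)
  qed
  from borel_measurable_LIMSEQ_real[OF lim this] show ?thesis by (simp add: split_beta')
qed

lemma right_continuous_process_at_random_time:
  fixes X :: "real \<Rightarrow> 'a \<Rightarrow> real"
  assumes meas: "\<And>s. 0 \<le> s \<Longrightarrow> X s \<in> borel_measurable M"
    and rc: "\<And>s x. 0 \<le> s \<Longrightarrow> x \<in> space M \<Longrightarrow> continuous (at_right s) (\<lambda>s. X s x)"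
    and R: "R \<in> borel_measurable M" "\<And>x. x \<in> space M \<Longrightarrow> 0 \<le> R x"
  shows "(\<lambda>x. X (R x) x) \<in> borel_measurable M"
proof -
  have "(\<lambda>x. (R x, x)) \<in> measurable M (borel \<Otimes>\<^sub>M M)" using R(1) by measurable
  from measurable_compose[OF this right_continuous_process_measurable[OF meas rc]]
  have "(\<lambda>x. X (max 0 (R x)) x) \<in> borel_measurable M" by simp
  then show ?thesis
    by (rule measurable_cong[THEN iffD1, rotated]) (use R(2) in \<open>auto simp: max_def\<close>)
qed

text \<open>Dominated convergence with the common bound \<open>B\<close>: a partial sum is the
  integrand restricted to \<open>J x < n\<close>. It serves twice, with \<open>J\<close> the dyadic
  index of a random time and with \<open>J\<close> the state of a counting variable.\<close>

lemma (in prob_space) sums_integral_partition: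
  fixes h :: "nat \<Rightarrow> 'a \<Rightarrow> real"
  assumes J[measurable]: "J \<in> measurable M (count_space UNIV)"
    and h[measurable]: "\<And>i. h i \<in> borel_measurable M"
    and B: "\<And>i x. x \<in> space M \<Longrightarrow> \<bar>h i x\<bar> \<le> B"
  shows "(\<lambda>i. \<integral>x. indicator {x. J x = i} x * h i x \<partial>M) sums (\<integral>x. h (J x) x \<partial>M)"
proof -
  have [measurable]: "(\<lambda>x. h (J x) x) \<in> borel_measurable M"
    by (rule measurable_compose_countable[OF h J])
  have int: "integrable M (\<lambda>x. indicator {x. J x = i} x * h i x)" for i
  proof (rule integrable_const_bound[of _ "\<bar>B\<bar>"])
    show "AE x in M. norm (indicator {x. J x = i} x * h i x) \<le> \<bar>B\<bar>"
      using B[of _ i] by (intro AE_I2) (force simp: indicator_def)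
  qed measurable
  have part: "(\<Sum>i<n. indicator {x. J x = i} x * h i x) = indicator {x. J x < n} x * h (J x) x" for n x
    by (simp add: indicator_def if_distrib sum.delta cong: if_cong)
  have "(\<lambda>n. \<integral>x. (\<Sum>i<n. indicator {x. J x = i} x * h i x) \<partial>M) \<longlonglongrightarrow> (\<integral>x. h (J x) x \<partial>M)"
  proof (rule integral_dominated_convergence[where w = "\<lambda>_. \<bar>B\<bar>"])
    show "AE x in M. (\<lambda>n. \<Sum>i<n. indicator {x. J x = i} x * h i x) \<longlonglongrightarrow> h (J x) x"
    proof (rule AE_I2, rule tendsto_eventually)
      fix x
      show "\<forall>\<^sub>F n in sequentially. (\<Sum>i<n. indicator {x. J x = i} x * h i x) = h (J x) x"
        using eventually_gt_at_top[of "J x"] by eventually_elim (simp add: part)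
    qed
    show "AE x in M. norm (\<Sum>i<n. indicator {x. J x = i} x * h i x) \<le> \<bar>B\<bar>" for n
    proof (intro AE_I2)
      fix x assume "x \<in> space M"
      from B[OF this, of "J x"] show "norm (\<Sum>i<n. indicator {x. J x = i} x * h i x) \<le> \<bar>B\<bar>"
        unfolding part by (auto simp: indicator_def)
    qed
  qed measurable
  then show ?thesis
    unfolding sums_def by (subst (asm) Bochner_Integration.integral_sum) (use int in auto)
qed

text \<open>Rounded up to a dyadic level, \<open>R\<close> takes countably many values; on each of
  them the time is fixed and the factorization applies. Right-continuity of \<open>f\<close> and
  continuity of \<open>g\<close> undo the rounding.\<close>

lemma (in prob_space) integral_at_independent_time:
  fixes f :: "real \<Rightarrow> 'a \<Rightarrow> real" and g :: "real \<Rightarrow> real"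
  assumes meas: "\<And>s. 0 \<le> s \<Longrightarrow> f s \<in> borel_measurable M"
    and rc: "\<And>s x. 0 \<le> s \<Longrightarrow> x \<in> space M \<Longrightarrow> continuous (at_right s) (\<lambda>s. f s x)"
    and B: "\<And>s x. 0 \<le> s \<Longrightarrow> x \<in> space M \<Longrightarrow> \<bar>f s x\<bar> \<le> B"
    and R[measurable]: "R \<in> borel_measurable M" and R0: "\<And>x. x \<in> space M \<Longrightarrow> 0 \<le> R x"
    and indep: "\<And>s A. 0 \<le> s \<Longrightarrow> A \<in> sets borel \<Longrightarrow>
      (\<integral>x. indicator A (R x) * f s x \<partial>M) = (\<integral>x. indicator A (R x) \<partial>M) * g s"
    and g: "continuous_on {0..} g"
  shows "(\<integral>x. f (R x) x \<partial>M) = (\<integral>x. g (R x) \<partial>M)"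
proof -
  \<comment> \<open>With \<open>A = UNIV\<close> the factorization shows that \<open>g s\<close> is
    the mean of \<open>f s\<close>, so it inherits the bound.\<close>
  have gB: "\<bar>g s\<bar> \<le> B" if "0 \<le> s" for s
  proof -
    have "g s = (\<integral>x. f s x \<partial>M)" using indep[OF that, of UNIV] by (simp add: prob_space)
    also have "\<bar>\<dots>\<bar> \<le> (\<integral>x. \<bar>f s x\<bar> \<partial>M)" by (rule integral_abs_bound)
    also have "\<dots> \<le> (\<integral>x. B \<partial>M)"
      using B[OF that] meas[OF that] by (intro integral_mono integrable_const_bound[of _ B] integrable_const) auto
    finally show ?thesis by (simp add: prob_space)
  qed
  have dpos: "0 \<le> dyadic_above m s" for m s by (simp add: dyadic_above_def)
  have fR[measurable]: "(\<lambda>x. f (R x) x) \<in> borel_measurable M"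
    by (rule right_continuous_process_at_random_time[OF meas rc R R0])
  define J where "J m x = nat \<lfloor>2 ^ m * R x\<rfloor>" for m x
  have J[measurable]: "J m \<in> measurable M (count_space UNIV)" for m unfolding J_def by measurable
  have dJ: "dyadic_above m (R x) = real (Suc (J m x)) / 2 ^ m" for m x
    by (simp add: dyadic_above_def J_def)
  have fd[measurable]: "(\<lambda>x. f (dyadic_above m (R x)) x) \<in> borel_measurable M" for m
    unfolding dJ by (rule measurable_compose_countable[OF meas J]) simp
  have gd[measurable]: "(\<lambda>x. g (dyadic_above m (R x))) \<in> borel_measurable M" for m
    unfolding dJ by measurable
  have eq: "(\<integral>x. f (dyadic_above m (R x)) x \<partial>M) = (\<integral>x. g (dyadic_above m (R x)) \<partial>M)" for m
  proof -
    have 1: "(\<lambda>i. \<integral>x. indicator {x. J m x = i} x * f (real (Suc i) / 2 ^ m) x \<partial>M) sums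
        (\<integral>x. f (real (Suc (J m x)) / 2 ^ m) x \<partial>M)"
      by (rule sums_integral_partition[where B = B]) (auto intro!: meas B)
    have 2: "(\<lambda>i. \<integral>x. indicator {x. J m x = i} x * g (real (Suc i) / 2 ^ m) \<partial>M) sums
        (\<integral>x. g (real (Suc (J m x)) / 2 ^ m) \<partial>M)"
      by (rule sums_integral_partition[where B = B]) (auto intro!: gB)
    have "(\<integral>x. indicator {x. J m x = i} x * f (real (Suc i) / 2 ^ m) x \<partial>M) =
        (\<integral>x. indicator {x. J m x = i} x * g (real (Suc i) / 2 ^ m) \<partial>M)" for i
    proof -
      define A where "A = {s::real. nat \<lfloor>2 ^ m * s\<rfloor> = i}"
      have "A = (\<lambda>s::real. nat \<lfloor>2 ^ m * s\<rfloor>) -` {i} \<inter> space borel" by (auto simp: A_def)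
      also have "\<dots> \<in> sets borel" by (rule measurable_sets[of _ _ "count_space UNIV"]) auto
      finally have A: "A \<in> sets borel" .
      have "indicator {x. J m x = i} x = (indicator A (R x) :: real)" for x
        by (simp add: A_def J_def indicator_def)
      then show ?thesis using indep[OF _ A, of "real (Suc i) / 2 ^ m"] by simp
    qed
    with 1 2 show ?thesis unfolding dJ by (simp add: sums_iff)
  qed
  have "(\<lambda>m. \<integral>x. f (dyadic_above m (R x)) x \<partial>M) \<longlonglongrightarrow> (\<integral>x. f (R x) x \<partial>M)"
    by (rule integral_dominated_convergence[where w = "\<lambda>_. B"])
      (use R0 dpos in \<open>auto intro!: dyadic_above_tendsto rc B\<close>)
  moreover have "(\<lambda>m. \<integral>x. g (dyadic_above m (R x)) \<partial>M) \<longlonglongrightarrow> (\<integral>x. g (R x) \<partial>M)"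
  proof (rule integral_dominated_convergence[where w = "\<lambda>_. B"])
    have rcg: "continuous (at_right s) g" if "0 \<le> s" for s
    proof -
      have "continuous (at s within {0..}) g" using g that by (simp add: continuous_on_eq_continuous_within)
      then show ?thesis by (rule continuous_within_subset) (use that in auto)
    qed
    \<comment> \<open>\<open>g\<close> is continuous only on \<open>{0..}\<close>, so measurability
      of \<open>g (R x)\<close> is obtained from this limit and not from \<open>g\<close>
      itself.\<close>
    have lim: "(\<lambda>m. g (dyadic_above m (R x))) \<longlonglongrightarrow> g (R x)" if "x \<in> space M" for x
      by (rule dyadic_above_tendsto[OF R0[OF that] rcg[OF R0[OF that]]])
    then show "AE x in M. (\<lambda>m. g (dyadic_above m (R x))) \<longlonglongrightarrow> g (R x)" by simp
    show "(\<lambda>x. g (R x)) \<in> borel_measurable M"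
      by (rule borel_measurable_LIMSEQ_real[OF lim gd])
  qed (use dpos gB in auto)
  ultimately show ?thesis unfolding eq by (rule LIMSEQ_unique)
qed

section \<open>Closure properties of right-continuous increasing processes\<close>

lemma increasing_paths_from_zeroD:
  assumes "increasing_paths_from_zero M X"
  shows "\<And>t. 0 \<le> t \<Longrightarrow> X t \<in> borel_measurable M"
    and "\<And>x. x \<in> space M \<Longrightarrow> X 0 x = 0"
    and "\<And>x s t. x \<in> space M \<Longrightarrow> 0 \<le> s \<Longrightarrow> s \<le> t \<Longrightarrow> X s x \<le> X t x"
    and "\<And>x t. x \<in> space M \<Longrightarrow> 0 \<le> t \<Longrightarrow> continuous (at_right t) (\<lambda>s. X s x)"
    and "\<And>x t. x \<in> space M \<Longrightarrow> 0 \<le> t \<Longrightarrow> 0 \<le> X t x"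
proof -
  show *: "\<And>t. 0 \<le> t \<Longrightarrow> X t \<in> borel_measurable M"
    "\<And>x. x \<in> space M \<Longrightarrow> X 0 x = 0"
    "\<And>x s t. x \<in> space M \<Longrightarrow> 0 \<le> s \<Longrightarrow> s \<le> t \<Longrightarrow> X s x \<le> X t x"
    "\<And>x t. x \<in> space M \<Longrightarrow> 0 \<le> t \<Longrightarrow> continuous (at_right t) (\<lambda>s. X s x)"
    using assms unfolding increasing_paths_from_zero_def mono_on_def by auto
  show "\<And>x t. x \<in> space M \<Longrightarrow> 0 \<le> t \<Longrightarrow> 0 \<le> X t x"
    using *(2) *(3)[of _ 0] by fastforce
qed

text \<open>\<open>g\<close> may be constant to the right of \<open>t\<close>, so \<open>g s\<close>
  need not approach \<open>g t\<close> from strictly above. Monotonicity keeps it in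
  \<open>{g t..}\<close>, and adding the point itself does not change the limit filter.\<close>

lemma continuous_at_right_compose_mono:
  fixes f g :: "real \<Rightarrow> real"
  assumes g: "continuous (at_right t) g" "\<And>s. t \<le> s \<Longrightarrow> g t \<le> g s"
    and f: "continuous (at_right (g t)) f"
  shows "continuous (at_right t) (\<lambda>s. f (g s))"
proof (rule continuous_within_compose2[OF g(1)])
  have "at (g t) within {g t..} = at_right (g t)"
    by (rule at_within_nhd[of _ UNIV]) auto
  then have "continuous (at (g t) within {g t..}) f"
    using f by (simp add: continuous_within)
  then show "continuous (at (g t) within g ` {t<..}) f"
    by (rule continuous_within_subset) (use g(2) in auto)
qed

lemma increasing_paths_compose:
  assumes X: "increasing_paths_from_zero M X" and R: "increasing_paths_from_zero M R"
  shows "increasing_paths_from_zero M (\<lambda>t x. X (R t x) x)"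
proof -
  note X = increasing_paths_from_zeroD[OF X] and R = increasing_paths_from_zeroD[OF R]
  show ?thesis
    unfolding increasing_paths_from_zero_def
  proof (intro conjI allI ballI impI)
    show "(\<lambda>x. X (R t x) x) \<in> borel_measurable M" if "0 \<le> t" for t
      by (rule right_continuous_process_at_random_time[OF X(1,4) R(1)[OF that] R(5)[OF _ that]])
    show "continuous (at_right t) (\<lambda>s. X (R s x) x)" if "x \<in> space M" "0 \<le> t" for t x
      by (rule continuous_at_right_compose_mono[OF R(4) R(3) X(4)]) (use that R(5) in auto)
    show "X (R 0 x) x = 0" if "x \<in> space M" for x
      using that by (simp add: X(2) R(2))
    show "mono_on {0..} (\<lambda>t. X (R t x) x)" if "x \<in> space M" for x
      using that by (intro mono_onI X(3) R(3) R(5)) auto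
  qed
qed

section \<open>Laplace transforms at independent random times\<close>

lemma (in prob_space) laplace_at_independent_time:
  assumes X: "increasing_paths_from_zero M X"
    and R: "R \<in> borel_measurable M" "\<And>x. x \<in> space M \<Longrightarrow> 0 \<le> R x"
    and \<theta>: "0 \<le> \<theta>"
    and indep: "\<And>s A. 0 \<le> s \<Longrightarrow> A \<in> sets borel \<Longrightarrow>
      (\<integral>x. indicator A (R x) * exp (- \<theta> * X s x) \<partial>M) = (\<integral>x. indicator A (R x) \<partial>M) * exp (- s * \<Phi>)"
  shows "(\<integral>x. exp (- \<theta> * X (R x) x) \<partial>M) = (\<integral>x. exp (- R x * \<Phi>) \<partial>M)"
proof (rule integral_at_independent_time[where B = 1 and g = "\<lambda>s. exp (- s * \<Phi>)" and f = "\<lambda>s x. exp (- \<theta> * X s x)"])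
  note X = increasing_paths_from_zeroD[OF X]
  show "(\<lambda>x. exp (- \<theta> * X s x)) \<in> borel_measurable M" if "0 \<le> s" for s
    using X(1)[OF that] by measurable
  show "continuous (at_right s) (\<lambda>s. exp (- \<theta> * X s x))" if "0 \<le> s" "x \<in> space M" for s x
    using X(4)[OF that(2,1)] by (intro continuous_intros)
  show "\<bar>exp (- \<theta> * X s x)\<bar> \<le> 1" if "0 \<le> s" "x \<in> space M" for s x
    using X(5)[OF that(2,1)] \<theta> by simp
  show "continuous_on {0..} (\<lambda>s. exp (- s * \<Phi>))" by (intro continuous_intros)
qed (fact R indep)+

lemma measurable_nat_of_real_measurable:
  assumes "(\<lambda>x. real (J x)) \<in> borel_measurable M"
  shows "J \<in> measurable M (count_space UNIV)"
proof -
  have "(\<lambda>x. nat \<lfloor>real (J x)\<rfloor>) \<in> measurable M (count_space UNIV)"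
    using assms by measurable
  then show ?thesis by simp
qed

lemma measurable_path_evaluation:
  "0 \<le> s \<Longrightarrow> (\<lambda>p. p s) \<in> measurable path_space borel"
  unfolding path_space_def by (rule measurable_component_singleton) simp

context prob_space
begin

lemma independent_process_pairD:
  assumes "independent_process_pair M X Y" "0 \<le> s" "0 \<le> u"
  shows "indep_var borel (X s) borel (Y u)"
proof -
  have "indep_var borel ((\<lambda>p. p s) \<circ> process_path X) borel ((\<lambda>p. p u) \<circ> process_path Y)"
    using assms(1) unfolding independent_process_pair_def
    by (rule indep_var_compose[OF _ measurable_path_evaluation[OF assms(2)] measurable_path_evaluation[OF assms(3)]])
  then show ?thesis using assms by (simp add: process_path_def o_def)
qed

lemma independent_processesD:
  assumes "independent_processes M I X" "\<And>i. i \<in> I \<Longrightarrow> 0 \<le> s i"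
  shows "indep_vars (\<lambda>_. borel) (\<lambda>i. X i (s i)) I"
proof -
  have "indep_vars (\<lambda>_. borel) (\<lambda>i x. (\<lambda>p. p (s i)) (process_path (X i) x)) I"
    using assms(1) unfolding independent_processes_def
    by (rule indep_vars_compose2) (rule measurable_path_evaluation[OF assms(2)])
  moreover have "(\<lambda>x. process_path (X i) x (s i)) = X i (s i)" if "i \<in> I" for i
    using assms(2)[OF that] by (simp add: process_path_def fun_eq_iff)
  then have "indep_vars (\<lambda>_. borel) (\<lambda>i x. process_path (X i) x (s i)) I \<longleftrightarrow>
      indep_vars (\<lambda>_. borel) (\<lambda>i. X i (s i)) I"
    by (intro indep_vars_cong refl)
  ultimately show ?thesis by blast
qed

text \<open>The version for a pair of processes, used for the Poisson process at \<open>Y\<close>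
  and for the resulting process at \<open>U\<close>. The weighted sums below need joint independence
  of a whole family instead.\<close>

lemma laplace_at_indep_var_time:
  assumes X: "increasing_paths_from_zero M X"
    and R: "\<And>x. x \<in> space M \<Longrightarrow> 0 \<le> R x"
    and \<theta>: "0 \<le> \<theta>"
    and indep: "\<And>s. 0 \<le> s \<Longrightarrow> indep_var borel (X s) borel R"
    and lap: "\<And>s. 0 \<le> s \<Longrightarrow> (\<integral>x. exp (- \<theta> * X s x) \<partial>M) = exp (- s * \<Phi>)"
  shows "(\<integral>x. exp (- \<theta> * X (R x) x) \<partial>M) = (\<integral>x. exp (- R x * \<Phi>) \<partial>M)"
proof (rule laplace_at_independent_time[OF X _ R \<theta>])
  note X = increasing_paths_from_zeroD[OF X]
  show Rm: "R \<in> borel_measurable M" using indep_var_rv2[OF indep[of 0]] by simp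
  fix s :: real and A assume s: "0 \<le> s" and A: "A \<in> sets (borel :: real measure)"
  have "indep_var borel ((\<lambda>y. exp (- \<theta> * y)) \<circ> X s) borel ((\<lambda>r. indicator A r :: real) \<circ> R)"
    by (rule indep_var_compose[OF indep[OF s]]) (use A in auto)
  then have ind: "indep_var borel (\<lambda>x. exp (- \<theta> * X s x)) borel (\<lambda>x. indicator A (R x) :: real)"
    by (simp add: o_def)
  have "(\<integral>x. exp (- \<theta> * X s x) * indicator A (R x) \<partial>M) =
      (\<integral>x. exp (- \<theta> * X s x) \<partial>M) * (\<integral>x. indicator A (R x) \<partial>M)"
  proof (rule indep_var_lebesgue_integral[OF ind])
    show "integrable M (\<lambda>x. indicator A (R x) :: real)"
      using A Rm by (intro integrable_const_bound[of _ 1]) auto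
    show "integrable M (\<lambda>x. exp (- \<theta> * X s x))"
      using X(1)[OF s] X(5)[OF _ s] \<theta> by (intro integrable_const_bound[of _ 1]) auto
  qed
  then show "(\<integral>x. indicator A (R x) * exp (- \<theta> * X s x) \<partial>M) = (\<integral>x. indicator A (R x) \<partial>M) * exp (- s * \<Phi>)"
    by (simp only: lap[OF s] mult.commute[of "indicator A _"] mult.commute[of "exp (- s * \<Phi>)"])
qed

text \<open>The two weights serve two processes: \<open>stable_sum\<close> scales values by
  \<open>c\<close> with \<open>b\<close> equal to \<open>1\<close>, and \<open>prabhakar_sum\<close>
  scales time by \<open>b\<close> with \<open>c\<close> equal to \<open>1\<close>.\<close>

lemma increasing_paths_weighted_sum:
  assumes V: "\<And>r. r \<in> A \<Longrightarrow> increasing_paths_from_zero M (V r)"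
    and bc: "\<And>r. r \<in> A \<Longrightarrow> 0 \<le> b r" "\<And>r. r \<in> A \<Longrightarrow> 0 \<le> c r"
  shows "increasing_paths_from_zero M (\<lambda>t x. \<Sum>r\<in>A. c r * V r (b r * t) x)"
proof -
  note VD = increasing_paths_from_zeroD[OF V]
  have scale: "continuous (at_right t) (\<lambda>s. V r (b r * s) x)"
    if "r \<in> A" "0 \<le> t" "x \<in> space M" for r t x
  proof (rule continuous_at_right_compose_mono[where f = "\<lambda>s. V r s x" and g = "\<lambda>s. b r * s"])
    show "continuous (at_right t) (\<lambda>s. b r * s)" by (intro continuous_intros)
    show "\<And>s. t \<le> s \<Longrightarrow> b r * t \<le> b r * s" using bc(1)[OF \<open>r \<in> A\<close>] by (rule mult_left_mono[rotated])
    show "continuous (at_right (b r * t)) (\<lambda>s. V r s x)"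
      using that bc(1)[OF that(1)] by (intro VD(4)) auto
  qed
  show ?thesis
    unfolding increasing_paths_from_zero_def
  proof (intro conjI allI ballI impI)
    show "(\<lambda>x. \<Sum>r\<in>A. c r * V r (b r * t) x) \<in> borel_measurable M" if "0 \<le> t" for t
      using that bc(1) by (intro borel_measurable_sum borel_measurable_times VD(1)) auto
    show "continuous (at_right t) (\<lambda>s. \<Sum>r\<in>A. c r * V r (b r * s) x)" if "x \<in> space M" "0 \<le> t" for t x
      using that by (intro continuous_intros scale)
    show "(\<Sum>r\<in>A. c r * V r (b r * 0) x) = 0" if "x \<in> space M" for x
      using that VD(2) by (intro sum.neutral) auto
    show "mono_on {0..} (\<lambda>t. \<Sum>r\<in>A. c r * V r (b r * t) x)" if "x \<in> space M" for x
      using that bc by (intro mono_onI sum_mono mult_left_mono VD(3)) auto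
  qed
qed

text \<open>At fixed times the family consists of independent real variables, so the expectation of
  the exponentials times an indicator of \<open>G t\<close> factors and the exponents add up. This
  is the factorization that allows the fixed time to be replaced by \<open>G t\<close>.\<close>

lemma laplace_subordinated_weighted_sum:
  assumes A: "finite A"
    and indep: "independent_processes M (insert None (Some ` A)) (case_option G V)"
    and V: "\<And>r. r \<in> A \<Longrightarrow> increasing_paths_from_zero M (V r)"
    and lapV: "\<And>r. r \<in> A \<Longrightarrow> has_laplace_exponent M (V r) (\<Phi> r)"
    and G: "increasing_paths_from_zero M G"
    and bc: "\<And>r. r \<in> A \<Longrightarrow> 0 \<le> b r" "\<And>r. r \<in> A \<Longrightarrow> 0 \<le> c r"
    and \<theta>: "0 \<le> \<theta>" and t: "0 \<le> t"
  shows "(\<integral>x. exp (- \<theta> * (\<Sum>r\<in>A. c r * V r (b r * G t x) x)) \<partial>M) =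
    (\<integral>x. exp (- G t x * (\<Sum>r\<in>A. b r * \<Phi> r (\<theta> * c r))) \<partial>M)"
proof -
  note VD = increasing_paths_from_zeroD[OF V] and GD = increasing_paths_from_zeroD[OF G]
  let ?Z = "\<lambda>s x. \<Sum>r\<in>A. c r * V r (b r * s) x"
  show ?thesis
  proof (rule laplace_at_independent_time[OF increasing_paths_weighted_sum[OF V bc] GD(1)[OF t] GD(5)[OF _ t] \<theta>])
    fix s :: real and B assume s: "0 \<le> s" and B: "B \<in> sets (borel :: real measure)"
    let ?I = "insert None (Some ` A)"
    \<comment> \<open>Index \<open>None\<close> is the subordinating process, observed at
      \<open>t\<close> through an indicator; \<open>Some r\<close> is \<open>V r\<close>, observed
      at a scaled fixed time through its exponential.\<close>
    define \<tau> where "\<tau> i = (case i of None \<Rightarrow> t | Some r \<Rightarrow> b r * s)" for i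
    define h :: "'b option \<Rightarrow> real \<Rightarrow> real" where
      "h i = (case i of None \<Rightarrow> indicator B | Some r \<Rightarrow> (\<lambda>y. exp (- (\<theta> * c r) * y)))" for i
    define X where "X i x = h i ((case_option G V) i (\<tau> i) x)" for i x
    have "indep_vars (\<lambda>_. borel) (\<lambda>i. (case_option G V) i (\<tau> i)) ?I"
      by (rule independent_processesD[OF indep]) (use s t bc in \<open>auto simp: \<tau>_def\<close>)
    then have X: "indep_vars (\<lambda>_. borel) X ?I"
      unfolding X_def[abs_def]
      by (rule indep_vars_compose2[where Y = h]) (use B in \<open>auto simp: h_def\<close>)
    have XS: "X (Some r) x = exp (- (\<theta> * c r) * V r (b r * s) x)" for r x
      by (simp add: X_def h_def \<tau>_def)
    have XN: "X None = (\<lambda>x. indicator B (G t x))"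
      by (simp add: X_def[abs_def] h_def \<tau>_def)
    have "integrable M (X i)" if "i \<in> ?I" for i
    proof (rule integrable_const_bound[of _ 1])
      show "X i \<in> borel_measurable M" using X that by (auto simp: indep_vars_def)
      show "AE x in M. norm (X i x) \<le> 1"
        using that VD(5) \<theta> bc s by (intro AE_I2) (auto simp: XS XN indicator_def)
    qed
    then have "(\<integral>x. (\<Prod>i\<in>?I. X i x) \<partial>M) = (\<Prod>i\<in>?I. \<integral>x. X i x \<partial>M)"
      by (intro indep_vars_lebesgue_integral X) (use A in auto)
    moreover have "(\<Prod>i\<in>?I. X i x) = indicator B (G t x) * exp (- \<theta> * ?Z s x)" for x
      using A by (subst prod.insert)
        (auto simp: prod.reindex XS XN exp_sum[symmetric] sum_distrib_left mult_ac sum_negf)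
    moreover have "(\<integral>x. X (Some r) x \<partial>M) = exp (- s * (b r * \<Phi> r (\<theta> * c r)))" if "r \<in> A" for r
    proof -
      have "0 \<le> b r * s" "0 \<le> \<theta> * c r" using s \<theta> bc that by auto
      then have "(\<integral>x. exp (- (\<theta> * c r) * V r (b r * s) x) \<partial>M) = exp (- (b r * s) * \<Phi> r (\<theta> * c r))"
        using lapV[OF that] by (simp only: has_laplace_exponent_def)
      then show ?thesis unfolding XS by (simp add: mult_ac)
    qed
    then have "(\<Prod>i\<in>?I. \<integral>x. X i x \<partial>M) = (\<integral>x. indicator B (G t x) \<partial>M) *
        exp (- s * (\<Sum>r\<in>A. b r * \<Phi> r (\<theta> * c r)))"
      using A by (subst prod.insert)
        (auto simp: prod.reindex XN exp_sum[symmetric] sum_distrib_left sum_negf)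
    ultimately show "(\<integral>x. indicator B (G t x) * exp (- \<theta> * ?Z s x) \<partial>M) = (\<integral>x. indicator B (G t x) \<partial>M) *
        exp (- s * (\<Sum>r\<in>A. b r * \<Phi> r (\<theta> * c r)))"
      by simp
  qed
qed

lemma integral_geometric_of_nat_rv:
  assumes J: "J \<in> measurable M (count_space (UNIV :: nat set))" and z: "0 \<le> z" "z \<le> 1"
  shows "(\<lambda>i. prob {x \<in> space M. J x = i} * z ^ i) sums (\<integral>x. z ^ J x \<partial>M)"
proof -
  have "(\<integral>x. indicator {x. J x = i} x * z ^ i \<partial>M) = prob {x \<in> space M. J x = i} * z ^ i" for i
  proof -
    have "{x. J x = i} \<inter> space M = {x \<in> space M. J x = i}" by auto
    then show ?thesis by simp
  qed
  moreover have "(\<lambda>i. \<integral>x. indicator {x. J x = i} x * z ^ i \<partial>M) sums (\<integral>x. z ^ J x \<partial>M)"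
    by (rule sums_integral_partition[OF J, where B = 1]) (use z in \<open>auto simp: power_le_one\<close>)
  ultimately show ?thesis by (simp only:)
qed

end

lemma laplace_poisson_process:
  assumes M: "prob_space M" and N: "poisson_process M rate N" and rate: "0 < rate"
    and s: "0 \<le> s" and \<theta>: "0 \<le> \<theta>"
  shows "(\<integral>x. exp (- \<theta> * real (N s x)) \<partial>M) = exp (- s * (rate * (1 - exp (- \<theta>))))"
proof -
  interpret prob_space M by fact
  have inc: "increasing_paths_from_zero M (\<lambda>t x. real (N t x))"
    using N by (simp add: poisson_process_def)
  have N0: "N 0 x = 0" if "x \<in> space M" for x
    using increasing_paths_from_zeroD(2)[OF inc that] by simp
  show ?thesis
  \<comment> \<open>The Poisson law is given only for increments over intervals of positive length.
    Time zero rests on \<open>N 0 x = 0\<close>, which otherwise identifies \<open>N s\<close> with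
    the increment from zero.\<close>
  proof (cases "s = 0")
    case True
    have "(\<integral>x. exp (- \<theta> * real (N s x)) \<partial>M) = (\<integral>x. 1 \<partial>M)"
      by (rule Bochner_Integration.integral_cong) (use N0 True in auto)
    then show ?thesis using True by (simp add: prob_space)
  next
    case False
    with s have s: "0 < s" by simp
    define \<mu> where "\<mu> = rate * s"
    have \<mu>: "0 < \<mu>" using s rate by (simp add: \<mu>_def)
    have Nm: "N s \<in> measurable M (count_space UNIV)"
      using s by (intro measurable_nat_of_real_measurable increasing_paths_from_zeroD(1)[OF inc]) simp
    have "distr M (count_space UNIV) (\<lambda>x. N s x - N 0 x) = distr M (count_space UNIV) (N s)"
      by (rule distr_cong) (use N0 in auto)
    then have d: "distr M (count_space UNIV) (N s) = measure_pmf (poisson_pmf \<mu>)"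
      using N s by (simp add: poisson_process_def \<mu>_def)
    have p: "prob {x \<in> space M. N s x = i} = \<mu> ^ i / fact i * exp (- \<mu>)" for i
    proof -
      have "measure (distr M (count_space UNIV) (N s)) {i} = prob (N s -` {i} \<inter> space M)"
        by (rule measure_distr[OF Nm]) simp
      then show ?thesis
        using \<mu> by (simp add: d measure_pmf_single vimage_def Int_def conj_commute)
    qed
    define z where "z = exp (- \<theta>)"
    have z: "0 \<le> z" "z \<le> 1" using \<theta> by (auto simp: z_def)
    have "(\<lambda>i. (\<mu> * z) ^ i /\<^sub>R fact i) sums exp (\<mu> * z)" by (rule exp_converges)
    then have "(\<lambda>i. exp (- \<mu>) * ((\<mu> * z) ^ i /\<^sub>R fact i)) sums (exp (- \<mu>) * exp (\<mu> * z))"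
      by (rule sums_mult)
    then have "(\<lambda>i. prob {x \<in> space M. N s x = i} * z ^ i) sums (exp (- \<mu>) * exp (\<mu> * z))"
      unfolding p by (simp add: power_mult_distrib field_simps)
    then have "(\<integral>x. z ^ N s x \<partial>M) = exp (- \<mu>) * exp (\<mu> * z)"
      using integral_geometric_of_nat_rv[OF Nm z] by (rule sums_unique2[rotated])
    then show ?thesis
      unfolding z_def by (simp add: exp_of_nat_mult[symmetric] mult_ac \<mu>_def mult_exp_exp algebra_simps)
  qed
qed

section \<open>Moments of hitting times\<close>

lemma hitting_time_nonneg: "0 \<le> hitting_time W t x"
  unfolding hitting_time_def by (intro real_of_ereal_pos INF_greatest) auto

text \<open>A time \<open>s0\<close> at which the path exceeds \<open>t\<close> makes the infimum
  finite, so the coercion from the extended reals loses nothing. Nothing is claimed at the hitting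
  time itself, a single point being negligible for the integrals over \<open>s\<close>.\<close>

lemma hitting_time_separates:
  assumes mono: "\<And>s s'. 0 \<le> s \<Longrightarrow> s \<le> s' \<Longrightarrow> W s x \<le> W s' x"
    and ex: "0 \<le> s0" "t < W s0 x" and s: "0 \<le> s"
  shows "s < hitting_time W t x \<Longrightarrow> W s x \<le> t"
    and "hitting_time W t x < s \<Longrightarrow> t < W s x"
proof -
  define I where "I = (INF s\<in>{s. 0 \<le> s \<and> t < W s x}. ereal s)"
  have "0 \<le> I" unfolding I_def by (intro INF_greatest) auto
  moreover have "I \<le> ereal s0" unfolding I_def using ex by (intro INF_lower) auto
  ultimately have "\<bar>I\<bar> \<noteq> \<infinity>" by auto
  then have I: "I = ereal (hitting_time W t x)"
    unfolding hitting_time_def I_def[symmetric] by (simp add: ereal_real)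
  show "W s x \<le> t" if "s < hitting_time W t x"
  proof (rule ccontr)
    assume "\<not> W s x \<le> t"
    then have "I \<le> ereal s" unfolding I_def using s by (intro INF_lower) auto
    then show False using that I by simp
  qed
  show "t < W s x" if "hitting_time W t x < s"
  proof -
    have "I < ereal s" using that I by simp
    then obtain s' where "0 \<le> s'" "t < W s' x" "s' < s"
      unfolding I_def by (auto simp: INF_less_iff)
    then show ?thesis using mono[of s' s] by simp
  qed
qed

section \<open>Elementary integrals\<close>

lemma nn_integral_power_over_fact:
  fixes h :: real
  assumes "0 \<le> h"
  shows "(\<integral>\<^sup>+s. ennreal (s ^ i / fact i) * indicator {0..h} s \<partial>lborel) = ennreal (h ^ Suc i / fact (Suc i))"
proof -
  have "(\<integral>\<^sup>+s. ennreal (s ^ i / fact i) * indicator {0..h} s \<partial>lborel) =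
      ennreal (h ^ Suc i / fact (Suc i) - 0 ^ Suc i / fact (Suc i))"
  proof (rule nn_integral_FTC_Icc[OF _ _ _ assms])
    show "DERIV (\<lambda>s. s ^ Suc i / fact (Suc i)) s :> s ^ i / fact i" for s :: real
      by (rule derivative_eq_intros refl | simp)+
  qed auto
  then show ?thesis by simp
qed

lemma nn_integral_exp_tail:
  fixes \<mu> a :: real
  assumes "0 < \<mu>"
  shows "(\<integral>\<^sup>+t. ennreal (exp (- \<mu> * t)) * indicator {a..} t \<partial>lborel) = ennreal (exp (- \<mu> * a) / \<mu>)"
proof -
  have "(\<integral>\<^sup>+t. ennreal (exp (- \<mu> * t)) * indicator {a..} t \<partial>lborel) =
      ennreal (0 - (- exp (- \<mu> * a) / \<mu>))"
  proof (rule nn_integral_FTC_atLeast)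
    show "DERIV (\<lambda>t. - exp (- \<mu> * t) / \<mu>) t :> exp (- \<mu> * t)" for t
      using assms by (auto intro!: derivative_eq_intros)
    have "((\<lambda>t. - exp (- (\<mu> * t)) / \<mu>) \<longlongrightarrow> - 0 / \<mu>) at_top"
      using assms
      by (intro tendsto_intros filterlim_compose[OF exp_at_bot] filterlim_compose[OF filterlim_uminus_at_bot_at_top]
        filterlim_tendsto_pos_mult_at_top[OF tendsto_const _ filterlim_ident]) auto
    then show "((\<lambda>t. - exp (- \<mu> * t) / \<mu>) \<longlongrightarrow> 0) at_top" by simp
  qed auto
  then show ?thesis by simp
qed

text \<open>Up to the factor \<open>\<Psi> ^ Suc i\<close> the integrand is the Erlang density, of
  total mass one.\<close>

lemma nn_integral_power_exp:
  fixes \<Psi> :: real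
  assumes "0 < \<Psi>"
  shows "(\<integral>\<^sup>+s. ennreal (s ^ i / fact i * exp (- s * \<Psi>)) * indicator {0..} s \<partial>lborel) = ennreal (1 / \<Psi> ^ Suc i)"
proof -
  have "(\<integral>\<^sup>+s. ennreal (s ^ i / fact i * exp (- s * \<Psi>)) * indicator {0..} s \<partial>lborel) =
      (\<integral>\<^sup>+s. ennreal (1 / \<Psi> ^ Suc i) * ennreal (erlang_density i \<Psi> s) \<partial>lborel)"
  proof (rule nn_integral_cong)
    fix s :: real
    show "ennreal (s ^ i / fact i * exp (- s * \<Psi>)) * indicator {0..} s =
        ennreal (1 / \<Psi> ^ Suc i) * ennreal (erlang_density i \<Psi> s)"
      using assms by (auto simp: erlang_density_def indicator_def ennreal_mult'[symmetric] field_simps)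
  qed
  also have "\<dots> = ennreal (1 / \<Psi> ^ Suc i) * (\<integral>\<^sup>+s. ennreal (erlang_density i \<Psi> s) \<partial>lborel)"
    by (rule nn_integral_cmult) simp
  also have "(\<integral>\<^sup>+s. ennreal (erlang_density i \<Psi> s) \<partial>lborel) = 1"
    using prob_space.emeasure_space_1[OF prob_space_erlang_density[OF assms, of i]]
    by (simp add: emeasure_density)
  finally show ?thesis by simp
qed

text \<open>
  For \<open>i = j - 1\<close> this is \<open>E (U t)^j / j!\<close>: almost every \<open>s\<close> with \<open>W s \<le> t\<close> lies below the
  hitting time, and conversely.  The truncation \<open>max 0 s\<close> only serves joint measurability.
\<close>

definition occupation_moment :: "'a measure \<Rightarrow> (real \<Rightarrow> 'a \<Rightarrow> real) \<Rightarrow> nat \<Rightarrow> real \<Rightarrow> ennreal" where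
  "occupation_moment M W i t =
     (\<integral>\<^sup>+x. \<integral>\<^sup>+s. ennreal (s ^ i / fact i) * indicator {s. 0 \<le> s \<and> W (max 0 s) x \<le> t} s \<partial>lborel \<partial>M)"

lemma occupation_moment_mono: "t \<le> t' \<Longrightarrow> occupation_moment M W i t \<le> occupation_moment M W i t'"
  unfolding occupation_moment_def
  by (intro nn_integral_mono mult_left_mono) (auto simp: indicator_def)

section \<open>Hitting times through occupation moments\<close>

context prob_space
begin

text \<open>A Chernoff bound: on \<open>B\<close> the path stays at or below \<open>t\<close> at all
  integer times, so \<open>exp (- t) * prob B\<close> is at most the mean of
  \<open>exp (- W n)\<close>, which decays geometrically in \<open>n\<close>. Integer times keep
  \<open>B\<close> measurable.\<close>

lemma AE_hitting_time_finite:
  assumes W: "increasing_paths_from_zero M W"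
    and lap: "\<And>s. 0 \<le> s \<Longrightarrow> (\<integral>x. exp (- W s x) \<partial>M) = exp (- s * \<Psi>)" and \<Psi>: "0 < \<Psi>"
  shows "AE x in M. \<exists>s\<ge>0. t < W s x"
proof -
  note WD = increasing_paths_from_zeroD[OF W]
  define B where "B = {x \<in> space M. \<forall>n::nat. W (real n) x \<le> t}"
  have [measurable]: "W (real n) \<in> borel_measurable M" for n using WD(1) by simp
  have B[measurable]: "B \<in> sets M" unfolding B_def by measurable
  have "exp (- t) * prob B \<le> exp (- real n * \<Psi>)" for n
  proof -
    have "exp (- t) * prob B = (\<integral>x. exp (- t) * indicator B x \<partial>M)" using B by simp
    also have "\<dots> \<le> (\<integral>x. exp (- W (real n) x) \<partial>M)"
    proof (rule integral_mono)
      show "integrable M (\<lambda>x. exp (- W (real n) x))"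
        using WD(5)[of _ "real n"] by (intro integrable_const_bound[of _ 1]) auto
      show "integrable M (\<lambda>x. exp (- t) * indicator B x)"
        by (intro integrable_mult_right integrable_real_indicator) (auto simp: less_top[symmetric])
      show "exp (- t) * indicator B x \<le> exp (- W (real n) x)" if "x \<in> space M" for x
        by (auto simp: indicator_def B_def)
    qed
    also have "\<dots> = exp (- real n * \<Psi>)" by (rule lap) simp
    finally show ?thesis .
  qed
  moreover have "(\<lambda>n. exp (- real n * \<Psi>)) \<longlonglongrightarrow> 0"
  proof -
    have "(\<lambda>n. exp (- \<Psi>) ^ n) \<longlonglongrightarrow> 0" using \<Psi> by (intro LIMSEQ_power_zero) auto
    then show ?thesis by (simp add: exp_of_nat_mult[symmetric])
  qed
  ultimately have "exp (- t) * prob B \<le> 0"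
    by (intro LIMSEQ_le_const) auto
  then have "prob B = 0" by (simp add: mult_le_0_iff measure_le_0_iff)
  then have "B \<in> null_sets M" using B by (simp add: null_sets_def emeasure_eq_measure)
  then have "AE x in M. x \<notin> B" by (rule AE_not_in)
  then show ?thesis
  proof (rule AE_mp, intro AE_I2 impI)
    fix x assume "x \<in> space M" "x \<notin> B"
    then obtain n :: nat where "t < W (real n) x" by (auto simp: B_def not_le)
    then show "\<exists>s\<ge>0. t < W s x" by (intro exI[of _ "real n"]) simp
  qed
qed

lemma nn_integral_hitting_time_power:
  assumes W: "increasing_paths_from_zero M W"
    and fin: "AE x in M. \<exists>s\<ge>0. t < W s x"
  shows "(\<integral>\<^sup>+x. ennreal (hitting_time W t x ^ Suc i / fact (Suc i)) \<partial>M) = occupation_moment M W i t"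
  unfolding occupation_moment_def
proof (rule nn_integral_cong_AE, rule AE_mp[OF fin], intro AE_I2 impI, elim exE conjE)
  note WD = increasing_paths_from_zeroD[OF W]
  fix x s0 assume x: "x \<in> space M" and s0: "0 \<le> s0" "t < W s0 x"
  show "ennreal (hitting_time W t x ^ Suc i / fact (Suc i)) =
     (\<integral>\<^sup>+s. ennreal (s ^ i / fact i) * indicator {s. 0 \<le> s \<and> W (max 0 s) x \<le> t} s \<partial>lborel)"
  proof -
    define h where "h = hitting_time W t x"
    have mono: "W s x \<le> W s' x" if "0 \<le> s" "s \<le> s'" for s s'
      using that by (intro WD(3)[OF x])
    have below: "W s x \<le> t" if "0 \<le> s" "s < h" for s
      using hitting_time_separates(1)[of W x, OF mono s0] that by (simp add: h_def)
    have above: "t < W s x" if "0 \<le> s" "h < s" for s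
      using hitting_time_separates(2)[of W x, OF mono s0] that by (simp add: h_def)
    have h: "0 \<le> h" unfolding h_def by (rule hitting_time_nonneg)
    have "AE s in lborel. s \<noteq> h" by (rule AE_lborel_singleton)
    then have "AE s in lborel. ennreal (s ^ i / fact i) * indicator {0..h} s =
        ennreal (s ^ i / fact i) * indicator {s. 0 \<le> s \<and> W (max 0 s) x \<le> t} s"
    proof eventually_elim
      case (elim s)
      show ?case
      proof (cases "0 \<le> s")
        case True
        with below[of s] above[of s] elim have "W s x \<le> t \<longleftrightarrow> s \<le> h" by fastforce
        with True show ?thesis by (simp add: indicator_def)
      qed simp
    qed
    then show ?thesis
      using nn_integral_power_over_fact[OF h, of i] unfolding h_def[symmetric]
      by (simp only: nn_integral_cong_AE)
  qed
qed

text \<open>By Tonelli the integrals may be taken in the order \<open>t\<close>, \<open>x\<close>,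
  \<open>s\<close>. The condition \<open>W s \<le> t\<close> leaves an exponential tail in
  \<open>t\<close>, hence \<open>exp (- \<mu> * W s) / \<mu>\<close>; the expectation makes this
  \<open>exp (- s * \<Psi>) / \<mu>\<close>; the integral in \<open>s\<close> is an Erlang
  one.\<close>

lemma laplace_occupation_moment:
  assumes W: "increasing_paths_from_zero M W"
    and lap: "\<And>s. 0 \<le> s \<Longrightarrow> (\<integral>x. exp (- \<mu> * W s x) \<partial>M) = exp (- s * \<Psi>)"
    and pos: "0 < \<mu>" "0 < \<Psi>"
  shows "(\<integral>\<^sup>+t. ennreal (exp (- \<mu> * t)) * indicator {0..} t * occupation_moment M W i t \<partial>lborel) =
    ennreal (1 / (\<mu> * \<Psi> ^ Suc i))"
proof -
  note WD = increasing_paths_from_zeroD[OF W]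
  have W2: "(\<lambda>(s, x). W (max 0 s) x) \<in> borel_measurable (borel \<Otimes>\<^sub>M M)"
    by (rule right_continuous_process_measurable[OF WD(1,4)])
  have Wm[measurable (raw)]: "(\<lambda>z. W (max 0 (f z)) (g z)) \<in> borel_measurable N"
    if "f \<in> borel_measurable N" "g \<in> measurable N M" for f g and N :: "'z measure"
    using measurable_compose[OF measurable_Pair[OF that] W2] by simp
  interpret LM: pair_sigma_finite lborel M ..
  let ?e = "\<lambda>t. ennreal (exp (- \<mu> * t)) * indicator {0..} t"
  let ?h = "\<lambda>s x t. ennreal (s ^ i / fact i) * indicator {s. 0 \<le> s \<and> W (max 0 s) x \<le> t} s :: ennreal"
  have "(\<integral>\<^sup>+t. ?e t * occupation_moment M W i t \<partial>lborel) =
      (\<integral>\<^sup>+t. \<integral>\<^sup>+x. \<integral>\<^sup>+s. ?e t * ?h s x t \<partial>lborel \<partial>M \<partial>lborel)"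
    unfolding occupation_moment_def
  proof (intro nn_integral_cong)
    fix t :: real
    have "(\<integral>\<^sup>+x. \<integral>\<^sup>+s. ?e t * ?h s x t \<partial>lborel \<partial>M) = (\<integral>\<^sup>+x. ?e t * (\<integral>\<^sup>+s. ?h s x t \<partial>lborel) \<partial>M)"
      by (intro nn_integral_cong nn_integral_cmult) measurable
    also have "\<dots> = ?e t * (\<integral>\<^sup>+x. \<integral>\<^sup>+s. ?h s x t \<partial>lborel \<partial>M)"
      by (rule nn_integral_cmult) measurable
    finally show "?e t * (\<integral>\<^sup>+x. \<integral>\<^sup>+s. ?h s x t \<partial>lborel \<partial>M) =
        (\<integral>\<^sup>+x. \<integral>\<^sup>+s. ?e t * ?h s x t \<partial>lborel \<partial>M)" ..
  qed
  also have "\<dots> = (\<integral>\<^sup>+x. \<integral>\<^sup>+t. \<integral>\<^sup>+s. ?e t * ?h s x t \<partial>lborel \<partial>lborel \<partial>M)"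
    by (rule LM.Fubini'[symmetric]) measurable
  also have "\<dots> = (\<integral>\<^sup>+x. \<integral>\<^sup>+s. \<integral>\<^sup>+t. ?e t * ?h s x t \<partial>lborel \<partial>lborel \<partial>M)"
    by (intro nn_integral_cong lborel_pair.Fubini') measurable
  also have "\<dots> = (\<integral>\<^sup>+s. \<integral>\<^sup>+x. \<integral>\<^sup>+t. ?e t * ?h s x t \<partial>lborel \<partial>M \<partial>lborel)"
    by (rule LM.Fubini') measurable
  also have "\<dots> = (\<integral>\<^sup>+s. \<integral>\<^sup>+x. ennreal (1 / \<mu>) * (ennreal (s ^ i / fact i) * indicator {0..} s) * ennreal (exp (- \<mu> * W (max 0 s) x)) \<partial>M \<partial>lborel)"
  proof (intro nn_integral_cong)
    fix s :: real and x assume x: "x \<in> space M"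
    show "(\<integral>\<^sup>+t. ?e t * ?h s x t \<partial>lborel) =
      ennreal (1 / \<mu>) * (ennreal (s ^ i / fact i) * indicator {0..} s) * ennreal (exp (- \<mu> * W (max 0 s) x))"
    proof (cases "0 \<le> s")
      case True
      then have "0 \<le> W (max 0 s) x" using WD(5)[OF x, of s] by simp
      then have "(\<integral>\<^sup>+t. ?e t * ?h s x t \<partial>lborel) =
        (\<integral>\<^sup>+t. ennreal (s ^ i / fact i) * (ennreal (exp (- \<mu> * t)) * indicator {W (max 0 s) x..} t) \<partial>lborel)"
        using True by (intro nn_integral_cong) (auto simp: indicator_def mult.commute)
      also have "\<dots> = ennreal (s ^ i / fact i) * ennreal (exp (- \<mu> * W (max 0 s) x) / \<mu>)"
        by (simp add: nn_integral_cmult nn_integral_exp_tail[OF pos(1), simplified])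
      finally show ?thesis
        using True pos by (simp add: ennreal_mult'[symmetric] field_simps)
    qed simp
  qed
  also have "\<dots> = (\<integral>\<^sup>+s. ennreal (1 / \<mu>) * (ennreal (s ^ i / fact i * exp (- s * \<Psi>)) * indicator {0..} s) \<partial>lborel)"
  proof (rule nn_integral_cong)
    fix s :: real
    show "(\<integral>\<^sup>+x. ennreal (1 / \<mu>) * (ennreal (s ^ i / fact i) * indicator {0..} s) * ennreal (exp (- \<mu> * W (max 0 s) x)) \<partial>M) =
      ennreal (1 / \<mu>) * (ennreal (s ^ i / fact i * exp (- s * \<Psi>)) * indicator {0..} s)"
    proof (cases "0 \<le> s")
      case True
      have [measurable]: "W s \<in> borel_measurable M" using WD(1)[OF True] .
      have "(\<integral>\<^sup>+x. ennreal (exp (- \<mu> * W s x)) \<partial>M) = ennreal (exp (- s * \<Psi>))"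
        unfolding lap[OF True, symmetric]
        using WD(5)[OF _ True] pos by (intro nn_integral_eq_integral integrable_const_bound[of _ 1]) auto
      then show ?thesis
        using True by (simp add: nn_integral_cmult ennreal_mult'[symmetric])
          (simp add: ennreal_mult'[symmetric] mult.assoc)
    qed simp
  qed
  also have "\<dots> = ennreal (1 / \<mu>) * ennreal (1 / \<Psi> ^ Suc i)"
    by (subst nn_integral_cmult) (simp_all only: nn_integral_power_exp[OF pos(2)], measurable)
  finally show ?thesis using pos by (simp add: ennreal_mult'[symmetric])
qed

end

section \<open>Laplace transforms\<close>

text \<open>With \<open>y = exp (- t)\<close> the hypothesis says that all monomials
  \<open>y ^ n\<close> integrate to zero against \<open>d\<close>. By Stone-Weierstrass, polynomials
  approximate \<open>g\<close> uniformly on \<open>{0..1}\<close>, which contains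
  \<open>exp (- t)\<close> for all \<open>t \<ge> 0\<close>, and integrability of \<open>d\<close>
  controls the error.\<close>

lemma integral_continuous_of_exp_eq_0:
  fixes d g :: "real \<Rightarrow> real"
  assumes d: "integrable lborel (\<lambda>t. indicator {0..} t * d t)"
    and zero: "\<And>n::nat. (\<integral>t. indicator {0..} t * (exp (- real n * t) * d t) \<partial>lborel) = 0"
    and g: "continuous_on UNIV g"
  shows "integrable lborel (\<lambda>t. indicator {0..} t * (g (exp (- t)) * d t))"
    and "(\<integral>t. indicator {0..} t * (g (exp (- t)) * d t) \<partial>lborel) = 0"
proof -
  let ?d = "\<lambda>t. indicator {0..} t * d t"
  have bnd: "integrable lborel (\<lambda>t. indicator {0..} t * (h (exp (- t)) * d t))"
    and est: "\<bar>\<integral>t. indicator {0..} t * (h (exp (- t)) * d t) \<partial>lborel\<bar> \<le> B * (\<integral>t. \<bar>?d t\<bar> \<partial>lborel)"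
    if h: "continuous_on UNIV h" and B: "\<And>y. 0 \<le> y \<Longrightarrow> y \<le> 1 \<Longrightarrow> \<bar>h y\<bar> \<le> B" for h :: "real \<Rightarrow> real" and B
  proof -
    have [measurable]: "h \<in> borel_measurable borel"
      using h by (rule borel_measurable_continuous_onI)
    have le: "norm (indicator {0..} t * (h (exp (- t)) * d t)) \<le> B * \<bar>?d t\<bar>" for t
    proof (cases "0 \<le> t")
      case True
      then have "\<bar>h (exp (- t))\<bar> \<le> B" by (intro B) auto
      then show ?thesis using True by (simp add: abs_mult mult_right_mono)
    qed simp
    have [measurable]: "?d \<in> borel_measurable lborel" using d by (rule borel_measurable_integrable)
    have m: "(\<lambda>t. indicator {0..} t * (h (exp (- t)) * d t)) \<in> borel_measurable lborel"
    proof -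
      have "(\<lambda>t. h (exp (- t)) * ?d t) \<in> borel_measurable lborel" by measurable
      then show ?thesis by (simp add: mult_ac)
    qed
    show *: "integrable lborel (\<lambda>t. indicator {0..} t * (h (exp (- t)) * d t))"
      by (rule Bochner_Integration.integrable_bound[OF integrable_mult_right[OF integrable_abs[OF d], of B] m])
        (use le in \<open>auto intro!: AE_I2 intro: order_trans[OF _ abs_ge_self]\<close>)
    have "\<bar>\<integral>t. indicator {0..} t * (h (exp (- t)) * d t) \<partial>lborel\<bar> \<le>
        (\<integral>t. \<bar>indicator {0..} t * (h (exp (- t)) * d t)\<bar> \<partial>lborel)"
      by (rule integral_abs_bound)
    also have "\<dots> \<le> (\<integral>t. B * \<bar>?d t\<bar> \<partial>lborel)"
      by (rule integral_mono[OF integrable_abs[OF *] integrable_mult_right[OF integrable_abs[OF d]]])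
        (use le in simp)
    finally show "\<bar>\<integral>t. indicator {0..} t * (h (exp (- t)) * d t) \<partial>lborel\<bar> \<le> B * (\<integral>t. \<bar>?d t\<bar> \<partial>lborel)"
      by simp
  qed
  have bdd: "\<exists>B. \<forall>y. 0 \<le> y \<longrightarrow> y \<le> 1 \<longrightarrow> \<bar>h y\<bar> \<le> B" if "continuous_on UNIV h" for h :: "real \<Rightarrow> real"
  proof -
    have "compact (h ` {0..1})"
      by (rule compact_continuous_image[OF continuous_on_subset[OF that]]) auto
    then have "bounded (h ` {0..1})" by (rule compact_imp_bounded)
    then obtain B where "\<forall>y\<in>{0..1}. norm (h y) \<le> B" by (auto simp: bounded_iff)
    then show ?thesis by (intro exI[of _ B]) auto
  qed
  have intg: "integrable lborel (\<lambda>t. indicator {0..} t * (h (exp (- t)) * d t))"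
    if "continuous_on UNIV h" for h :: "real \<Rightarrow> real"
    using bdd[OF that] bnd[OF that] by blast
  then show "integrable lborel (\<lambda>t. indicator {0..} t * (g (exp (- t)) * d t))" using g .
  define K where "K = (\<integral>t. \<bar>?d t\<bar> \<partial>lborel)"
  have K: "0 \<le> K" unfolding K_def by simp
  have "\<bar>\<integral>t. indicator {0..} t * (g (exp (- t)) * d t) \<partial>lborel\<bar> \<le> e" if e: "0 < e" for e
  proof -
    \<comment> \<open>\<open>K\<close> is the integral of the absolute value of \<open>d\<close>
      over \<open>{0..}\<close>; the added \<open>1\<close> covers \<open>K = 0\<close>.\<close>
    define e' where "e' = e / (K + 1)"
    have e': "0 < e'" using e K by (simp add: e'_def)
    obtain p where p: "real_polynomial_function p" "\<And>y. y \<in> {0..1} \<Longrightarrow> \<bar>g y - p y\<bar> < e'"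
      using Stone_Weierstrass_real_polynomial_function[of "{0..1::real}" g e']
        continuous_on_subset[OF g] e' by auto
    from p(1) obtain a n where pn: "p = (\<lambda>y. \<Sum>i\<le>n. a i * y ^ i)"
      by (auto simp: real_polynomial_function_iff_sum)
    have pc: "continuous_on UNIV p" unfolding pn by (intro continuous_intros)
    have "(\<integral>t. indicator {0..} t * (p (exp (- t)) * d t) \<partial>lborel) =
        (\<integral>t. (\<Sum>i\<le>n. a i * (indicator {0..} t * ((exp (- t)) ^ i * d t))) \<partial>lborel)"
      unfolding pn by (simp add: sum_distrib_left sum_distrib_right mult_ac)
    also have "\<dots> = (\<Sum>i\<le>n. a i * (\<integral>t. indicator {0..} t * ((exp (- t)) ^ i * d t) \<partial>lborel))"
      by (subst Bochner_Integration.integral_sum)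
        (auto intro!: integrable_mult_right intg[where h = "\<lambda>y. y ^ i" for i] continuous_intros)
    also have "\<dots> = 0"
    proof (intro sum.neutral ballI)
      fix i
      have "(exp (- t)) ^ i = exp (- real i * t)" for t :: real
        by (simp add: exp_of_nat_mult[symmetric])
      then show "a i * (\<integral>t. indicator {0..} t * ((exp (- t)) ^ i * d t) \<partial>lborel) = 0"
        using zero[of i] by simp
    qed
    finally have p0: "(\<integral>t. indicator {0..} t * (p (exp (- t)) * d t) \<partial>lborel) = 0" .
    have gp: "continuous_on UNIV (\<lambda>y. g y - p y)" using g pc by (intro continuous_intros)
    have "(\<integral>t. indicator {0..} t * (g (exp (- t)) * d t) \<partial>lborel) =
        (\<integral>t. indicator {0..} t * (g (exp (- t)) * d t) \<partial>lborel) - (\<integral>t. indicator {0..} t * (p (exp (- t)) * d t) \<partial>lborel)"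
      using p0 by simp
    also have "\<dots> = (\<integral>t. indicator {0..} t * (g (exp (- t)) * d t) - indicator {0..} t * (p (exp (- t)) * d t) \<partial>lborel)"
      by (rule Bochner_Integration.integral_diff[symmetric, OF intg[OF g] intg[OF pc]])
    also have "\<dots> = (\<integral>t. indicator {0..} t * ((g (exp (- t)) - p (exp (- t))) * d t) \<partial>lborel)"
      by (simp add: algebra_simps)
    also have "\<bar>\<dots>\<bar> \<le> e' * K" unfolding K_def
      by (rule est[OF gp]) (use p(2) in \<open>auto intro: less_imp_le\<close>)
    also have "\<dots> \<le> e" using e K by (simp add: e'_def field_simps)
    finally show ?thesis .
  qed
  then show "(\<integral>t. indicator {0..} t * (g (exp (- t)) * d t) \<partial>lborel) = 0"
    by (meson abs_le_zero_iff field_le_epsilon add_0 le_less_trans dense_ge not_le)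
qed

text \<open>Were \<open>d\<close> positive on the interval, a tent function of
  \<open>exp (- t)\<close> supported there would give a nonnegative integrand with integral zero
  that is positive on a set of positive measure. One point per interval is all that the next lemma
  asks for.\<close>

lemma exp_moments_0_imp_not_positive:
  fixes d :: "real \<Rightarrow> real"
  assumes d: "integrable lborel (\<lambda>t. indicator {0..} t * d t)"
    and zero: "\<And>n::nat. (\<integral>t. indicator {0..} t * (exp (- real n * t) * d t) \<partial>lborel) = 0"
    and ab: "0 \<le> a" "a < b"
  shows "\<exists>t. a < t \<and> t < b \<and> d t \<le> 0"
proof (rule ccontr)
  assume "\<not> ?thesis"
  then have pos: "0 < d t" if "a < t" "t < b" for t using that by (meson not_le)
  \<comment> \<open>The exponential reverses order: the tent is positive exactly between
    \<open>exp (- b)\<close> and \<open>exp (- a)\<close>.\<close>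
  define g where "g y = max 0 (min (y - exp (- b)) (exp (- a) - y))" for y :: real
  have g: "continuous_on UNIV g" unfolding g_def by (intro continuous_intros)
  have gpos: "0 < g (exp (- t)) \<longleftrightarrow> a < t \<and> t < b" for t by (auto simp: g_def less_max_iff_disj)
  have gnn: "0 \<le> g y" for y by (simp add: g_def)
  let ?f = "\<lambda>t. indicator {0..} t * (g (exp (- t)) * d t)"
  have nn: "0 \<le> ?f t" for t
  proof (cases "a < t \<and> t < b")
    case True
    then show ?thesis using pos[of t] gnn[of "exp (- t)"] by (simp add: indicator_def)
  next
    case False
    then have "g (exp (- t)) = 0" using gpos[of t] gnn[of "exp (- t)"] by linarith
    then show ?thesis by simp
  qed
  have "AE t in lborel. ?f t = 0"
    using integral_continuous_of_exp_eq_0[OF d zero g] nn by (subst (asm) integral_nonneg_eq_0_iff_AE) auto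
  then have "AE t in lborel. t \<notin> {a<..<b}"
  proof eventually_elim
    case (elim t)
    show ?case
    proof
      assume "t \<in> {a<..<b}"
      then have "0 < g (exp (- t))" "0 < d t" "0 \<le> t" using gpos[of t] pos[of t] ab by auto
      then show False using elim by simp
    qed
  qed
  then have "emeasure lborel {t. a < t \<and> t < b} = 0"
    by (subst (asm) AE_iff_measurable[OF _ refl]) auto
  moreover have "{t. a < t \<and> t < b} = {a<..<b}" by auto
  ultimately have "emeasure lborel {a<..<b} = 0" by simp
  then show False using ab by simp
qed

text \<open>The difference cannot keep a strict sign on an interval. Monotonicity of
  \<open>m\<close> and continuity of \<open>c\<close> turn this into equality at every
  \<open>t\<close>: \<open>m t > c t\<close> would persist on an interval to the right of
  \<open>t\<close>, and \<open>m t < c t\<close> on one to the left.\<close>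

lemma laplace_transform_unique:
  fixes m c :: "real \<Rightarrow> real"
  assumes mono: "\<And>s t. 0 \<le> s \<Longrightarrow> s \<le> t \<Longrightarrow> m s \<le> m t" and c: "continuous_on {0..} c"
    and im: "\<And>n::nat. integrable lborel (\<lambda>t. indicator {0..} t * (exp (- (\<mu> + real n) * t) * m t))"
    and ic: "\<And>n::nat. integrable lborel (\<lambda>t. indicator {0..} t * (exp (- (\<mu> + real n) * t) * c t))"
    and eq: "\<And>n::nat. (\<integral>t. indicator {0..} t * (exp (- (\<mu> + real n) * t) * m t) \<partial>lborel) =
      (\<integral>t. indicator {0..} t * (exp (- (\<mu> + real n) * t) * c t) \<partial>lborel)"
    and t: "0 < t"
  shows "m t = c t"
proof -
  \<comment> \<open>Absorbing \<open>exp (- \<mu> * t)\<close> moves the rates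
    \<open>\<mu> + n\<close> to the natural numbers, the case of monomials in
    \<open>exp (- t)\<close>.\<close>
  define d where "d t = exp (- \<mu> * t) * (m t - c t)" for t
  have split: "indicator {0..} t * (exp (- real n * t) * d t) =
      indicator {0..} t * (exp (- (\<mu> + real n) * t) * m t) - indicator {0..} t * (exp (- (\<mu> + real n) * t) * c t)"
    for n :: nat and t :: real
  proof -
    have "exp (- (\<mu> + real n) * t) = exp (- real n * t) * exp (- \<mu> * t)"
      by (simp add: mult_exp_exp algebra_simps)
    then show ?thesis by (simp add: d_def algebra_simps)
  qed
  have d: "integrable lborel (\<lambda>t. indicator {0..} t * d t)"
    using Bochner_Integration.integrable_diff[OF im ic, of 0 0] split[of _ 0] by simp
  have zero: "(\<integral>t. indicator {0..} t * (exp (- real n * t) * d t) \<partial>lborel) = 0" for n :: nat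
    unfolding split using im ic eq by (subst Bochner_Integration.integral_diff) auto
  have d': "integrable lborel (\<lambda>t. indicator {0..} t * - d t)" using integrable_minus[OF d] by simp
  have zero': "(\<integral>t. indicator {0..} t * (exp (- real n * t) * - d t) \<partial>lborel) = 0" for n :: nat
    using zero[of n] by simp
  have isC: "isCont c t" using c t
    by (intro continuous_on_interior[of "{0..}"]) auto
  show ?thesis
  proof (rule antisym)
    show "m t \<le> c t"
    proof (rule ccontr)
      assume "\<not> m t \<le> c t"
      then have "eventually (\<lambda>s. c s < m t) (at t)" using isC by (intro order_tendstoD(2)) (auto simp: isCont_def)
      then obtain e where e: "0 < e" "\<And>s. s \<noteq> t \<Longrightarrow> dist s t < e \<Longrightarrow> c s < m t"
        by (auto simp: eventually_at)
      obtain s where s: "t < s" "s < t + e" "d s \<le> 0"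
        using exp_moments_0_imp_not_positive[OF d zero, of t "t + e"] t e by auto
      then have "c s < m t" by (intro e) (auto simp: dist_real_def)
      also have "m t \<le> m s" using s t by (intro mono) auto
      finally show False using s by (simp add: d_def mult_le_0_iff)
    qed
  next
    show "c t \<le> m t"
    proof (rule ccontr)
      assume "\<not> c t \<le> m t"
      then have "eventually (\<lambda>s. m t < c s) (at t)" using isC by (intro order_tendstoD(1)) (auto simp: isCont_def)
      then obtain e where e: "0 < e" "\<And>s. s \<noteq> t \<Longrightarrow> dist s t < e \<Longrightarrow> m t < c s"
        by (auto simp: eventually_at)
      obtain s where s: "max 0 (t - e) < s" "s < t" "- d s \<le> 0"
        using exp_moments_0_imp_not_positive[OF d' zero', of "max 0 (t - e)" t] t e by auto
      then have "m t < c s" by (intro e) (auto simp: dist_real_def)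
      moreover have "m s \<le> m t" using s by (intro mono) auto
      ultimately show False using s by (simp add: d_def zero_le_mult_iff)
    qed
  qed
qed

section \<open>Laplace transform of the Mittag-Leffler series\<close>

lemma has_bochner_integral_powr_exp:
  assumes x: "0 < x" and \<mu>: "0 < (\<mu>::real)"
  shows "has_bochner_integral lborel (\<lambda>t. indicator {0..} t * (exp (- \<mu> * t) * t powr (x - 1)))
    (Gamma x * \<mu> powr (- x))"
proof -
  let ?f = "\<lambda>t::real. indicator {0..} t * t powr (x - 1) / exp t"
  have "has_bochner_integral lborel ?f (Gamma x)"
    using Gamma_real_pos[OF x]
    by (intro has_bochner_integral_nn_integral)
      (auto simp: Gamma_conv_nn_integral_real[OF x])
  then have "has_bochner_integral lborel (\<lambda>t. ?f (0 + \<mu> * t)) (Gamma x /\<^sub>R \<bar>\<mu>\<bar>)"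
    using \<mu> by (subst (asm) lborel_has_bochner_integral_real_affine_iff[of \<mu> _ _ 0]) auto
  then have "has_bochner_integral lborel (\<lambda>t. \<mu> powr (1 - x) * ?f (\<mu> * t)) (\<mu> powr (1 - x) * (Gamma x / \<mu>))"
    using \<mu> by (intro has_bochner_integral_mult_right) (simp_all add: divide_inverse_commute)
  also have "(\<lambda>t. \<mu> powr (1 - x) * ?f (\<mu> * t)) = (\<lambda>t. indicator {0..} t * (exp (- \<mu> * t) * t powr (x - 1)))"
  proof
    fix t :: real
    show "\<mu> powr (1 - x) * ?f (\<mu> * t) = indicator {0..} t * (exp (- \<mu> * t) * t powr (x - 1))"
    proof (cases "0 \<le> t")
      case True
      then have "(\<mu> * t) powr (x - 1) = \<mu> powr (x - 1) * t powr (x - 1)"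
        using \<mu> by (intro powr_mult)
      moreover have "\<mu> powr (1 - x) * \<mu> powr (x - 1) = 1" using \<mu> by (simp add: powr_add[symmetric])
      ultimately have "\<mu> powr (1 - x) * (\<mu> * t) powr (x - 1) = t powr (x - 1)" by simp
      then show ?thesis using True \<mu> by (simp add: exp_minus field_simps)
    qed (use \<mu> in \<open>auto simp: zero_le_mult_iff\<close>)
  qed
  also have "\<mu> powr (1 - x) * (Gamma x / \<mu>) = Gamma x * \<mu> powr (- x)"
    using \<mu> by (simp add: powr_diff powr_minus field_simps)
  finally show ?thesis .
qed

text \<open>For \<open>s \<ge> t\<close> one has \<open>s powr a \<ge> t powr a\<close>, so the
  Gamma integral is at least \<open>t powr a\<close> times the exponential tail from
  \<open>t\<close> on. The resulting bound is geometric in \<open>a\<close>, with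
  \<open>\<mu>\<close> free, and avoids Gamma asymptotics.\<close>

lemma powr_rGamma_le:
  fixes t a \<mu> :: real
  assumes a: "0 \<le> a" and \<mu>: "0 < \<mu>" and t: "0 < t"
  shows "t powr a * rGamma (a + 1) \<le> exp (\<mu> * t) * \<mu> powr (- a)"
proof -
  have 1: "has_bochner_integral lborel (\<lambda>s. indicator {0..} s * (exp (- \<mu> * s) * s powr a))
    (Gamma (a + 1) * \<mu> powr (- (a + 1)))"
    using has_bochner_integral_powr_exp[of "a + 1" \<mu>] a \<mu> by simp
  have "has_bochner_integral lborel (\<lambda>s. indicator {0..} s * (exp (- \<mu> * s) * s powr (1 - 1)))
    (Gamma 1 * \<mu> powr (- 1))"
    by (rule has_bochner_integral_powr_exp) (use \<mu> in auto)
  \<comment> \<open>Translation by \<open>t\<close> turns the case \<open>x = 1\<close> into the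
    tail integral. The factor \<open>powr (1 - 1)\<close> is \<open>1\<close> except at
    \<open>s = t\<close>, where \<open>0 powr 0 = 0\<close>; so the comparison below is nontrivial
    only for \<open>t < s\<close>.\<close>
  then have "has_bochner_integral lborel (\<lambda>s. indicator {0..} (- t + 1 * s) * (exp (- \<mu> * (- t + 1 * s)) * (- t + 1 * s) powr (1 - 1)))
    ((Gamma 1 * \<mu> powr (- 1)) /\<^sub>R \<bar>1\<bar>)"
    by (subst (asm) lborel_has_bochner_integral_real_affine_iff[of 1 _ _ "- t"]) auto
  then have "has_bochner_integral lborel (\<lambda>s. (exp (- \<mu> * t) * t powr a) * (indicator {0..} (- t + 1 * s) * (exp (- \<mu> * (- t + 1 * s)) * (- t + 1 * s) powr (1 - 1))))
    ((exp (- \<mu> * t) * t powr a) * ((Gamma 1 * \<mu> powr (- 1)) /\<^sub>R \<bar>1\<bar>))"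
    by (rule has_bochner_integral_mult_right[rotated])
  then have 2: "has_bochner_integral lborel (\<lambda>s. (exp (- \<mu> * t) * t powr a) * (indicator {0..} (- t + 1 * s) * (exp (- \<mu> * (- t + 1 * s)) * (- t + 1 * s) powr (1 - 1))))
    (exp (- \<mu> * t) * t powr a / \<mu>)" using \<mu> by (simp add: powr_minus divide_inverse)
  have "(exp (- \<mu> * t) * t powr a) * (indicator {0..} (- t + 1 * s) * (exp (- \<mu> * (- t + 1 * s)) * (- t + 1 * s) powr (1 - 1)))
     \<le> indicator {0..} s * (exp (- \<mu> * s) * s powr a)" for s
  proof (cases "t < s")
    case True
    have "(exp (- \<mu> * t) * t powr a) * exp (- \<mu> * (- t + s)) = exp (- \<mu> * s) * t powr a"
      by (simp add: mult_exp_exp algebra_simps)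
    also have "\<dots> \<le> exp (- \<mu> * s) * s powr a"
      using True t a by (intro mult_left_mono powr_mono2) auto
    finally show ?thesis using True t by (simp add: indicator_def)
  qed (auto simp: indicator_def)
  with 1 2 have "exp (- \<mu> * t) * t powr a / \<mu> \<le> Gamma (a + 1) * \<mu> powr (- (a + 1))"
    unfolding has_bochner_integral_iff by (metis (no_types, lifting) integral_mono)
  also have "\<mu> powr (- (a + 1)) = \<mu> powr (- a) / \<mu>"
    using \<mu> by (simp add: powr_diff)
  finally have "exp (- \<mu> * t) * t powr a \<le> Gamma (a + 1) * \<mu> powr (- a)"
    using \<mu> by (simp add: field_simps)
  then have "exp (\<mu> * t) * (exp (- \<mu> * t) * t powr a) \<le> exp (\<mu> * t) * (Gamma (a + 1) * \<mu> powr (- a))"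
    by (rule mult_left_mono) simp
  moreover have "exp (\<mu> * t) * (exp (- \<mu> * t) * t powr a) = t powr a"
    by (simp only: mult.assoc[symmetric] mult_exp_exp) simp
  moreover have "exp (\<mu> * t) * (Gamma (a + 1) * \<mu> powr (- a)) = exp (\<mu> * t) * \<mu> powr (- a) * Gamma (a + 1)"
    by (simp only: mult_ac)
  ultimately have "t powr a \<le> exp (\<mu> * t) * \<mu> powr (- a) * Gamma (a + 1)" by (simp only:)
  moreover have "0 < Gamma (a + 1)" using a by (intro Gamma_real_pos) simp
  ultimately have "t powr a / Gamma (a + 1) \<le> exp (\<mu> * t) * \<mu> powr (- a)"
    by (simp only: pos_divide_le_eq)
  then show ?thesis by (simp only: rGamma_inverse_Gamma divide_inverse)
qed

text \<open>Up to sign, \<open>pochhammer c i / fact i\<close> is the generalized binomial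
  coefficient of \<open>- c\<close>.\<close>

lemma binomial_pochhammer_sums:
  fixes c y :: real
  assumes "\<bar>y\<bar> < 1"
  shows "(\<lambda>i. (- y) ^ i * pochhammer c i / fact i) sums (1 + y) powr (- c)"
proof -
  have "(- c gchoose i) * y ^ i = (- y) ^ i * pochhammer c i / fact i" for i
    by (simp add: gbinomial_pochhammer power_minus[of y] mult_ac)
  then show ?thesis using gen_binomial_real[OF assms, of "- c"] by simp
qed

text \<open>The prefactor is kept inside so that for \<open>t > 0\<close> each term is a multiple of
  one power of \<open>t\<close>, whose Laplace transform is again a power. The sign of
  \<open>b\<close> is free: the series takes \<open>- \<omega>\<close>, its absolute values take
  \<open>\<bar>b\<bar>\<close>.\<close>

definition ml_term :: "real \<Rightarrow> real \<Rightarrow> nat \<Rightarrow> real \<Rightarrow> real \<Rightarrow> nat \<Rightarrow> real \<Rightarrow> real" where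
  "ml_term \<alpha> \<beta> j c b i t = (t powr \<beta>) ^ j *
     ((b * t powr \<alpha>) ^ i * pochhammer c i / fact i * rGamma (\<alpha> * real i + (\<beta> * real j + 1)))"

context
  fixes \<alpha> \<beta> c :: real and j :: nat
  assumes ab: "0 < \<alpha>" "0 < \<beta>" and c: "0 \<le> c"
begin

lemma pochhammer_c_nonneg: "0 \<le> pochhammer c i"
  using c by (induction i) (auto simp: pochhammer_Suc)

lemma ml_term_eq:
  assumes "0 < t"
  shows "ml_term \<alpha> \<beta> j c b i t = b ^ i * pochhammer c i / fact i *
    (t powr (\<alpha> * real i + \<beta> * real j) * rGamma (\<alpha> * real i + \<beta> * real j + 1))"
  using assms unfolding ml_term_def
  by (simp add: power_mult_distrib powr_power powr_add mult_ac add_ac)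

lemma ml_term_le:
  assumes \<mu>: "0 < \<mu>" and t: "0 \<le> t"
  shows "\<bar>ml_term \<alpha> \<beta> j c b i t\<bar> \<le> exp (\<mu> * t) * \<mu> powr (- \<beta> * real j) * ((\<bar>b\<bar> * \<mu> powr (- \<alpha>)) ^ i * pochhammer c i / fact i)"
proof -
  have e: "\<mu> powr (- (\<alpha> * real i + \<beta> * real j)) = \<mu> powr (- \<beta> * real j) * (\<mu> powr (- \<alpha>)) ^ i"
    using \<mu> by (simp add: powr_power powr_add[symmetric] algebra_simps)
  have a: "0 \<le> \<alpha> * real i + \<beta> * real j" using ab by simp
  have rG: "0 \<le> rGamma (\<alpha> * real i + \<beta> * real j + 1)"
    using Gamma_real_pos[of "\<alpha> * real i + \<beta> * real j + 1"] a by (simp add: rGamma_inverse_Gamma)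
  show ?thesis
  proof (cases "t = 0")
    case False
    then have "0 < t" using t by simp
    then have "\<bar>ml_term \<alpha> \<beta> j c b i t\<bar> = \<bar>b\<bar> ^ i * pochhammer c i / fact i *
        (t powr (\<alpha> * real i + \<beta> * real j) * rGamma (\<alpha> * real i + \<beta> * real j + 1))"
      using rG pochhammer_c_nonneg by (simp add: ml_term_eq abs_mult power_abs)
    also have "\<dots> \<le> \<bar>b\<bar> ^ i * pochhammer c i / fact i * (exp (\<mu> * t) * \<mu> powr (- (\<alpha> * real i + \<beta> * real j)))"
      using pochhammer_c_nonneg by (intro mult_left_mono powr_rGamma_le a \<mu> \<open>0 < t\<close>) auto
    finally show ?thesis unfolding e by (simp add: power_mult_distrib mult_ac)
  next
    case True
    have "0 \<le> \<mu> powr (- \<beta> * real j) * ((\<bar>b\<bar> * \<mu> powr (- \<alpha>)) ^ i * pochhammer c i / fact i)"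
      using pochhammer_c_nonneg by (intro mult_nonneg_nonneg divide_nonneg_nonneg) auto
    moreover have "ml_term \<alpha> \<beta> j c b i t = 0" if "\<not> (i = 0 \<and> j = 0)"
      using that True by (auto simp: ml_term_def)
    moreover have "ml_term \<alpha> \<beta> j c b i t = 1" if "i = 0" "j = 0"
      using that by (simp add: ml_term_def)
    ultimately show ?thesis using True \<mu> by (cases "i = 0 \<and> j = 0") auto
  qed
qed

lemma summable_ml_bound:
  assumes "\<bar>b\<bar> * \<mu> powr (- \<alpha>) < 1"
  shows "summable (\<lambda>i. (\<bar>b\<bar> * \<mu> powr (- \<alpha>)) ^ i * pochhammer c i / fact i)"
  using binomial_pochhammer_sums[of "- (\<bar>b\<bar> * \<mu> powr (- \<alpha>))"] assms
  by (simp add: sums_iff abs_mult)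

text \<open>All larger rates are included because transforms are later compared at
  \<open>\<mu> + n\<close> for every \<open>n\<close>.\<close>

lemma exists_large_rate: "\<exists>\<mu>>0. \<forall>\<mu>'\<ge>\<mu>. \<bar>b\<bar> * \<mu>' powr (- \<alpha>) < 1"
proof -
  have "((\<lambda>\<mu>. \<bar>b\<bar> * \<mu> powr (- \<alpha>)) \<longlongrightarrow> \<bar>b\<bar> * 0) at_top"
    using ab by (intro tendsto_intros tendsto_neg_powr filterlim_ident) auto
  then have "eventually (\<lambda>\<mu>. \<bar>b\<bar> * \<mu> powr (- \<alpha>) < 1) at_top"
    by (intro order_tendstoD) auto
  then obtain K where "\<And>\<mu>. \<mu> \<ge> K \<Longrightarrow> \<bar>b\<bar> * \<mu> powr (- \<alpha>) < 1"
    by (auto simp: eventually_at_top_linorder)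
  then show ?thesis by (intro exI[of _ "max K 1"]) auto
qed

lemma summable_ml_term:
  assumes "0 \<le> t"
  shows "summable (\<lambda>i. ml_term \<alpha> \<beta> j c b i t)"
proof -
  obtain \<mu> where \<mu>: "\<mu> > 0" "\<bar>b\<bar> * \<mu> powr (- \<alpha>) < 1" using exists_large_rate[of b] by auto
  show ?thesis
    by (rule summable_comparison_test'[OF summable_mult[OF summable_ml_bound[OF \<mu>(2)]], of 0])
      (use ml_term_le[OF \<mu>(1) assms, of b] in auto)
qed

lemma gen_mittag_leffler_eq_suminf:
  assumes "0 < t"
  shows "(t powr \<beta>) ^ j * gen_mittag_leffler \<alpha> (\<beta> * real j + 1) c (b * t powr \<alpha>) =
    (\<Sum>i. ml_term \<alpha> \<beta> j c b i t)"
proof -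
  have "summable (\<lambda>i. (t powr \<beta>) ^ j * ((b * t powr \<alpha>) ^ i * pochhammer c i / fact i * rGamma (\<alpha> * real i + (\<beta> * real j + 1))))"
    using summable_ml_term[of t b] assms by (simp add: ml_term_def)
  then have "summable (\<lambda>i. (b * t powr \<alpha>) ^ i * pochhammer c i / fact i * rGamma (\<alpha> * real i + (\<beta> * real j + 1)))"
    by (subst (asm) summable_cmult_iff) (use assms in auto)
  then show ?thesis
    unfolding gen_mittag_leffler_def ml_term_def by (rule suminf_mult[symmetric])
qed

lemma continuous_on_ml_series: "continuous_on {0..} (\<lambda>t. \<Sum>i. ml_term \<alpha> \<beta> j c b i t)"
proof -
  obtain \<mu> where \<mu>: "\<mu> > 0" "\<bar>b\<bar> * \<mu> powr (- \<alpha>) < 1" using exists_large_rate[of b] by auto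
  \<comment> \<open>The bound of \<open>ml_term_le\<close> grows with \<open>t\<close>, so uniform
    convergence is obtained on each \<open>{0..K}\<close>; continuity is local, hence this is
    enough.\<close>
  have "continuous_on {0..K} (\<lambda>t. \<Sum>i. ml_term \<alpha> \<beta> j c b i t)" for K
  proof (rule uniform_limit_theorem)
    show "uniform_limit {0..K} (\<lambda>n t. \<Sum>i<n. ml_term \<alpha> \<beta> j c b i t) (\<lambda>t. \<Sum>i. ml_term \<alpha> \<beta> j c b i t) sequentially"
    proof (rule Weierstrass_m_test)
      show "summable (\<lambda>i. exp (\<mu> * K) * \<mu> powr (- \<beta> * real j) * ((\<bar>b\<bar> * \<mu> powr (- \<alpha>)) ^ i * pochhammer c i / fact i))"
        by (rule summable_mult[OF summable_ml_bound[OF \<mu>(2)]])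
      show "norm (ml_term \<alpha> \<beta> j c b i t) \<le> exp (\<mu> * K) * \<mu> powr (- \<beta> * real j) * ((\<bar>b\<bar> * \<mu> powr (- \<alpha>)) ^ i * pochhammer c i / fact i)"
        if "t \<in> {0..K}" for i t
      proof -
        have "exp (\<mu> * t) * \<mu> powr (- \<beta> * real j) * ((\<bar>b\<bar> * \<mu> powr (- \<alpha>)) ^ i * pochhammer c i / fact i)
           \<le> exp (\<mu> * K) * \<mu> powr (- \<beta> * real j) * ((\<bar>b\<bar> * \<mu> powr (- \<alpha>)) ^ i * pochhammer c i / fact i)"
          using that \<mu> pochhammer_c_nonneg
          by (intro mult_right_mono) (auto intro!: mult_nonneg_nonneg divide_nonneg_nonneg)
        then show ?thesis using ml_term_le[OF \<mu>(1), of t b i] that by simp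
      qed
    qed
    show "\<forall>\<^sub>F n in sequentially. continuous_on {0..K} (\<lambda>t. \<Sum>i<n. ml_term \<alpha> \<beta> j c b i t)"
      unfolding ml_term_def using ab
      by (intro always_eventually allI continuous_intros continuous_on_powr') auto
  qed simp
  then have "continuous (at t within {0..t + 1}) (\<lambda>t. \<Sum>i. ml_term \<alpha> \<beta> j c b i t)" if "0 \<le> t" for t
    using that by (simp add: continuous_on_eq_continuous_within)
  moreover have "at t within {0..t + 1} = at t within {0..}" for t :: real
    by (rule at_within_nhd[of _ "{..<t + 1}"]) auto
  ultimately show ?thesis
    by (simp add: continuous_on_eq_continuous_within)
qed

lemma has_bochner_integral_ml_term:
  assumes \<mu>: "0 < \<mu>"
  shows "has_bochner_integral lborel (\<lambda>t. indicator {0..} t * (exp (- \<mu> * t) * ml_term \<alpha> \<beta> j c b i t))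
    (\<mu> powr (- 1 - \<beta> * real j) * ((b * \<mu> powr (- \<alpha>)) ^ i * pochhammer c i / fact i))"
proof -
  define a where "a = \<alpha> * real i + \<beta> * real j"
  have a: "0 \<le> a" using ab by (simp add: a_def)
  define q where "q = b ^ i * pochhammer c i / fact i * rGamma (a + 1)"
  have "Gamma (a + 1) \<noteq> 0" using Gamma_real_pos[of "a + 1"] a by linarith
  then have G: "rGamma (a + 1) * Gamma (a + 1) = 1" by (simp add: rGamma_inverse_Gamma)
  have e: "\<mu> powr (- (a + 1)) = \<mu> powr (- 1 - \<beta> * real j) * (\<mu> powr (- \<alpha>)) ^ i"
    using \<mu> by (simp add: a_def powr_power powr_add[symmetric] algebra_simps)
  have h: "has_bochner_integral lborel (\<lambda>t. q * (indicator {0..} t * (exp (- \<mu> * t) * t powr (a + 1 - 1))))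
      (q * (Gamma (a + 1) * \<mu> powr (- (a + 1))))"
    by (rule has_bochner_integral_mult_right, rule has_bochner_integral_powr_exp) (use a \<mu> in auto)
  \<comment> \<open>The integrands agree only almost everywhere: at \<open>t = 0\<close> with
    \<open>i = j = 0\<close> the closed form gives \<open>0 powr 0 = 0\<close>, while the term is
    \<open>1\<close>.\<close>
  have "AE t in lborel. t \<noteq> (0::real)" by (rule AE_lborel_singleton)
  then have "AE t in lborel. q * (indicator {0..} t * (exp (- \<mu> * t) * t powr (a + 1 - 1))) =
      indicator {0..} t * (exp (- \<mu> * t) * ml_term \<alpha> \<beta> j c b i t)"
  proof eventually_elim
    case (elim t)
    then show ?case
      by (cases "0 < t") (simp_all add: ml_term_eq a_def[symmetric] q_def indicator_def)
  qed
  then have "has_bochner_integral lborel (\<lambda>t. indicator {0..} t * (exp (- \<mu> * t) * ml_term \<alpha> \<beta> j c b i t))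
     (q * (Gamma (a + 1) * \<mu> powr (- (a + 1))))"
    using h by (subst (asm) has_bochner_integral_cong_AE) (auto simp: ml_term_def)
  also have "q * (Gamma (a + 1) * \<mu> powr (- (a + 1))) =
     (b ^ i * pochhammer c i / fact i) * \<mu> powr (- (a + 1)) * (rGamma (a + 1) * Gamma (a + 1))"
    by (simp add: q_def)
  also have "\<dots> = \<mu> powr (- 1 - \<beta> * real j) * ((b * \<mu> powr (- \<alpha>)) ^ i * pochhammer c i / fact i)"
    unfolding G e by (simp add: power_mult_distrib)
  finally show ?thesis .
qed

text \<open>The Pochhammer and reciprocal Gamma factors are nonnegative, so the norms form the same
  series at \<open>\<bar>b\<bar>\<close>. The assumption on \<open>b\<close> makes their transforms
  summable and permits termwise integration; the transforms then add up to a binomial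
  series.\<close>

lemma laplace_ml_series:
  assumes \<mu>: "0 < \<mu>" and b: "\<bar>b\<bar> * \<mu> powr (- \<alpha>) < 1"
  shows "has_bochner_integral lborel (\<lambda>t. indicator {0..} t * (exp (- \<mu> * t) * (\<Sum>i. ml_term \<alpha> \<beta> j c b i t)))
    (\<mu> powr (- 1 - \<beta> * real j) * (1 - b * \<mu> powr (- \<alpha>)) powr (- c))"
proof -
  define f where "f i t = indicator {0..} t * (exp (- \<mu> * t) * ml_term \<alpha> \<beta> j c b i t)" for i t
  note hb = has_bochner_integral_ml_term[OF \<mu>, of b, folded f_def]
  have int: "integrable lborel (f i)" for i
    using hb[of i] by (auto simp: has_bochner_integral_iff f_def[abs_def])
  have norm: "norm (f i t) = indicator {0..} t * (exp (- \<mu> * t) * ml_term \<alpha> \<beta> j c \<bar>b\<bar> i t)" for i t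
  proof -
    have "0 \<le> rGamma (\<alpha> * real i + (\<beta> * real j + 1))"
      using Gamma_real_pos[of "\<alpha> * real i + (\<beta> * real j + 1)"] ab
      by (simp add: rGamma_inverse_Gamma add_nonneg_pos)
    then show ?thesis
      using pochhammer_c_nonneg[of i] by (simp add: f_def ml_term_def abs_mult power_abs)
  qed
  have s: "summable (\<lambda>i. ml_term \<alpha> \<beta> j c b' i t)" if "0 \<le> t" for b' t
    by (rule summable_ml_term[OF that])
  have fsum: "(\<Sum>i. f i t) = indicator {0..} t * (exp (- \<mu> * t) * (\<Sum>i. ml_term \<alpha> \<beta> j c b i t))" for t
    using s[of t b] by (cases "0 \<le> t") (simp_all add: f_def suminf_mult)
  have ae: "AE t in lborel. summable (\<lambda>i. norm (f i t))"
  proof (rule AE_I2)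
    fix t :: real
    show "summable (\<lambda>i. norm (f i t))"
      unfolding norm using s[of t "\<bar>b\<bar>"] by (cases "0 \<le> t") (auto intro: summable_mult)
  qed
  have sn: "summable (\<lambda>i. \<integral>t. norm (f i t) \<partial>lborel)"
  proof -
    have "(\<integral>t. norm (f i t) \<partial>lborel) =
        \<mu> powr (- 1 - \<beta> * real j) * ((\<bar>b\<bar> * \<mu> powr (- \<alpha>)) ^ i * pochhammer c i / fact i)" for i
      unfolding norm using has_bochner_integral_ml_term[OF \<mu>, of "\<bar>b\<bar>" i] by (simp add: has_bochner_integral_iff)
    then show ?thesis using summable_mult[OF summable_ml_bound[OF b]] by simp
  qed
  have "(\<integral>t. (\<Sum>i. f i t) \<partial>lborel) = (\<Sum>i. \<integral>t. f i t \<partial>lborel)"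
    by (rule integral_suminf[OF int ae sn])
  also have "\<dots> = (\<Sum>i. \<mu> powr (- 1 - \<beta> * real j) * ((b * \<mu> powr (- \<alpha>)) ^ i * pochhammer c i / fact i))"
    using hb by (simp add: has_bochner_integral_iff f_def[abs_def])
  also have "\<dots> = \<mu> powr (- 1 - \<beta> * real j) * (1 - b * \<mu> powr (- \<alpha>)) powr (- c)"
  proof -
    have "(\<lambda>i. (b * \<mu> powr (- \<alpha>)) ^ i * pochhammer c i / fact i) sums (1 - b * \<mu> powr (- \<alpha>)) powr (- c)"
      using binomial_pochhammer_sums[of "- (b * \<mu> powr (- \<alpha>))"] b by (simp add: abs_mult)
    from sums_mult[OF this] show ?thesis by (rule sums_unique[symmetric])
  qed
  finally show ?thesis
    using integrable_suminf[OF int ae sn] by (simp add: has_bochner_integral_iff fsum)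
qed

end

section \<open>The inverse of the Prabhakar subordinator\<close>

text \<open>The symbol of the Prabhakar fractional derivative.\<close>

definition prabhakar_exponent :: "real \<Rightarrow> real \<Rightarrow> real \<Rightarrow> real \<Rightarrow> real \<Rightarrow> real" where
  "prabhakar_exponent \<alpha> \<beta> \<gamma> \<omega> \<mu> = \<mu> powr \<beta> * (1 + \<omega> * \<mu> powr (- \<alpha>)) powr \<gamma>"

definition prabhakar_moment :: "real \<Rightarrow> real \<Rightarrow> real \<Rightarrow> real \<Rightarrow> nat \<Rightarrow> real \<Rightarrow> real" where
  "prabhakar_moment \<alpha> \<beta> \<gamma> \<omega> j t =
     (t powr \<beta>) ^ j * gen_mittag_leffler \<alpha> (\<beta> * real j + 1) (\<gamma> * real j) (- \<omega> * t powr \<alpha>)"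

text \<open>Faithful once finiteness is known, which \<open>occupation_moment_eq\<close> provides;
  \<open>enn2real\<close> sends infinity to zero.\<close>

definition occupation_moment_real :: "'a measure \<Rightarrow> (real \<Rightarrow> 'a \<Rightarrow> real) \<Rightarrow> nat \<Rightarrow> real \<Rightarrow> real" where
  "occupation_moment_real M W i t = enn2real (occupation_moment M W i t)"

lemma occupation_moment_real_nonneg: "0 \<le> occupation_moment_real M W i t"
  by (simp add: occupation_moment_real_def)

section \<open>Occupation moments for a general Laplace exponent\<close>

context prob_space
begin

context
  fixes W :: "real \<Rightarrow> 'a \<Rightarrow> real" and \<Psi> :: "real \<Rightarrow> real"
  assumes W: "increasing_paths_from_zero M W"
    and lap: "\<And>s \<mu>. 0 \<le> s \<Longrightarrow> 0 < \<mu> \<Longrightarrow> (\<integral>x. exp (- \<mu> * W s x) \<partial>M) = exp (- s * \<Psi> \<mu>)"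
    and \<Psi>: "\<And>\<mu>. 0 < \<mu> \<Longrightarrow> 0 < \<Psi> \<mu>"
begin

text \<open>The moment increases with \<open>t\<close>, so its value at \<open>t\<close> times the
  exponential tail from \<open>t\<close> on is at most the full Laplace transform. As
  \<open>\<mu>\<close> is free, large values of \<open>\<Psi> \<mu>\<close> give fast geometric
  decay in \<open>i\<close>.\<close>

lemma occupation_moment_le:
  assumes \<mu>: "0 < \<mu>" and t: "0 \<le> t"
  shows "occupation_moment M W i t \<le> ennreal (exp (\<mu> * t) / \<Psi> \<mu> ^ Suc i)"
proof -
  let ?om = "occupation_moment M W i"
  have "?om t * ennreal (exp (- \<mu> * t) / \<mu>) =
      (\<integral>\<^sup>+s. ?om t * (ennreal (exp (- \<mu> * s)) * indicator {t..} s) \<partial>lborel)"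
    by (subst nn_integral_cmult) (auto simp: nn_integral_exp_tail[OF \<mu>, simplified])
  also have "\<dots> \<le> (\<integral>\<^sup>+s. ennreal (exp (- \<mu> * s)) * indicator {0..} s * ?om s \<partial>lborel)"
    using t by (intro nn_integral_mono)
      (auto simp: indicator_def mult.commute intro!: mult_right_mono occupation_moment_mono)
  also have "\<dots> = ennreal (1 / (\<mu> * \<Psi> \<mu> ^ Suc i))"
    by (rule laplace_occupation_moment[OF W lap[OF _ \<mu>] \<mu> \<Psi>[OF \<mu>]])
  finally have "?om t * ennreal (exp (- \<mu> * t) / \<mu>) * ennreal (\<mu> * exp (\<mu> * t)) \<le>
      ennreal (1 / (\<mu> * \<Psi> \<mu> ^ Suc i)) * ennreal (\<mu> * exp (\<mu> * t))"
    by (rule mult_right_mono) simp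
  moreover have "ennreal (exp (- \<mu> * t) / \<mu>) * ennreal (\<mu> * exp (\<mu> * t)) = 1"
    using \<mu> by (simp add: ennreal_mult'[symmetric] mult_exp_exp)
  moreover have "ennreal (1 / (\<mu> * \<Psi> \<mu> ^ Suc i)) * ennreal (\<mu> * exp (\<mu> * t)) = ennreal (exp (\<mu> * t) / \<Psi> \<mu> ^ Suc i)"
    using \<mu> \<Psi>[OF \<mu>] by (simp add: ennreal_mult'[symmetric])
  ultimately show ?thesis by (simp add: mult.assoc)
qed

lemma occupation_moment_eq: "occupation_moment M W i t = ennreal (occupation_moment_real M W i t)"
proof -
  have "occupation_moment M W i t \<le> occupation_moment M W i (max 0 t)"
    by (rule occupation_moment_mono) simp
  also have "\<dots> \<le> ennreal (exp (1 * max 0 t) / \<Psi> 1 ^ Suc i)"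
    by (rule occupation_moment_le) auto
  finally have "occupation_moment M W i t < top"
    using ennreal_less_top le_less_trans by blast
  then show ?thesis by (simp add: occupation_moment_real_def)
qed

lemma occupation_moment_real_mono: "t \<le> t' \<Longrightarrow> occupation_moment_real M W i t \<le> occupation_moment_real M W i t'"
  using occupation_moment_mono[of t t' M W i]
  by (simp add: occupation_moment_eq occupation_moment_real_nonneg)

lemma occupation_moment_real_le:
  assumes "0 < \<mu>" "0 \<le> t"
  shows "occupation_moment_real M W i t \<le> exp (\<mu> * t) / \<Psi> \<mu> ^ Suc i"
  using occupation_moment_le[OF assms, of i] \<Psi>[OF assms(1)]
  by (subst (asm) occupation_moment_eq, subst (asm) ennreal_le_iff) auto

lemma has_bochner_integral_occupation_moment_real:
  assumes \<mu>: "0 < \<mu>"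
  shows "has_bochner_integral lborel (\<lambda>t. indicator {0..} t * (exp (- \<mu> * t) * occupation_moment_real M W i t)) (1 / (\<mu> * \<Psi> \<mu> ^ Suc i))"
proof (rule has_bochner_integral_nn_integral)
  have [measurable]: "occupation_moment_real M W i \<in> borel_measurable borel"
    by (rule borel_measurable_mono) (auto intro!: monoI occupation_moment_real_mono)
  show "(\<lambda>t. indicator {0..} t * (exp (- \<mu> * t) * occupation_moment_real M W i t)) \<in> borel_measurable lborel" by measurable
  have "(\<integral>\<^sup>+t. ennreal (indicator {0..} t * (exp (- \<mu> * t) * occupation_moment_real M W i t)) \<partial>lborel) =
      (\<integral>\<^sup>+t. ennreal (exp (- \<mu> * t)) * indicator {0..} t * occupation_moment M W i t \<partial>lborel)"
    by (intro nn_integral_cong)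
      (auto simp: occupation_moment_eq indicator_def ennreal_mult'[symmetric])
  also have "\<dots> = ennreal (1 / (\<mu> * \<Psi> \<mu> ^ Suc i))"
    by (rule laplace_occupation_moment[OF W lap[OF _ \<mu>] \<mu> \<Psi>[OF \<mu>]])
  finally show "(\<integral>\<^sup>+t. ennreal (indicator {0..} t * (exp (- \<mu> * t) * occupation_moment_real M W i t)) \<partial>lborel) = ennreal (1 / (\<mu> * \<Psi> \<mu> ^ Suc i))" .
qed (use \<mu> \<Psi>[OF \<mu>] in \<open>auto intro!: AE_I2 simp: occupation_moment_real_nonneg\<close>)

lemma has_bochner_integral_hitting_time_power:
  assumes U: "hitting_time W t \<in> borel_measurable M"
  shows "has_bochner_integral M (\<lambda>x. hitting_time W t x ^ Suc i / fact (Suc i)) (occupation_moment_real M W i t)"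
proof (rule has_bochner_integral_nn_integral)
  have "AE x in M. \<exists>s\<ge>0. t < W s x"
    by (rule AE_hitting_time_finite[OF W, of "\<Psi> 1"]) (use lap[of _ 1] \<Psi>[of 1] in auto)
  then show "(\<integral>\<^sup>+x. ennreal (hitting_time W t x ^ Suc i / fact (Suc i)) \<partial>M) = ennreal (occupation_moment_real M W i t)"
    unfolding occupation_moment_eq[symmetric] by (rule nn_integral_hitting_time_power[OF W])
qed (use U occupation_moment_real_nonneg in \<open>auto intro!: AE_I2 divide_nonneg_nonneg mult_nonneg_nonneg simp: hitting_time_nonneg\<close>)

end

section \<open>Identification of the moments for the Prabhakar exponent\<close>

context
  fixes W :: "real \<Rightarrow> 'a \<Rightarrow> real" and \<alpha> \<beta> \<gamma> \<omega> :: real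
  assumes W: "increasing_paths_from_zero M W"
    and lap: "\<And>s \<mu>. 0 \<le> s \<Longrightarrow> 0 < \<mu> \<Longrightarrow>
      (\<integral>x. exp (- \<mu> * W s x) \<partial>M) = exp (- s * prabhakar_exponent \<alpha> \<beta> \<gamma> \<omega> \<mu>)"
    and pos: "0 < \<alpha>" "0 < \<beta>" "0 \<le> \<gamma>" "0 < \<omega>"
begin

text \<open>This yields positivity and growth without bound in \<open>\<mu>\<close>, the source of
  the superexponential decay of the moments.\<close>

lemma prabhakar_exponent_ge:
  assumes "0 < \<mu>"
  shows "\<mu> powr \<beta> \<le> prabhakar_exponent \<alpha> \<beta> \<gamma> \<omega> \<mu>"
proof -
  have "1 \<le> 1 + \<omega> * \<mu> powr (- \<alpha>)" using pos by simp
  then have "1 \<le> (1 + \<omega> * \<mu> powr (- \<alpha>)) powr \<gamma>" using pos by (intro ge_one_powr_ge_zero) auto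
  then show ?thesis unfolding prabhakar_exponent_def by (simp add: mult_le_cancel_left1)
qed

lemma prabhakar_exponent_pos: "0 < \<mu> \<Longrightarrow> 0 < prabhakar_exponent \<alpha> \<beta> \<gamma> \<omega> \<mu>"
  using prabhakar_exponent_ge[of \<mu>] powr_gt_zero[of \<mu> \<beta>] by linarith

text \<open>This puts the transform of an occupation moment into the form of
  \<open>laplace_ml_series\<close> with \<open>b = - \<omega>\<close> and
  \<open>c = \<gamma> * j\<close>.\<close>

lemma prabhakar_exponent_power:
  assumes "0 < \<mu>"
  shows "1 / (\<mu> * prabhakar_exponent \<alpha> \<beta> \<gamma> \<omega> \<mu> ^ j) =
    \<mu> powr (- 1 - \<beta> * real j) * (1 - (- \<omega>) * \<mu> powr (- \<alpha>)) powr (- (\<gamma> * real j))"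
proof -
  have b: "0 < 1 + \<omega> * \<mu> powr (- \<alpha>)" using pos by (simp add: add_pos_nonneg)
  have "prabhakar_exponent \<alpha> \<beta> \<gamma> \<omega> \<mu> ^ j = \<mu> powr (\<beta> * real j) * (1 + \<omega> * \<mu> powr (- \<alpha>)) powr (\<gamma> * real j)"
    using b assms unfolding prabhakar_exponent_def by (simp add: power_mult_distrib powr_power mult.commute)
  moreover have "\<mu> powr (- 1 - \<beta> * real j) = 1 / (\<mu> * \<mu> powr (\<beta> * real j))"
    using assms by (simp add: powr_diff powr_minus_divide)
  moreover have "(1 - (- \<omega>) * \<mu> powr (- \<alpha>)) powr (- (\<gamma> * real j)) = 1 / (1 + \<omega> * \<mu> powr (- \<alpha>)) powr (\<gamma> * real j)"
    by (simp add: powr_minus_divide)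
  ultimately show ?thesis by (simp add: mult.assoc)
qed

lemma prabhakar_occupation_moment:
  shows "t \<le> t' \<Longrightarrow> occupation_moment_real M W i t \<le> occupation_moment_real M W i t'"
    and "0 < \<mu> \<Longrightarrow> has_bochner_integral lborel (\<lambda>t. indicator {0..} t * (exp (- \<mu> * t) * occupation_moment_real M W i t))
      (1 / (\<mu> * prabhakar_exponent \<alpha> \<beta> \<gamma> \<omega> \<mu> ^ Suc i))"
    and "hitting_time W t \<in> borel_measurable M \<Longrightarrow>
      has_bochner_integral M (\<lambda>x. hitting_time W t x ^ Suc i / fact (Suc i)) (occupation_moment_real M W i t)"
    and "0 < \<mu> \<Longrightarrow> 0 \<le> t \<Longrightarrow> occupation_moment_real M W i t \<le> exp (\<mu> * t) / prabhakar_exponent \<alpha> \<beta> \<gamma> \<omega> \<mu> ^ Suc i"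
proof -
  note rules = occupation_moment_real_mono has_bochner_integral_occupation_moment_real has_bochner_integral_hitting_time_power occupation_moment_real_le
  note rules = rules[where \<Psi> = "prabhakar_exponent \<alpha> \<beta> \<gamma> \<omega>", OF W]
  show "t \<le> t' \<Longrightarrow> occupation_moment_real M W i t \<le> occupation_moment_real M W i t'"
    by (rule rules(1)) (auto intro: lap[simplified] prabhakar_exponent_pos)
  show "0 < \<mu> \<Longrightarrow> has_bochner_integral lborel (\<lambda>t. indicator {0..} t * (exp (- \<mu> * t) * occupation_moment_real M W i t))
      (1 / (\<mu> * prabhakar_exponent \<alpha> \<beta> \<gamma> \<omega> \<mu> ^ Suc i))"
    by (rule rules(2)) (auto intro: lap[simplified] prabhakar_exponent_pos)
  show "hitting_time W t \<in> borel_measurable M \<Longrightarrow>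
      has_bochner_integral M (\<lambda>x. hitting_time W t x ^ Suc i / fact (Suc i)) (occupation_moment_real M W i t)"
    by (rule rules(3)) (auto intro: lap[simplified] prabhakar_exponent_pos)
  show "0 < \<mu> \<Longrightarrow> 0 \<le> t \<Longrightarrow> occupation_moment_real M W i t \<le> exp (\<mu> * t) / prabhakar_exponent \<alpha> \<beta> \<gamma> \<omega> \<mu> ^ Suc i"
    by (rule rules(4)) (auto intro: lap[simplified] prabhakar_exponent_pos)
qed

text \<open>Both sides have the same Laplace transform at all rates \<open>\<mu> + n\<close>, once
  \<open>\<mu>\<close> is large enough for the binomial expansion; one is monotone and the other
  continuous, as uniqueness requires.\<close>

lemma occupation_moment_real_eq_moment:
  assumes t: "0 \<le> t"
  shows "occupation_moment_real M W i t = prabhakar_moment \<alpha> \<beta> \<gamma> \<omega> (Suc i) t"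
proof -
  define c where "c t = (\<Sum>l. ml_term \<alpha> \<beta> (Suc i) (\<gamma> * real (Suc i)) (- \<omega>) l t)" for t
  have g: "0 \<le> \<gamma> * real (Suc i)" using pos by simp
  have cont: "continuous_on {0..} c" unfolding c_def
    by (rule continuous_on_ml_series[OF pos(1,2) g])
  obtain \<mu> where \<mu>: "0 < \<mu>" "\<And>\<mu>'. \<mu> \<le> \<mu>' \<Longrightarrow> \<bar>- \<omega>\<bar> * \<mu>' powr (- \<alpha>) < 1"
    using exists_large_rate[OF pos(1,2) g, of "- \<omega>"] by auto
  have hc: "has_bochner_integral lborel (\<lambda>t. indicator {0..} t * (exp (- (\<mu> + real n) * t) * c t))
      (1 / ((\<mu> + real n) * prabhakar_exponent \<alpha> \<beta> \<gamma> \<omega> (\<mu> + real n) ^ Suc i))" for n :: nat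
  proof -
    have "0 < \<mu> + real n" using \<mu>(1) by simp
    from prabhakar_exponent_power[OF this, of "Suc i"] show ?thesis
      using laplace_ml_series[OF pos(1,2) g \<open>0 < \<mu> + real n\<close> \<mu>(2), of "Suc i"] unfolding c_def by simp
  qed
  have hm: "has_bochner_integral lborel (\<lambda>t. indicator {0..} t * (exp (- (\<mu> + real n) * t) * occupation_moment_real M W i t))
      (1 / ((\<mu> + real n) * prabhakar_exponent \<alpha> \<beta> \<gamma> \<omega> (\<mu> + real n) ^ Suc i))" for n :: nat
    by (rule prabhakar_occupation_moment(2)) (use \<mu>(1) in auto)
  have eq: "occupation_moment_real M W i s = c s" if "0 < s" for s
    by (rule laplace_transform_unique[OF _ cont _ _ _ that, where \<mu> = \<mu>])
      (use hc hm prabhakar_occupation_moment(1) in \<open>auto simp only: has_bochner_integral_iff\<close>)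
  show ?thesis
  proof (cases "t = 0")
    case False
    with t have "0 < t" by simp
    then show ?thesis
      using eq[OF \<open>0 < t\<close>] gen_mittag_leffler_eq_suminf[OF pos(1,2) g \<open>0 < t\<close>, of "Suc i" "- \<omega>"]
      by (simp only: c_def prabhakar_moment_def)
  next
    \<comment> \<open>Uniqueness covers positive times only. At zero the moment is squeezed: it is
      at most \<open>c s\<close> for small \<open>s > 0\<close>, and \<open>c s\<close> tends to
      \<open>c 0\<close>, which vanishes because the power \<open>Suc i\<close> is positive.\<close>
    case True
    have c0: "c 0 = 0" unfolding c_def by (simp add: ml_term_def)
    have "continuous (at 0 within {0..}) c" using cont by (simp add: continuous_on_eq_continuous_within)
    then have "continuous (at_right 0) c" by (rule continuous_within_subset) auto
    then have "(c \<longlongrightarrow> 0) (at_right 0)" using c0 by (simp add: continuous_within)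
    moreover have "eventually (\<lambda>s. occupation_moment_real M W i 0 \<le> c s) (at_right 0)"
    proof (rule eventually_at_rightI[of 0 1])
      show "occupation_moment_real M W i 0 \<le> c s" if "s \<in> {0<..<1}" for s
        using prabhakar_occupation_moment(1)[of 0 s i] eq[of s] that by simp
    qed simp
    ultimately have "occupation_moment_real M W i 0 \<le> 0" by (rule tendsto_lowerbound) simp
    then show ?thesis using occupation_moment_real_nonneg[of M W i 0] True by (simp add: prabhakar_moment_def)
  qed
qed

section \<open>Moments and Laplace transform of the hitting time at a fixed level\<close>

context
  fixes t :: real
  assumes t: "0 \<le> t" and U: "hitting_time W t \<in> borel_measurable M"
begin

lemma has_bochner_integral_hitting_time_moment:
  "has_bochner_integral M (\<lambda>x. hitting_time W t x ^ j / fact j) (prabhakar_moment \<alpha> \<beta> \<gamma> \<omega> j t)"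
proof (cases j)
  \<comment> \<open>Occupation moments start at \<open>j = 1\<close>. For \<open>j = 0\<close> the
    Pochhammer symbol of \<open>0\<close> leaves only the leading term of the Mittag-Leffler
    series.\<close>
  case 0
  have "gen_mittag_leffler \<alpha> 1 0 z = 1" for z
  proof -
    have "(\<lambda>i. z ^ i * pochhammer 0 i / fact i * rGamma (\<alpha> * real i + 1)) sums
      (\<Sum>i\<in>{0}. z ^ i * pochhammer 0 i / fact i * rGamma (\<alpha> * real i + 1))"
      by (rule sums_finite) (auto simp: pochhammer_0_left)
    then show ?thesis by (simp add: gen_mittag_leffler_def sums_iff)
  qed
  then show ?thesis using 0
    by (simp add: prabhakar_moment_def has_bochner_integral_iff prob_space)
next
  case (Suc i)
  then show ?thesis using prabhakar_occupation_moment(3)[OF U, of i] occupation_moment_real_eq_moment[OF t, of i] by (simp only:)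
qed

lemma prabhakar_moment_nonneg: "0 \<le> prabhakar_moment \<alpha> \<beta> \<gamma> \<omega> j t"
proof -
  have "0 \<le> (\<integral>x. hitting_time W t x ^ j / fact j \<partial>M)"
    by (intro Bochner_Integration.integral_nonneg) (simp add: hitting_time_nonneg)
  then show ?thesis
    using has_bochner_integral_hitting_time_moment[of j] by (simp only: has_bochner_integral_iff)
qed

lemma prabhakar_moment_le:
  assumes "0 < \<mu>"
  shows "prabhakar_moment \<alpha> \<beta> \<gamma> \<omega> j t \<le> exp (\<mu> * t) / prabhakar_exponent \<alpha> \<beta> \<gamma> \<omega> \<mu> ^ j"
proof (cases j)
  case 0
  have "prabhakar_moment \<alpha> \<beta> \<gamma> \<omega> 0 t = 1"
    using has_bochner_integral_hitting_time_moment[of 0] by (simp add: has_bochner_integral_iff prob_space)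
  then show ?thesis using 0 assms t by simp
next
  case (Suc i)
  then show ?thesis using prabhakar_occupation_moment(4)[OF assms t, of i] occupation_moment_real_eq_moment[OF t, of i] by (simp only:)
qed

lemma summable_prabhakar_moment: "summable (\<lambda>j. \<bar>prabhakar_moment \<alpha> \<beta> \<gamma> \<omega> j t\<bar> * B ^ j)"
proof -
  \<comment> \<open>Chosen so that \<open>\<mu> powr \<beta> = 2 * \<bar>B\<bar> + 1\<close>; the
    exponent is at least that, so the ratio \<open>\<bar>B\<bar> / P\<close> is below one
    half.\<close>
  define \<mu> where "\<mu> = (2 * \<bar>B\<bar> + 1) powr (1 / \<beta>)"
  define P where "P = prabhakar_exponent \<alpha> \<beta> \<gamma> \<omega> \<mu>"
  have \<mu>: "0 < \<mu>" by (simp add: \<mu>_def)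
  have "\<mu> powr \<beta> = 2 * \<bar>B\<bar> + 1" using pos by (simp add: \<mu>_def powr_powr)
  then have P: "2 * \<bar>B\<bar> + 1 \<le> P" using prabhakar_exponent_ge[OF \<mu>] by (simp add: P_def)
  have "norm (\<bar>prabhakar_moment \<alpha> \<beta> \<gamma> \<omega> j t\<bar> * B ^ j) \<le> exp (\<mu> * t) * (\<bar>B\<bar> / P) ^ j" for j
  proof -
    have "\<bar>prabhakar_moment \<alpha> \<beta> \<gamma> \<omega> j t\<bar> * \<bar>B\<bar> ^ j \<le> exp (\<mu> * t) / P ^ j * \<bar>B\<bar> ^ j"
      using prabhakar_moment_le[OF \<mu>, of j] prabhakar_moment_nonneg[of j]
      by (intro mult_right_mono) (auto simp: P_def)
    then show ?thesis by (simp add: abs_mult power_abs power_divide)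
  qed
  moreover have "\<bar>\<bar>B\<bar> / P\<bar> < 1" using P by (simp add: abs_divide)
  ultimately show ?thesis
    by (intro summable_comparison_test'[OF summable_mult[OF summable_geometric], of "\<bar>B\<bar> / P" 0 _ "exp (\<mu> * t)"]) auto
qed

text \<open>The norms of the terms of the exponential series integrate to the same moments weighted
  by \<open>\<bar>q\<bar> ^ j\<close>. These are summable for every \<open>q\<close>, so sum and
  expectation commute.\<close>

lemma laplace_hitting_time:
  "(\<integral>x. exp (- q * hitting_time W t x) \<partial>M) = (\<Sum>j. prabhakar_moment \<alpha> \<beta> \<gamma> \<omega> j t * (- q) ^ j)"
proof -
  let ?U = "hitting_time W t"
  define f where "f j x = (- q) ^ j * (?U x ^ j / fact j)" for j x
  note hb = has_bochner_integral_hitting_time_moment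
  have int: "integrable M (f j)" for j
    unfolding f_def[abs_def] using hb[of j] by (intro integrable_mult_right) (simp add: has_bochner_integral_iff)
  have norm: "norm (f j x) = \<bar>q\<bar> ^ j * (?U x ^ j / fact j)" for j x
    using hitting_time_nonneg[of W t x] by (simp add: f_def abs_mult power_abs)
  have ser: "(\<lambda>j. a ^ j * (?U x ^ j / fact j)) sums exp (a * ?U x)" for a x
    using exp_converges[of "a * ?U x"] by (simp add: power_mult_distrib divide_inverse mult_ac)
  have "(\<integral>x. (\<Sum>j. f j x) \<partial>M) = (\<Sum>j. \<integral>x. f j x \<partial>M)"
  proof (rule integral_suminf[OF int])
    show "AE x in M. summable (\<lambda>j. norm (f j x))"
      unfolding norm using ser by (intro AE_I2) (auto simp: sums_iff)
    have "(\<integral>x. norm (f j x) \<partial>M) = \<bar>prabhakar_moment \<alpha> \<beta> \<gamma> \<omega> j t\<bar> * \<bar>q\<bar> ^ j" for j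
      unfolding norm using has_bochner_integral_mult_right[OF hb[of j], of "\<bar>q\<bar> ^ j"] prabhakar_moment_nonneg[of j]
      by (simp add: has_bochner_integral_iff mult.commute)
    then show "summable (\<lambda>j. \<integral>x. norm (f j x) \<partial>M)"
      using summable_prabhakar_moment[of "\<bar>q\<bar>"] by simp
  qed
  moreover have "(\<Sum>j. f j x) = exp (- q * ?U x)" for x
    unfolding f_def using ser[of "- q" x] by (rule sums_unique[symmetric])
  moreover have "(\<integral>x. f j x \<partial>M) = prabhakar_moment \<alpha> \<beta> \<gamma> \<omega> j t * (- q) ^ j" for j
    unfolding f_def using has_bochner_integral_mult_right[OF hb[of j], of "(- q) ^ j"]
    by (simp add: has_bochner_integral_iff mult.commute)
  ultimately show ?thesis by simp
qed

end
end
end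

section \<open>State probabilities\<close>

context prob_space
begin

text \<open>The weights satisfy
  \<open>c r powr (\<nu> * r) = (n choose r) * \<eta> ^ (n - r)\<close>, so the exponents add up to
  \<open>(\<eta> + \<theta> powr \<nu>) ^ n\<close> without its term \<open>\<eta> ^ n\<close> for
  \<open>r = 0\<close>. The tempering of \<open>T\<close> supplies this term, and its power
  \<open>\<delta> / n\<close> turns \<open>n\<close> into \<open>\<delta>\<close>.\<close>

lemma stable_sum_subordinated:
  fixes V :: "nat \<Rightarrow> real \<Rightarrow> 'a \<Rightarrow> real" and T :: "real \<Rightarrow> 'a \<Rightarrow> real"
  assumes n: "0 < n" and pos: "0 < \<eta>" "0 < \<nu>"
    and V: "\<And>r. r \<in> {1..n} \<Longrightarrow> stable_subordinator M (\<nu> * real r) (V r)"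
    and T: "subordinator M T"
      "has_laplace_exponent M T (\<lambda>\<mu>. (\<eta> ^ n + \<mu>) powr (\<delta> / real n) - \<eta> powr \<delta>)"
    and indep: "independent_processes M (insert None (Some ` {1..n})) (case_option T V)"
  defines "Y \<equiv> subordinated_stable_sum \<eta> \<nu> n V T"
  shows "increasing_paths_from_zero M Y"
    and "0 \<le> s \<Longrightarrow> 0 < \<theta> \<Longrightarrow> (\<integral>x. exp (- \<theta> * Y s x) \<partial>M) = exp (- s * ((\<eta> + \<theta> powr \<nu>) powr \<delta> - \<eta> powr \<delta>))"
proof -
  define c where "c r = real (n choose r) powr (1 / (\<nu> * real r)) * \<eta> powr (real (n - r) / (\<nu> * real r))" for r
  have c: "0 \<le> c r" for r by (simp add: c_def)
  have Y: "Y s x = (\<Sum>r=1..n. c r * V r (1 * T s x) x)" for s x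
    by (simp add: Y_def subordinated_stable_sum_def stable_sum_def c_def)
  have Vi: "increasing_paths_from_zero M (V r)" "has_laplace_exponent M (V r) (\<lambda>\<mu>. \<mu> powr (\<nu> * real r))"
    if "r \<in> {1..n}" for r
    using V[OF that] by (auto simp: stable_subordinator_def subordinator_def)
  have Ti: "increasing_paths_from_zero M T" using T(1) by (simp add: subordinator_def)
  show "increasing_paths_from_zero M Y"
    using increasing_paths_compose[OF increasing_paths_weighted_sum[of "{1..n}" V "\<lambda>_. 1" c, OF Vi(1)] Ti] c
    unfolding Y[abs_def] by simp
  assume s: "0 \<le> s" and \<theta>: "0 < \<theta>"
  define S where "S = (\<Sum>r=1..n. 1 * (\<theta> * c r) powr (\<nu> * real r))"
  have "(\<theta> * c r) powr (\<nu> * real r) = real (n choose r) * (\<theta> powr \<nu>) ^ r * \<eta> ^ (n - r)" if "r \<in> {1..n}" for r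
  proof -
    have "0 < \<nu> * real r" "0 < n choose r" using that pos by auto
    then show ?thesis
      using \<theta> pos that
      by (simp add: c_def powr_mult powr_powr powr_power powr_realpow mult_ac del: of_nat_diff)
  qed
  then have "S = (\<Sum>r=1..n. real (n choose r) * (\<theta> powr \<nu>) ^ r * \<eta> ^ (n - r))"
    unfolding S_def by (intro sum.cong) auto
  also have "\<dots> + \<eta> ^ n = (\<Sum>r\<le>n. real (n choose r) * (\<theta> powr \<nu>) ^ r * \<eta> ^ (n - r))"
    by (simp add: atMost_atLeast0 sum.atLeast_Suc_atMost)
  also have "\<dots> = (\<theta> powr \<nu> + \<eta>) ^ n" by (simp only: binomial_ring)
  finally have S: "\<eta> ^ n + S = (\<eta> + \<theta> powr \<nu>) ^ n" by (simp add: add.commute)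
  have S0: "0 \<le> S" unfolding S_def by (simp add: sum_nonneg)
  have "(\<integral>x. exp (- \<theta> * Y s x) \<partial>M) = (\<integral>x. exp (- T s x * S) \<partial>M)"
    unfolding Y S_def
    by (rule laplace_subordinated_weighted_sum[OF _ indep Vi Ti]) (use c s \<theta> in auto)
  also have "\<dots> = (\<integral>x. exp (- S * T s x) \<partial>M)" by (simp add: mult.commute)
  also have "\<dots> = exp (- s * ((\<eta> ^ n + S) powr (\<delta> / real n) - \<eta> powr \<delta>))"
    using T(2) s S0 unfolding has_laplace_exponent_def by blast
  also have "(\<eta> ^ n + S) powr (\<delta> / real n) = (\<eta> + \<theta> powr \<nu>) powr \<delta>"
  proof -
    have "0 < \<eta> + \<theta> powr \<nu>" using pos by (simp add: add_pos_nonneg)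
    then show ?thesis unfolding S using n by (simp add: powr_realpow[symmetric] powr_powr)
  qed
  finally show "(\<integral>x. exp (- \<theta> * Y s x) \<partial>M) = exp (- s * ((\<eta> + \<theta> powr \<nu>) powr \<delta> - \<eta> powr \<delta>))" .
qed

text \<open>Scaling time scales an exponent linearly, so the weights complete a binomial sum,
  \<open>\<mu> powr (\<beta> * q) * (1 + \<omega> * \<mu> powr (- \<alpha>)) ^ p\<close>. The power
  \<open>1 / q\<close> contributed by \<open>G\<close> turns \<open>\<beta> * q\<close> into
  \<open>\<beta>\<close> and \<open>p\<close> into \<open>\<gamma>\<close>.\<close>

lemma prabhakar_sum_subordinated:
  fixes V :: "nat \<Rightarrow> real \<Rightarrow> 'a \<Rightarrow> real" and G :: "real \<Rightarrow> 'a \<Rightarrow> real"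
  assumes pos: "0 < \<omega>" "0 \<le> \<gamma>"
    and V: "\<And>r. r \<in> {0..nat \<lceil>\<gamma>\<rceil>} \<Longrightarrow> stable_subordinator M (\<beta> * ceiling_ratio \<gamma> - real r * \<alpha>) (V r)"
    and G: "stable_subordinator M (1 / ceiling_ratio \<gamma>) G"
    and indep: "independent_processes M (insert None (Some ` {0..nat \<lceil>\<gamma>\<rceil>})) (case_option G V)"
  defines "W \<equiv> prabhakar_sum \<omega> \<gamma> V G"
  shows "increasing_paths_from_zero M W"
    and "0 \<le> s \<Longrightarrow> 0 < \<mu> \<Longrightarrow> (\<integral>x. exp (- \<mu> * W s x) \<partial>M) = exp (- s * prabhakar_exponent \<alpha> \<beta> \<gamma> \<omega> \<mu>)"
proof -
  define p where "p = nat \<lceil>\<gamma>\<rceil>"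
  define q where "q = ceiling_ratio \<gamma>"
  define b where "b r = real (p choose r) * \<omega> ^ r" for r
  have b: "0 \<le> b r" for r using pos by (simp add: b_def)
  have q: "0 < q" using G by (simp add: stable_subordinator_def q_def)
  \<comment> \<open>For \<open>\<gamma> = 0\<close> this reads \<open>0 = 0 * 1\<close>, by the
    convention in \<open>ceiling_ratio\<close>.\<close>
  have pq: "real p = \<gamma> * q"
    using pos by (auto simp: p_def q_def ceiling_ratio_def)
  have W: "W s x = (\<Sum>r\<in>{0..p}. 1 * V r (b r * G s x) x)" for s x
    by (simp add: W_def prabhakar_sum_def b_def p_def)
  have Vi: "increasing_paths_from_zero M (V r)" "has_laplace_exponent M (V r) (\<lambda>\<mu>. \<mu> powr (\<beta> * q - real r * \<alpha>))"
    if "r \<in> {0..p}" for r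
    using V[of r] that by (auto simp: stable_subordinator_def subordinator_def p_def q_def)
  have Gi: "increasing_paths_from_zero M G" "has_laplace_exponent M G (\<lambda>\<mu>. \<mu> powr (1 / q))"
    using G by (auto simp: stable_subordinator_def subordinator_def q_def)
  show "increasing_paths_from_zero M W"
    using increasing_paths_compose[OF increasing_paths_weighted_sum[of "{0..p}" V b "\<lambda>_. 1", OF Vi(1)] Gi(1)] b
    unfolding W[abs_def] by simp
  assume s: "0 \<le> s" and \<mu>: "0 < \<mu>"
  define S where "S = (\<Sum>r\<in>{0..p}. b r * (\<mu> * 1) powr (\<beta> * q - real r * \<alpha>))"
  have "S = (\<Sum>r\<le>p. \<mu> powr (\<beta> * q) * (real (p choose r) * (\<omega> * \<mu> powr (- \<alpha>)) ^ r * 1 ^ (p - r)))"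
    unfolding S_def atMost_atLeast0
  proof (rule sum.cong[OF refl])
    fix r
    have "\<mu> powr (\<beta> * q - real r * \<alpha>) = \<mu> powr (\<beta> * q) * (\<mu> powr (- \<alpha>)) ^ r"
      using \<mu> by (simp add: powr_power powr_add[symmetric] mult.commute)
    then show "b r * (\<mu> * 1) powr (\<beta> * q - real r * \<alpha>) =
        \<mu> powr (\<beta> * q) * (real (p choose r) * (\<omega> * \<mu> powr (- \<alpha>)) ^ r * 1 ^ (p - r))"
      by (simp add: b_def power_mult_distrib mult_ac)
  qed
  also have "\<dots> = \<mu> powr (\<beta> * q) * (\<omega> * \<mu> powr (- \<alpha>) + 1) ^ p"
    by (simp only: binomial_ring sum_distrib_left)
  finally have S: "S = \<mu> powr (\<beta> * q) * (1 + \<omega> * \<mu> powr (- \<alpha>)) ^ p" by (simp add: add.commute)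
  have o: "0 < 1 + \<omega> * \<mu> powr (- \<alpha>)" using pos by (simp add: add_pos_nonneg)
  have S0: "0 \<le> S" using o by (simp add: S)
  have "(\<integral>x. exp (- \<mu> * W s x) \<partial>M) = (\<integral>x. exp (- G s x * S) \<partial>M)"
    unfolding W S_def
    by (rule laplace_subordinated_weighted_sum[OF _ indep[folded p_def] Vi Gi(1)]) (use b s \<mu> in auto)
  also have "\<dots> = (\<integral>x. exp (- S * G s x) \<partial>M)" by (simp add: mult.commute)
  also have "\<dots> = exp (- s * (S powr (1 / q)))"
    using Gi(2) s S0 unfolding has_laplace_exponent_def by blast
  also have "S powr (1 / q) = prabhakar_exponent \<alpha> \<beta> \<gamma> \<omega> \<mu>"
    unfolding S prabhakar_exponent_def powr_realpow[OF o, symmetric] using q o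
    by (simp add: powr_mult powr_powr pq)
  finally show "(\<integral>x. exp (- \<mu> * W s x) \<partial>M) = exp (- s * prabhakar_exponent \<alpha> \<beta> \<gamma> \<omega> \<mu>)" .
qed

end

text \<open>Convergence of the series over \<open>j\<close> is part of the claim, through
  \<open>sums\<close>; it follows from the decay of the moments of the hitting time.\<close>

theorem theorem3p3:
  fixes M :: "'a measure"
    and \<delta> \<eta> rate \<nu> \<omega> \<gamma> \<alpha> \<beta> t :: real
    and V Vw :: "nat \<Rightarrow> real \<Rightarrow> 'a \<Rightarrow> real"
    and T G W U Y :: "real \<Rightarrow> 'a \<Rightarrow> real"
    and N :: "real \<Rightarrow> 'a \<Rightarrow> nat"
    and n k :: nat
  assumes M: "prob_space M"
    and parameters: "0 < \<delta>" "0 < \<eta>" "0 < rate" "0 < \<omega>" "0 \<le> \<gamma>"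
      "0 < \<alpha>" "\<alpha> \<le> 1" "0 < \<beta>" "\<beta> \<le> 1"
    and n: "n = nat \<lceil>\<delta>\<rceil>"
    and \<nu>: "0 < \<nu> * real n" "\<nu> * real n < 1"
    and orders: "\<And>r. \<gamma> \<noteq> 0 \<Longrightarrow> r \<le> nat \<lceil>\<gamma>\<rceil> \<Longrightarrow>
        0 < \<beta> * real_of_int \<lceil>\<gamma>\<rceil> / \<gamma> - real r * \<alpha> \<and>
        \<beta> * real_of_int \<lceil>\<gamma>\<rceil> / \<gamma> - real r * \<alpha> < 1"
    \<comment> \<open>the process Y, subordinating the Poisson process\<close>
    and V: "\<And>r. r \<in> {1..n} \<Longrightarrow> stable_subordinator M (\<nu> * real r) (V r)"
    and T: "subordinator M T"
      "has_laplace_exponent M T (\<lambda>\<mu>. (\<eta> ^ n + \<mu>) powr (\<delta> / real n) - \<eta> powr \<delta>)"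
    and indep_V_T: "independent_processes M (insert None (Some ` {1..n})) (case_option T V)"
    and Y: "Y = subordinated_stable_sum \<eta> \<nu> n V T"
    \<comment> \<open>the hitting-time process U\<close>
    and Vw: "\<And>r. r \<in> {0..nat \<lceil>\<gamma>\<rceil>} \<Longrightarrow>
        stable_subordinator M (\<beta> * ceiling_ratio \<gamma> - real r * \<alpha>) (Vw r)"
    and G: "stable_subordinator M (1 / ceiling_ratio \<gamma>) G"
    and indep_Vw_G:
      "independent_processes M (insert None (Some ` {0..nat \<lceil>\<gamma>\<rceil>})) (case_option G Vw)"
    and W: "W = prabhakar_sum \<omega> \<gamma> Vw G"
    and U: "U = hitting_time W"
    \<comment> \<open>the Poisson process\<close>
    and N: "poisson_process M rate N"
    and indep_N_Y: "independent_process_pair M (\<lambda>s x. real (N s x)) Y"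
    and indep_NY_U: "independent_process_pair M (\<lambda>s x. real (N (Y s x) x)) U"
    and t: "0 \<le> t"
    \<comment> \<open>the innermost series on the right-hand side converge\<close>
    and convergence: "\<And>r. summable (inner_term \<delta> \<eta> \<nu> rate k r)"
  shows "(\<lambda>j. (- 1) ^ k / fact k *
            ((- (t powr \<beta>)) ^ j
             * gen_mittag_leffler \<alpha> (\<beta> * real j + 1) (\<gamma> * real j) (- \<omega> * t powr \<alpha>)
             * (\<Sum>r=0..j. real (j choose r) * (- (\<eta> powr \<delta>)) ^ (j - r)
                  * (\<Sum>m. inner_term \<delta> \<eta> \<nu> rate k r m))))
         sums measure M {x \<in> space M. N (Y (U t x) x) x = k}"
proof -
  interpret prob_space M by (rule M)
  have n0: "0 < n" using n parameters(1) by simp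
  have \<nu>0: "0 < \<nu>" using \<nu>(1) n0 by (simp add: zero_less_mult_iff)
  have "\<nu> * 1 \<le> \<nu> * real n" using \<nu>0 n0 by (intro mult_left_mono) auto
  then have \<nu>1: "\<nu> \<le> 1" using \<nu>(2) by simp
  have Yi: "increasing_paths_from_zero M Y"
    unfolding Y by (rule stable_sum_subordinated(1)[OF n0 parameters(2) \<nu>0 _ T indep_V_T]) (rule V)
  have lapY: "(\<integral>x. exp (- \<theta> * Y s x) \<partial>M) = exp (- s * ((\<eta> + \<theta> powr \<nu>) powr \<delta> - \<eta> powr \<delta>))"
    if "0 \<le> s" "0 < \<theta>" for s \<theta>
    unfolding Y by (rule stable_sum_subordinated(2)[OF n0 parameters(2) \<nu>0 _ T indep_V_T that]) (rule V)
  have Wi: "increasing_paths_from_zero M W"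
    unfolding W by (rule prabhakar_sum_subordinated(1)[OF parameters(4,5) _ G indep_Vw_G]) (rule Vw)
  have lapW: "(\<integral>x. exp (- \<mu> * W s x) \<partial>M) = exp (- s * prabhakar_exponent \<alpha> \<beta> \<gamma> \<omega> \<mu>)"
    if "0 \<le> s" "0 < \<mu>" for s \<mu>
    unfolding W by (rule prabhakar_sum_subordinated(2)[OF parameters(4,5) _ G indep_Vw_G that]) (rule Vw)
  have Ni: "increasing_paths_from_zero M (\<lambda>t x. real (N t x))"
    using N by (simp add: poisson_process_def)
  \<comment> \<open>A real-valued copy of the counting process, to which the results on
    right-continuous real processes apply.\<close>
  define X where "X s x = real (N (Y s x) x)" for s x
  have Xi: "increasing_paths_from_zero M X"
    unfolding X_def[abs_def] by (rule increasing_paths_compose[OF Ni Yi])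
  define \<phi> where "\<phi> \<mu> = (\<eta> + \<mu> powr \<nu>) powr \<delta> - \<eta> powr \<delta>" for \<mu>
  have lapX: "(\<integral>x. exp (- \<theta> * X s x) \<partial>M) = exp (- s * \<phi> (rate * (1 - exp (- \<theta>))))"
    if s: "0 \<le> s" and \<theta>: "0 < \<theta>" for s \<theta>
  proof -
    have "(\<integral>x. exp (- \<theta> * X s x) \<partial>M) = (\<integral>x. exp (- Y s x * (rate * (1 - exp (- \<theta>)))) \<partial>M)"
      unfolding X_def
      by (rule laplace_at_indep_var_time[OF Ni, of "Y s"])
        (use \<theta> s increasing_paths_from_zeroD(5)[OF Yi] independent_process_pairD[OF indep_N_Y]
          laplace_poisson_process[OF M N parameters(3)] in auto)
    also have "\<dots> = (\<integral>x. exp (- (rate * (1 - exp (- \<theta>))) * Y s x) \<partial>M)" by (simp add: mult.commute)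
    also have "\<dots> = exp (- s * \<phi> (rate * (1 - exp (- \<theta>))))"
      unfolding \<phi>_def by (rule lapY[OF s]) (use \<theta> parameters(3) in auto)
    finally show ?thesis .
  qed
  have indXU: "indep_var borel (X s) borel (U t)" if "0 \<le> s" for s
    using independent_process_pairD[OF indep_NY_U that t] unfolding X_def[abs_def] .
  \<comment> \<open>Independence of \<open>U\<close> includes the measurability of its path, hence
    of \<open>U t\<close>.\<close>
  have Um: "U t \<in> borel_measurable M" using indep_var_rv2[OF indXU[of 0]] by simp
  have U0: "0 \<le> U t x" for x by (simp add: U hitting_time_nonneg)
  define J where "J x = N (Y (U t x) x) x" for x
  have "(\<lambda>x. X (U t x) x) \<in> borel_measurable M"
    by (rule right_continuous_process_at_random_time[OF increasing_paths_from_zeroD(1,4)[OF Xi] Um U0])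
  then have Jm: "J \<in> measurable M (count_space UNIV)"
    unfolding J_def[abs_def] X_def by (rule measurable_nat_of_real_measurable)
  define p where "p k = prob {x \<in> space M. J x = k}" for k
  define c where "c j = prabhakar_moment \<alpha> \<beta> \<gamma> \<omega> j t" for j
  have pgf: "(\<Sum>k. p k * z ^ k) = (\<Sum>j. c j * (- \<phi> (rate * (1 - z))) ^ j)" if z: "0 < z" "z < 1" for z
  proof -
    \<comment> \<open>The generating function at \<open>z\<close> is the Laplace transform at
      \<open>- ln z\<close>, which is positive because \<open>z < 1\<close>.\<close>
    define \<theta> where "\<theta> = - ln z"
    have \<theta>: "0 < \<theta>" and e: "exp (- \<theta>) = z" using z by (auto simp: \<theta>_def)
    have "(\<Sum>k. p k * z ^ k) = (\<integral>x. z ^ J x \<partial>M)"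
      unfolding p_def using integral_geometric_of_nat_rv[OF Jm, of z] z by (simp add: sums_iff)
    also have "\<dots> = (\<integral>x. exp (- \<theta> * X (U t x) x) \<partial>M)"
      by (simp add: X_def J_def e[symmetric] exp_of_nat_mult[symmetric] mult.commute)
    also have "\<dots> = (\<integral>x. exp (- U t x * \<phi> (rate * (1 - exp (- \<theta>)))) \<partial>M)"
      by (rule laplace_at_indep_var_time[OF Xi U0 _ indXU lapX]) (use \<theta> in auto)
    also have "\<dots> = (\<integral>x. exp (- \<phi> (rate * (1 - z)) * hitting_time W t x) \<partial>M)"
      by (simp add: e U mult.commute)
    also have "\<dots> = (\<Sum>j. c j * (- \<phi> (rate * (1 - z))) ^ j)"
      unfolding c_def
      by (rule laplace_hitting_time[OF Wi lapW parameters(6,8,5,4) t Um[unfolded U]])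
    finally show ?thesis .
  qed
  have "summable p"
    using integral_geometric_of_nat_rv[OF Jm, of 1] by (simp add: p_def[abs_def] sums_iff)
  moreover have "summable (\<lambda>j. \<bar>c j\<bar> * B ^ j)" for B
    unfolding c_def
    by (rule summable_prabhakar_moment[OF Wi lapW parameters(6,8,5,4) t Um[unfolded U]])
  ultimately have "(\<lambda>j. (- 1) ^ k / fact k * ((- 1) ^ j * c j *
      (\<Sum>r=0..j. real (j choose r) * (- (\<eta> powr \<delta>)) ^ (j - r) * (\<Sum>m. inner_term \<delta> \<eta> \<nu> rate k r m))))
    sums p k"
    by (rule generating_function_expansion[OF parameters(2,3) \<nu>0 \<nu>1 _ _ pgf[unfolded \<phi>_def] convergence])
  moreover have "(- 1) ^ j * c j = (- (t powr \<beta>)) ^ j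
             * gen_mittag_leffler \<alpha> (\<beta> * real j + 1) (\<gamma> * real j) (- \<omega> * t powr \<alpha>)" for j
    unfolding c_def prabhakar_moment_def by (subst power_minus[of "t powr \<beta>"]) simp
  ultimately show ?thesis unfolding p_def J_def by simp
qed

end
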